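(* Let $n\ge 1$, $r\in\{0,1,\ldots,n-1\}$, and let $q$ be an integer with $r\le q\le n-r-1$. Let $D\subset\mathbb{C}^n$ be an unbounded domain which has an $r$-peak point at each of its boundary points. Let $f:\partial D\to\mathbb{R}$ be continuous with $0\le f\le \sup_{\partial D} f\le M$ for some constant $M<+\infty$. Then there exists an almost $q$-Bremermann function $\Phi=\Phi_M$ on $\overline{D}$ such that: (1) $\Phi=f$ on $\partial D$, and $0\le\Phi\le M$ on $\overline{D}$. (2) $\Phi$ is $q$-maximal with respect to $q$-plurisubharmonic functions $\psi$ with $\psi\le f$ on $\partial D$ and $\psi\le M$ on $\overline{D}$; that is, every $\psi\in\mathcal{PSH}_q(D)\cap\mathcal{USC}(\overline{D})$ with $\psi\le f$ on $\partial D$ and $\psi\le M$ on $\overline{D}$ satisfies $\psi\le\Phi$ on $\overline{D}$. Therefore $\mathcal{P}_{f,q,D,M}\le\Phi$ on $\overline{D}$. (3) $\Phi$ (as a function on $\overline{D}$) is continuous at every point of $\partial D$. (4) If $D$ is of bounded type, then $\Phi$ is continuous and $q$-Bremermann on $\overline{D}$. Thus $\Phi=\mathcal{P}_{f,q,D,M_0}$ on $\overline{D}$ for $M_0:=\sup_{\partial D} f$. (5) If $D$ is of bounded type, then $\Phi$ is the unique $q$-Bremermann function on $\overline{D}$ with $\Phi=f$ on $\partial D$.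
   Context: A domain is a nonempty connected open set. For $A\subset\mathbb{C}^n$, $\mathcal{USC}(A)$ is the set of upper semi-continuous functions $A\to[-\infty,+\infty)$ and $\mathcal{C}(A)$ the set of real-valued continuous functions on $A$; $B_R(0)$ is the ball of radius $R$ centered at $0$. $q$-plurisubharmonic: Let $U\subset\mathbb{C}^n$ be open and $q\in\{0,\ldots,n-1\}$. An upper semi-continuous function $\psi:U\to[-\infty,+\infty)$ is $q$-plurisubharmonic on $U$ if for every complex $(q+1)$-dimensional affine subspace $\Pi\subset\mathbb{C}^n$, every ball $B$ with $\overline{B}\subset U$ compact, and every pluriharmonic function $h$ defined on an open neighbourhood of $\overline{B}$ with $\psi\le h$ on $\partial B\cap\Pi$, one has $\psi\le h$ on $\overline{B}\cap\Pi$. $\mathcal{PSH}_q(U)$ denotes the set of all such functions; $\mathcal{PSH}(U)=\mathcal{PSH}_0(U)$ are the plurisubharmonic functions. For a real-valued function $F$ on a set $A\subset\mathbb{C}^n$, $F^*(z)=\limsup_{\zeta\to z}F(\zeta)$ and $F_*(z)=\liminf_{\zeta\to z}F(\zeta)$ are the upper and lower semi-continuous regularizations on $A$ (limits over $\zeta\in A$, $\zeta=z$ allowed, so $F_*\le F\le F^*$). Let $A^\circ$ denote the interior of $A$. $F:A\to\mathbb{R}$ is almost $q$-Bremermann on $A$ if $F^*\in\mathcal{PSH}_q(A^\circ)$ and $-F_*\in\mathcal{PSH}_{n-q-1}(A^\circ)$. $F$ is $q$-Bremermann on $A$ if it is continuous on $A$ and almost $q$-Bremermann on $A^\circ$. These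 notions are used with $A=\overline{D}$. $r$-peak point: $D$ has an $r$-peak point at $p\in\partial D$ if there is $\psi\in\mathcal{PSH}_r(D)\cap\mathcal{C}(\overline{D})$ with $\psi(p)=0$ and $\psi<0$ on $\overline{D}\setminus\{p\}$. $q$-Perron-Bremermann envelope: for a constant $M$ with $\sup_{\partial D}f\le M\le+\infty$ and $z\in\overline{D}$, $$\mathcal{P}_{f,q,D,M}(z)=\sup\{\psi(z):\psi\in\mathcal{PSH}_q(D)\cap\mathcal{C}(\overline{D}),\ \psi\le f\text{ on }\partial D,\ \psi\le M\text{ on }\overline{D}\}.$$ Bounded type: an unbounded domain $D\subset\mathbb{C}^n$ is of bounded type if there exists $\Psi\in\mathcal{PSH}(D)\cap\mathcal{C}(D)$ with $\Psi<0$ on $D$ and $\Psi(z)\to-\infty$ as $|z|\to+\infty$, i.e. for every $C\ge0$ there is $R>0$ with $\Psi<-C$ on $D\setminus B_R(0)$.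
   Formalization: The (almost) q-Bremermann conditions are imposed on D rather than on the interior of its closure (the claim fails for the slit plane), and uniqueness in (5) is among bounded q-Bremermann functions (on the half-plane, 0 and Re z both vanish on the boundary). *)

theory Defs
  imports "HOL-Analysis.Analysis"
begin

text \<open>
  \<open>\<complex>\<^sup>n\<close> is \<^typ>\<open>complex^'n\<close> with \<open>n = CARD('n)\<close>; its library norm is the Euclidean one.
  Functions to \<open>[-\<infinity>, +\<infinity>)\<close> are \<^typ>\<open>ereal\<close>-valued functions that avoid \<open>\<infinity>\<close> on the set under
  consideration. Values outside that set are irrelevant.
\<close>

definition usc_on :: "('a::topological_space) set \<Rightarrow> ('a \<Rightarrow> ereal) \<Rightarrow> bool" where
  "usc_on A \<psi> \<longleftrightarrow> (\<forall>z\<in>A. \<psi> z < \<infinity> \<and> (\<forall>c. \<psi> z < c \<longrightarrow> (\<forall>\<^sub>F w in at z within A. \<psi> w < c)))"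

definition complex_affine_subspace :: "nat \<Rightarrow> (complex^'n) set \<Rightarrow> bool" where
  "complex_affine_subspace k P \<longleftrightarrow>
     (\<exists>a V. vec.subspace V \<and> vec.dim V = k \<and> P = (\<lambda>v. a + v) ` V)"

text \<open>
  Pluriharmonic: of class \<open>C\<^sup>2\<close> and harmonic along every complex line. Here \<open>h1\<close> and \<open>h2\<close> are the
  first two real derivatives of \<open>h\<close>, and the last condition says that the Laplacian at
  \<open>0\<close> of \<open>\<zeta> \<mapsto> h (x + \<zeta> v)\<close> vanishes for all \<open>x\<close> and \<open>v\<close>.
\<close>
definition pluriharmonic_on :: "(complex^'n) set \<Rightarrow> (complex^'n \<Rightarrow> real) \<Rightarrow> bool" where
  "pluriharmonic_on W h \<longleftrightarrow>
     (\<exists>(h1 :: complex^'n \<Rightarrow> (complex^'n) \<Rightarrow>\<^sub>L real)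
       (h2 :: complex^'n \<Rightarrow> (complex^'n) \<Rightarrow>\<^sub>L (complex^'n) \<Rightarrow>\<^sub>L real).
        (\<forall>x\<in>W. (h has_derivative blinfun_apply (h1 x)) (at x)) \<and>
        (\<forall>x\<in>W. (h1 has_derivative blinfun_apply (h2 x)) (at x)) \<and>
        continuous_on W h2 \<and>
        (\<forall>x\<in>W. \<forall>v. blinfun_apply (blinfun_apply (h2 x) v) v
                   + blinfun_apply (blinfun_apply (h2 x) (\<i> *s v)) (\<i> *s v) = 0))"

definition q_psh :: "nat \<Rightarrow> (complex^'n) set \<Rightarrow> (complex^'n \<Rightarrow> ereal) \<Rightarrow> bool" where
  "q_psh q U \<psi> \<longleftrightarrow>
     open U \<and> q < CARD('n) \<and> usc_on U \<psi> \<and>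
     (\<forall>P c \<rho> W h.
        complex_affine_subspace (q + 1) P \<and> 0 < \<rho> \<and> cball c \<rho> \<subseteq> U \<and>
        open W \<and> cball c \<rho> \<subseteq> W \<and> pluriharmonic_on W h \<and>
        (\<forall>z\<in>sphere c \<rho> \<inter> P. \<psi> z \<le> ereal (h z))
        \<longrightarrow> (\<forall>z\<in>cball c \<rho> \<inter> P. \<psi> z \<le> ereal (h z)))"

text \<open>
  The filter \<open>inf (nhds z) (principal A)\<close> is \<open>\<zeta> \<rightarrow> z\<close> with \<open>\<zeta> \<in> A\<close>, where \<open>\<zeta> = z\<close> is allowed.
\<close>
definition usc_reg :: "(complex^'n) set \<Rightarrow> (complex^'n \<Rightarrow> real) \<Rightarrow> complex^'n \<Rightarrow> ereal" where
  "usc_reg A F z = Limsup (inf (nhds z) (principal A)) (\<lambda>\<zeta>. ereal (F \<zeta>))"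

definition lsc_reg :: "(complex^'n) set \<Rightarrow> (complex^'n \<Rightarrow> real) \<Rightarrow> complex^'n \<Rightarrow> ereal" where
  "lsc_reg A F z = Liminf (inf (nhds z) (principal A)) (\<lambda>\<zeta>. ereal (F \<zeta>))"

definition almost_bremermann :: "nat \<Rightarrow> (complex^'n) set \<Rightarrow> (complex^'n \<Rightarrow> real) \<Rightarrow> bool" where
  "almost_bremermann q A F \<longleftrightarrow>
     q < CARD('n) \<and>
     q_psh q (interior A) (usc_reg A F) \<and>
     q_psh (CARD('n) - q - 1) (interior A) (\<lambda>z. - lsc_reg A F z)"

definition bremermann :: "nat \<Rightarrow> (complex^'n) set \<Rightarrow> (complex^'n \<Rightarrow> real) \<Rightarrow> bool" where
  "bremermann q A F \<longleftrightarrow> continuous_on A F \<and> almost_bremermann q (interior A) F"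

text \<open>
  The notions for the closure of a domain \<open>D\<close>: the plurisubharmonicity conditions live on \<open>D\<close>.
  If \<open>interior (closure D) = D\<close> this is exactly \<^const>\<open>almost_bremermann\<close> and
  \<^const>\<open>bremermann\<close> at \<open>A = closure D\<close>, as proved below. If \<open>D\<close> is strictly smaller than
  \<open>interior (closure D)\<close> (slit domains), conditions on the latter set would also restrict the
  boundary data on the slit: for \<open>D\<close> the complex plane minus the closed negative half-axis they
  would make every bounded solution constant.
\<close>
definition almost_bremermann_closure ::
    "nat \<Rightarrow> (complex^'n) set \<Rightarrow> (complex^'n \<Rightarrow> real) \<Rightarrow> bool" where
  "almost_bremermann_closure q D F \<longleftrightarrow>
     q < CARD('n) \<and>
     q_psh q D (usc_reg (closure D) F) \<and>
     q_psh (CARD('n) - q - 1) D (\<lambda>z. - lsc_reg (closure D) F z)"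

definition bremermann_closure ::
    "nat \<Rightarrow> (complex^'n) set \<Rightarrow> (complex^'n \<Rightarrow> real) \<Rightarrow> bool" where
  "bremermann_closure q D F \<longleftrightarrow> continuous_on (closure D) F \<and> almost_bremermann_closure q D F"

lemma inf_nhds_principal_interior:
  assumes "z \<in> interior A"
  shows "inf (nhds z) (principal A) = nhds z"
proof -
  have "\<forall>\<^sub>F x in nhds z. x \<in> A"
    using eventually_nhds_in_open[OF open_interior assms]
    by (rule eventually_mono) (use interior_subset in blast)
  then have "nhds z \<le> principal A"
    by (simp add: le_principal)
  then show ?thesis
    by (simp add: inf_absorb1)
qed

lemma usc_on_cong:
  assumes "\<And>z. z \<in> A \<Longrightarrow> \<phi> z = \<psi> z"
  shows "usc_on A \<phi> \<longleftrightarrow> usc_on A \<psi>"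
proof -
  have "(\<forall>\<^sub>F w in at z within A. \<phi> w < c) \<longleftrightarrow> (\<forall>\<^sub>F w in at z within A. \<psi> w < c)" for z c
    using assms by (simp add: eventually_at_filter cong: imp_cong)
  then show ?thesis
    using assms by (simp add: usc_on_def)
qed

lemma q_psh_cong:
  fixes U :: "(complex^'n) set"
  assumes "\<And>z. z \<in> U \<Longrightarrow> \<phi> z = \<psi> z"
  shows "q_psh q U \<phi> \<longleftrightarrow> q_psh q U \<psi>"
proof -
  have imp: "q_psh q U \<psi>" if eq: "\<And>z. z \<in> U \<Longrightarrow> \<phi> z = \<psi> z" and psh: "q_psh q U \<phi>"
    for \<phi> \<psi> :: "complex^'n \<Rightarrow> ereal"
    unfolding q_psh_def
  proof (intro conjI allI impI)
    show "open U" "q < CARD('n)"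
      using psh by (auto simp: q_psh_def)
    show "usc_on U \<psi>"
      using psh usc_on_cong[of U \<phi> \<psi>] eq by (auto simp: q_psh_def)
    fix P c \<rho> W h
    assume H: "complex_affine_subspace (q + 1) P \<and> 0 < \<rho> \<and> cball c \<rho> \<subseteq> U \<and>
        open W \<and> cball c \<rho> \<subseteq> W \<and> pluriharmonic_on W h \<and>
        (\<forall>z\<in>sphere c \<rho> \<inter> P. \<psi> z \<le> ereal (h z))"
    then have sub: "cball c \<rho> \<subseteq> U" by blast
    then have e: "\<phi> z = \<psi> z" if "z \<in> cball c \<rho>" for z
      using that eq by blast
    then have "\<forall>z\<in>sphere c \<rho> \<inter> P. \<phi> z \<le> ereal (h z)"
      using H sphere_cball by fastforce
    with H psh have "\<forall>z\<in>cball c \<rho> \<inter> P. \<phi> z \<le> ereal (h z)"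
      unfolding q_psh_def by blast
    then show "\<forall>z\<in>cball c \<rho> \<inter> P. \<psi> z \<le> ereal (h z)"
      using e by auto
  qed
  show ?thesis
    using imp[of \<phi> \<psi>] imp[of \<psi> \<phi>] assms by auto
qed

lemma almost_bremermann_closure_eq:
  assumes "open D"
  shows "almost_bremermann_closure q D F \<longleftrightarrow> almost_bremermann q D F"
proof -
  have "z \<in> interior D \<and> z \<in> interior (closure D)" if "z \<in> D" for z
    using that assms interior_maximal[OF closure_subset assms] by (auto simp: interior_open)
  then have "usc_reg (closure D) F z = usc_reg D F z" "lsc_reg (closure D) F z = lsc_reg D F z"
    if "z \<in> D" for z
    using that by (simp_all add: usc_reg_def lsc_reg_def inf_nhds_principal_interior)
  then show ?thesis
    using q_psh_cong[of D "usc_reg (closure D) F" "usc_reg D F"]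
      q_psh_cong[of D "\<lambda>z. - lsc_reg (closure D) F z" "\<lambda>z. - lsc_reg D F z"] assms
    by (simp add: almost_bremermann_closure_def almost_bremermann_def interior_open)
qed

lemma almost_bremermann_closure_regular:
  assumes "interior (closure D) = D"
  shows "almost_bremermann_closure q D F \<longleftrightarrow> almost_bremermann q (closure D) F"
  using assms by (simp add: almost_bremermann_closure_def almost_bremermann_def)

lemma bremermann_closure_regular:
  assumes "interior (closure D) = D"
  shows "bremermann_closure q D F \<longleftrightarrow> bremermann q (closure D) F"
proof -
  have "open D"
    using assms open_interior by metis
  then show ?thesis
    using assms by (simp add: bremermann_closure_def bremermann_def almost_bremermann_closure_eq)
qed

definition peak_point :: "nat \<Rightarrow> (complex^'n) set \<Rightarrow> complex^'n \<Rightarrow> bool" where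
  "peak_point r D p \<longleftrightarrow>
     (\<exists>\<psi> :: complex^'n \<Rightarrow> real.
        q_psh r D (\<lambda>z. ereal (\<psi> z)) \<and> continuous_on (closure D) \<psi> \<and>
        \<psi> p = 0 \<and> (\<forall>z\<in>closure D - {p}. \<psi> z < 0))"

definition perron_bremermann ::
    "(complex^'n \<Rightarrow> real) \<Rightarrow> nat \<Rightarrow> (complex^'n) set \<Rightarrow> ereal \<Rightarrow> complex^'n \<Rightarrow> ereal" where
  "perron_bremermann f q D M z =
     (SUP \<psi> \<in> {\<psi> :: complex^'n \<Rightarrow> real.
                q_psh q D (\<lambda>w. ereal (\<psi> w)) \<and> continuous_on (closure D) \<psi> \<and>
                (\<forall>w\<in>frontier D. \<psi> w \<le> f w) \<and> (\<forall>w\<in>closure D. ereal (\<psi> w) \<le> M)}.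
        ereal (\<psi> z))"

text \<open>
  The right half-plane is of bounded type (take \<open>\<Psi> z = - ln (cmod (z + 1))\<close>), and both \<open>0\<close> and
  \<open>Re z\<close> are \<open>0\<close>-Bremermann there with zero boundary values. Boundary values therefore determine
  a \<open>q\<close>-Bremermann function on a domain of bounded type only among bounded functions.
\<close>
definition bounded_type :: "(complex^'n) set \<Rightarrow> bool" where
  "bounded_type D \<longleftrightarrow>
     (\<exists>\<Psi> :: complex^'n \<Rightarrow> real.
        q_psh 0 D (\<lambda>z. ereal (\<Psi> z)) \<and> continuous_on D \<Psi> \<and> (\<forall>z\<in>D. \<Psi> z < 0) \<and>
        (\<forall>C\<ge>0. \<exists>R>0. \<forall>z\<in>D - ball 0 R. \<Psi> z < - C))"

end

theory Submission
  imports Defs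
begin

text \<open>
  \<open>\<Phi>\<close> is the pointwise supremum of all upper semicontinuous \<open>q\<close>-plurisubharmonic \<open>\<psi>\<close> with
  \<open>\<psi> \<le> f\<close> on the boundary and \<open>0 \<le> \<psi> \<le> M\<close>. A multiple of a peak function, glued with the constant \<open>0\<close>
  (this uses \<open>f \<ge> 0\<close>), is a lower barrier; the maximum principle for \<open>\<psi> + K \<phi>\<close>, with \<open>\<phi>\<close> a peak
  function, gives an upper barrier. Hence \<open>\<Phi>\<close> is continuous at the boundary and upper semicontinuous, and
  lifting \<open>\<Phi>\<close> locally by quadratic functions shows that the negative of its lower regularization is
  \<open>(n - q - 1)\<close>-plurisubharmonic. On a domain of bounded type, adding \<open>\<delta> \<Psi>\<close> and letting \<open>\<delta> \<rightarrow> 0\<close> yields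
  the maximum principle for functions bounded above, hence continuity and uniqueness.

  All comparisons rest on Slodkowski's theorem that the sum of a \<open>q\<close>- and an \<open>r\<close>-plurisubharmonic function
  is \<open>(q + r)\<close>-plurisubharmonic. It follows from the theorem on sums of viscosity theory, that is, from
  sup-convolutions and the almost everywhere second order differentiability of convex functions with Lipschitz
  gradient (Rademacher's theorem).
\<close>

section \<open>Lipschitz functions are differentiable almost everywhere\<close>

text \<open>For \<open>q \<ge> 1\<close> the class of \<open>q\<close>-plurisubharmonic functions is
  not closed under addition, so averaging over translates leaves the class and smoothing by
  convolution is no way to treat sums. Sup-convolution is the substitute: it turns an upper
  semicontinuous function into a semiconvex one and passes second-order information back to the
  original function. The price is that the two summands are expanded at different points. This is
  harmless because the criterion for \<open>q\<close>-plurisubharmonicity has constant coefficients: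
  a quadratic test function has the same Levi form at every point.

  The indices follow from counting dimensions. A function of index \<open>n - 1\<close>, the largest
  one, still obeys the maximum principle on bounded sets. Upper barriers therefore need
  \<open>q + r \<le> n - 1\<close>, lower barriers need peak functions of index at most
  \<open>q\<close>, and \<open>n - q - 1\<close> is the complementary index, for which the envelope
  and its negative lower regularization add up to index \<open>n - 1\<close>.\<close>

lemma has_integral_density_increment:
  fixes F :: "real \<Rightarrow> real"
  assumes lip: "C-lipschitz_on UNIV F" and grow: "\<And>x y. x \<le> y \<Longrightarrow> y - x \<le> F y - F x"
  obtains \<phi> where "\<And>a b. a \<le> b \<Longrightarrow> (\<phi> has_integral (F b - F a)) {a..b}"
proof -
  have contF: "continuous_on UNIV F"
    using lip by (rule lipschitz_on_continuous_on)
  have sm: "F x < F y" if "x < y" for x y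
    using grow[of x y] that by linarith
  then have le_iff: "F x \<le> F y \<longleftrightarrow> x \<le> y" for x y
    using sm by (metis less_eq_real_def linorder_not_less)
  have surj: "\<exists>x. F x = y" for y
  proof -
    have 1: "F (- \<bar>y - F 0\<bar>) \<le> y" "y \<le> F \<bar>y - F 0\<bar>"
      using grow[of "- \<bar>y - F 0\<bar>" 0] grow[of 0 "\<bar>y - F 0\<bar>"] by linarith+
    have "\<exists>x\<ge>- \<bar>y - F 0\<bar>. x \<le> \<bar>y - F 0\<bar> \<and> F x = y"
      by (rule IVT') (use 1 contF in \<open>auto intro: continuous_on_subset\<close>)
    then show ?thesis by blast
  qed
  define G where "G = inv F"
  have FG: "F (G y) = y" for y
    unfolding G_def by (rule f_inv_into_f) (use surj in \<open>auto simp: image_iff\<close>, metis)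
  have GF: "G (F x) = x" for x
    using FG[of "F x"] le_iff by (metis order_antisym order_refl)
  have "\<bar>G a - G b\<bar> \<le> \<bar>a - b\<bar>" for a b
    using grow[of "G a" "G b"] grow[of "G b" "G a"] FG by (smt (verit))
  then have "1-lipschitz_on UNIV G"
    by (intro lipschitz_onI) (auto simp: dist_real_def)
  then have contG: "continuous_on UNIV G"
    by (rule lipschitz_on_continuous_on)
  then have measG [measurable]: "G \<in> borel_measurable borel"
    by (rule borel_measurable_continuous_onI)
  \<comment> \<open>By construction \<open>\<mu>\<close> gives \<open>{a..b}\<close> the mass
    \<open>F b - F a\<close>. A Lipschitz \<open>F\<close> maps null sets to null sets, so
    \<open>\<mu>\<close> is absolutely continuous and its Radon-Nikodym density is the wanted
    integrand.\<close>
  define \<mu> where "\<mu> = distr lborel borel G"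
  have vim: "G -` A = F ` A" for A :: "real set"
    using FG GF by (auto simp: image_iff) metis+
  have ac: "absolutely_continuous lborel \<mu>"
    unfolding absolutely_continuous_def
  proof
    fix A :: "real set" assume A: "A \<in> null_sets lborel"
    then have "negligible A"
      by (simp add: negligible_iff_null_sets null_sets_completionI)
    then have "negligible (F ` A)"
    proof (rule negligible_locally_Lipschitz_image[rotated])
      show "DIM(real) \<le> DIM(real)" by simp
      fix x assume "x \<in> A"
      show "\<exists>T B. open T \<and> x \<in> T \<and> (\<forall>y\<in>A \<inter> T. norm (F y - F x) \<le> B * norm (y - x))"
        using lipschitz_onD[OF lip] by (intro exI[of _ UNIV] exI[of _ C]) (auto simp: dist_norm)
    qed
    then have "negligible (G -` A)" by (simp add: vim)
    moreover have "G -` A \<in> sets borel"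
      using measurable_sets[OF measG, of A] A by auto
    ultimately have "emeasure lborel (G -` A) = 0"
      by (auto simp: negligible_iff_null_sets null_sets_def)
    then show "A \<in> null_sets \<mu>"
      using A by (auto simp: \<mu>_def null_sets_def emeasure_distr)
  qed
  obtain f where f [measurable]: "f \<in> borel_measurable borel" and fd: "density lborel f = \<mu>"
    using sigma_finite_measure.Radon_Nikodym[OF sigma_finite_lborel ac] by (auto simp: \<mu>_def)
  define \<phi> where "\<phi> x = enn2real (f x)" for x
  have \<phi>m [measurable]: "\<phi> \<in> borel_measurable borel"
    unfolding \<phi>_def by measurable
  have "(\<phi> has_integral (F b - F a)) {a..b}" if "a \<le> b" for a b
  proof -
    have "G -` {a..b} = {F a..F b}"
      using le_iff FG by (auto) (metis le_iff FG)+
    then have "emeasure \<mu> {a..b} = ennreal (F b - F a)"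
      using le_iff[of a b] that by (simp add: \<mu>_def emeasure_distr)
    then have I: "(\<integral>\<^sup>+x. f x * indicator {a..b} x \<partial>lborel) = ennreal (F b - F a)"
      using fd emeasure_density[of f lborel "{a..b}"] by simp
    then have "AE x in lborel. f x * indicator {a..b} x \<noteq> \<infinity>"
      by (intro nn_integral_noteq_infinite) auto
    then have "AE x in lborel. ennreal (\<phi> x * indicator {a..b} x) = f x * indicator {a..b} x"
      by (rule AE_mp) (auto intro!: AE_I2 simp: \<phi>_def less_top split: split_indicator)
    then have "(\<integral>\<^sup>+x. ennreal (\<phi> x * indicator {a..b} x) \<partial>lborel) = ennreal (F b - F a)"
      by (subst nn_integral_cong_AE) (use I in auto)
    then have "((\<lambda>x. \<phi> x * indicator {a..b} x) has_integral (F b - F a)) UNIV"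
      using le_iff[of a b] that
      by (intro nn_integral_has_integral) (auto simp: \<phi>_def split: split_indicator)
    also have "(\<lambda>x. \<phi> x * indicator {a..b} x) = (\<lambda>x. if x \<in> {a..b} then \<phi> x else 0)"
      by (auto simp: indicator_def)
    finally show ?thesis
      by (simp only: has_integral_restrict_UNIV)
  qed
  then show thesis by (rule that)
qed

text \<open>Up to a linear term \<open>g\<close> is the indefinite integral of a density, and
  Lebesgue's differentiation theorem gives the derivative wherever the averages of the density
  converge on both sides.\<close>

lemma lipschitz_ae_differentiable_real:
  fixes g :: "real \<Rightarrow> real"
  assumes lip: "L-lipschitz_on UNIV g"
  obtains N where "negligible N" "\<And>x. x \<notin> N \<Longrightarrow> g differentiable (at x)"
proof -
  \<comment> \<open>The added slope \<open>L + 1\<close> outweighs every decrease of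
    \<open>g\<close> and leaves slope at least \<open>1\<close>, which makes \<open>F\<close> a
    bijection with a Lipschitz inverse.\<close>
  define F where "F x = g x + (L + 1) * x" for x
  have L0: "L \<ge> 0" using lip by (rule lipschitz_on_nonneg)
  have gl: "\<bar>g x - g y\<bar> \<le> L * \<bar>x - y\<bar>" for x y
    using lipschitz_onD[OF lip, of x y] by (simp add: dist_real_def)
  have "(L + (L + 1))-lipschitz_on UNIV F"
  proof (rule lipschitz_onI)
    fix x y show "dist (F x) (F y) \<le> (L + (L + 1)) * dist x y"
    proof -
      have "\<bar>F x - F y\<bar> \<le> \<bar>g x - g y\<bar> + \<bar>(L + 1) * (x - y)\<bar>"
        unfolding F_def by (simp add: algebra_simps)
      also have "\<dots> \<le> L * \<bar>x - y\<bar> + (L + 1) * \<bar>x - y\<bar>"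
        using gl[of x y] L0 by (simp add: abs_mult)
      finally show ?thesis by (simp add: dist_real_def algebra_simps)
    qed
  qed (use L0 in auto)
  moreover have "y - x \<le> F y - F x" if "x \<le> y" for x y
    using gl[of y x] that unfolding F_def by (simp add: algebra_simps)
  ultimately obtain \<phi> where \<phi>: "\<And>a b. a \<le> b \<Longrightarrow> (\<phi> has_integral (F b - F a)) {a..b}"
    by (rule has_integral_density_increment) blast+
  have int1: "\<phi> integrable_on cbox a b" for a b
    using \<phi>[of a b] by (cases "a \<le> b") (auto simp: has_integral_integrable)
  \<comment> \<open>Averages over \<open>{x..x + h}\<close> see only the right derivative. The
    reflected density at \<open>- x\<close> supplies the left one.\<close>
  have \<phi>': "((\<lambda>x. \<phi> (- x)) has_integral (F (- a) - F (- b))) {a..b}" if "a \<le> b" for a b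
    using \<phi>[of "- b" "- a"] that has_integral_reflect_real[of \<phi> "F (- a) - F (- b)" "- a" "- b"]
    by (simp del: has_integral_reflect_real)
  have int2: "(\<lambda>x. \<phi> (- x)) integrable_on cbox a b" for a b
    using \<phi>'[of a b] by (cases "a \<le> b") (auto simp: has_integral_integrable)
  obtain N1 where N1: "negligible N1" and D1: "\<And>x e. \<lbrakk>x \<notin> N1; 0 < e\<rbrakk> \<Longrightarrow> \<exists>d>0. \<forall>h. 0 < h \<and> h < d \<longrightarrow>
        norm (integral (cbox x (x + h *\<^sub>R One)) \<phi> /\<^sub>R h ^ DIM(real) - \<phi> x) < e"
    using integrable_ccontinuous_explicit[OF int1] by metis
  obtain N2 where N2: "negligible N2" and D2: "\<And>x e. \<lbrakk>x \<notin> N2; 0 < e\<rbrakk> \<Longrightarrow> \<exists>d>0. \<forall>h. 0 < h \<and> h < d \<longrightarrow>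
        norm (integral (cbox x (x + h *\<^sub>R One)) (\<lambda>x. \<phi> (- x)) /\<^sub>R h ^ DIM(real) - \<phi> (- x)) < e"
    using integrable_ccontinuous_explicit[OF int2] by metis
  show thesis
  proof
    show "negligible (N1 \<union> uminus ` N2)"
      using N1 N2 by (intro negligible_Un negligible_differentiable_image_negligible)
        (auto intro!: derivative_intros simp: differentiable_on_def)
    fix x assume x: "x \<notin> N1 \<union> uminus ` N2"
    then have x1: "x \<notin> N1" and x2: "- x \<notin> N2"
      by (auto simp: image_iff)
    have "((\<lambda>y. (F y - F x) / (y - x)) \<longlongrightarrow> \<phi> x) (at x)"
      unfolding LIM_eq
    proof (intro allI impI)
      fix e :: real assume "e > 0"
      obtain d1 where d1: "d1 > 0" and E1: "\<And>h. 0 < h \<Longrightarrow> h < d1 \<Longrightarrow>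
          norm (integral (cbox x (x + h *\<^sub>R One)) \<phi> /\<^sub>R h ^ DIM(real) - \<phi> x) < e"
        using D1[OF x1 \<open>e > 0\<close>] by blast
      obtain d2 where d2: "d2 > 0" and E2: "\<And>h. 0 < h \<Longrightarrow> h < d2 \<Longrightarrow>
          norm (integral (cbox (- x) (- x + h *\<^sub>R One)) (\<lambda>x. \<phi> (- x)) /\<^sub>R h ^ DIM(real) - \<phi> x) < e"
        using D2[OF x2 \<open>e > 0\<close>] by auto
      show "\<exists>s>0. \<forall>y. y \<noteq> x \<and> norm (y - x) < s \<longrightarrow> norm ((F y - F x) / (y - x) - \<phi> x) < e"
      proof (intro exI[of _ "min d1 d2"] conjI allI impI)
        fix y assume y: "y \<noteq> x \<and> norm (y - x) < min d1 d2"
        show "norm ((F y - F x) / (y - x) - \<phi> x) < e"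
        proof (cases "x < y")
          case True
          have "integral {x..y} \<phi> = F y - F x"
            using \<phi>[of x y] True by (simp add: integral_unique)
          then show ?thesis
            using E1[of "y - x"] y True by (simp add: divide_inverse mult.commute)
        next
          case False
          have "integral {- x..- y} (\<lambda>x. \<phi> (- x)) = F x - F y"
            using \<phi>'[of "- x" "- y"] False by (simp add: integral_unique)
          then have "norm ((F x - F y) / (x - y) - \<phi> x) < e"
            using E2[of "x - y"] y False by (simp add: divide_inverse mult.commute)
          moreover have "(F x - F y) / (x - y) = (F y - F x) / (y - x)"
            by (metis minus_diff_eq minus_divide_divide)
          ultimately show ?thesis by simp
        qed
      qed (use d1 d2 in auto)
    qed
    then have "(F has_field_derivative \<phi> x) (at x)"
      by (simp add: has_field_derivative_iff)
    then have "((\<lambda>x. F x - (L + 1) * x) has_field_derivative (\<phi> x - (L + 1))) (at x)"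
      by (auto intro!: derivative_eq_intros)
    then show "g differentiable (at x)"
      unfolding F_def by (auto simp: real_differentiable_def)
  qed
qed

section \<open>Directional derivatives and Rademacher's theorem\<close>

definition dirquot :: "('a::real_normed_vector \<Rightarrow> real) \<Rightarrow> 'a \<Rightarrow> 'a \<Rightarrow> real \<Rightarrow> real" where
  "dirquot g v y t = (g (y + t *\<^sub>R v) - g y) / t"

text \<open>Fixing the sequence \<open>1 / Suc k\<close> makes this Borel measurable in
  \<open>y\<close> for continuous \<open>g\<close>, also at points where the limit fails to exist.
  It agrees with the two-sided limit wherever that exists.\<close>

definition dirder :: "('a::real_normed_vector \<Rightarrow> real) \<Rightarrow> 'a \<Rightarrow> 'a \<Rightarrow> real" where
  "dirder g v y = lim (\<lambda>k. dirquot g v y (1 / real (Suc k)))"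

lemma dirquot_bound:
  assumes "L-lipschitz_on UNIV g"
  shows "\<bar>dirquot g v y t\<bar> \<le> L * norm v"
proof (cases "t = 0")
  case True
  then show ?thesis using lipschitz_on_nonneg[OF assms] by (simp add: dirquot_def)
next
  case False
  have "\<bar>g (y + t *\<^sub>R v) - g y\<bar> \<le> L * norm v * \<bar>t\<bar>"
    using lipschitz_onD[OF assms, of "y + t *\<^sub>R v" y] by (simp add: dist_norm mult_ac)
  then show ?thesis using False by (simp add: dirquot_def divide_simps)
qed

lemma dirquot_Suc_tendsto:
  assumes "(dirquot g v y \<longlongrightarrow> d) (at 0)"
  shows "(\<lambda>k. dirquot g v y (1 / real (Suc k))) \<longlonglongrightarrow> d"
proof -
  have "filterlim (\<lambda>k. 1 / real (Suc k)) (at 0) sequentially"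
    unfolding filterlim_at using LIMSEQ_inverse_real_of_nat by (auto simp: inverse_eq_divide)
  then show ?thesis
    using assms filterlim_compose by blast
qed

lemma dirder_eq:
  assumes "(dirquot g v y \<longlongrightarrow> d) (at 0)"
  shows "dirder g v y = d"
  unfolding dirder_def using dirquot_Suc_tendsto[OF assms] by (rule limI)

lemma dirder_scale:
  assumes "(dirquot g v y \<longlongrightarrow> dirder g v y) (at 0)"
  shows "(dirquot g (c *\<^sub>R v) y \<longlongrightarrow> c * dirder g v y) (at 0)"
proof (cases "c = 0")
  case True
  then show ?thesis by (simp add: dirquot_def[abs_def])
next
  case False
  have "filterlim (\<lambda>t. t * c) (at 0) (at 0)"
    unfolding filterlim_at using False
    by (auto intro!: tendsto_eq_intros simp: eventually_at intro: exI[of _ 1])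
  then have "((\<lambda>t. dirquot g v y (t * c)) \<longlongrightarrow> dirder g v y) (at 0)"
    using assms filterlim_compose by blast
  then have "((\<lambda>t. c * dirquot g v y (t * c)) \<longlongrightarrow> c * dirder g v y) (at 0)"
    by (rule tendsto_mult_left)
  then show ?thesis
    using False by (simp add: dirquot_def[abs_def] mult.commute)
qed

text \<open>Existence of the limit is a Cauchy condition. Countably many tolerances and radii
  suffice, and for each pair of them the uncountable intersection over \<open>s\<close> and
  \<open>t\<close> is closed, so it does no harm to measurability.\<close>

lemma dirquot_limit_borel:
  fixes g :: "'a::euclidean_space \<Rightarrow> real"
  assumes cont: "continuous_on UNIV g"
  shows "{y. \<exists>d. (dirquot g v y \<longlongrightarrow> d) (at 0)} \<in> sets borel"
proof -
  define E where "E n m = {y. \<forall>s t. 0 < \<bar>s\<bar> \<and> \<bar>s\<bar> < 1 / real (Suc m) \<and> 0 < \<bar>t\<bar> \<and> \<bar>t\<bar> < 1 / real (Suc m)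
      \<longrightarrow> \<bar>dirquot g v y s - dirquot g v y t\<bar> \<le> 1 / real (Suc n)}" for n m
  have "closed (E n m)" for n m
  proof -
    have "E n m = (\<Inter>s\<in>{s. 0 < \<bar>s\<bar> \<and> \<bar>s\<bar> < 1 / real (Suc m)}. \<Inter>t\<in>{t. 0 < \<bar>t\<bar> \<and> \<bar>t\<bar> < 1 / real (Suc m)}.
        {y. \<bar>dirquot g v y s - dirquot g v y t\<bar> \<le> 1 / real (Suc n)})"
      unfolding E_def by blast
    moreover have "closed {y. \<bar>dirquot g v y s - dirquot g v y t\<bar> \<le> 1 / real (Suc n)}" for s t
      unfolding dirquot_def divide_inverse
      by (intro closed_Collect_le continuous_intros continuous_on_compose2[OF cont]) auto
    ultimately show ?thesis by (auto intro!: closed_INT simp del: of_nat_Suc)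
  qed
  then have "(\<Inter>n. \<Union>m. E n m) \<in> sets borel"
    by (intro sets.countable_INT'' sets.countable_UN) auto
  moreover have "{y. \<exists>d. (dirquot g v y \<longlongrightarrow> d) (at 0)} = (\<Inter>n. \<Union>m. E n m)"
  proof (intro equalityI subsetI)
    fix y assume "y \<in> {y. \<exists>d. (dirquot g v y \<longlongrightarrow> d) (at 0)}"
    then obtain d where d: "(dirquot g v y \<longlongrightarrow> d) (at 0)" by blast
    show "y \<in> (\<Inter>n. \<Union>m. E n m)"
    proof
      fix n
      have "0 < 1 / (2 * real (Suc n))" by simp
      then obtain \<delta> where \<delta>: "\<delta> > 0" "\<And>s. s \<noteq> 0 \<Longrightarrow> \<bar>s\<bar> < \<delta> \<Longrightarrow> \<bar>dirquot g v y s - d\<bar> < 1 / (2 * real (Suc n))"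
        using d[unfolded LIM_eq] by (metis diff_zero real_norm_def)
      obtain m where m: "1 / real (Suc m) < \<delta>"
        using reals_Archimedean[OF \<delta>(1)] by (auto simp: inverse_eq_divide)
      have half: "1 / (2 * real (Suc n)) + 1 / (2 * real (Suc n)) = 1 / real (Suc n)"
        by (simp add: field_simps)
      have "y \<in> E n m"
        unfolding E_def
      proof (intro CollectI allI impI)
        fix s t assume st: "0 < \<bar>s\<bar> \<and> \<bar>s\<bar> < 1 / real (Suc m) \<and> 0 < \<bar>t\<bar> \<and> \<bar>t\<bar> < 1 / real (Suc m)"
        have "\<bar>dirquot g v y s - d\<bar> < 1 / (2 * real (Suc n))" "\<bar>dirquot g v y t - d\<bar> < 1 / (2 * real (Suc n))"
          using st m by (auto intro!: \<delta>(2) simp del: of_nat_Suc)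
        then show "\<bar>dirquot g v y s - dirquot g v y t\<bar> \<le> 1 / real (Suc n)"
          unfolding half[symmetric] by linarith
      qed
      then show "y \<in> (\<Union>m. E n m)" by blast
    qed
  next
    fix y assume y: "y \<in> (\<Inter>n. \<Union>m. E n m)"
    define x where "x k = dirquot g v y (1 / real (Suc k))" for k
    have small: "\<exists>m. \<forall>s t. 0 < \<bar>s\<bar> \<and> \<bar>s\<bar> < 1 / real (Suc m) \<and> 0 < \<bar>t\<bar> \<and> \<bar>t\<bar> < 1 / real (Suc m)
      \<longrightarrow> \<bar>dirquot g v y s - dirquot g v y t\<bar> \<le> e / 2" if e: "e > 0" for e :: real
    proof -
      obtain n where n: "1 / real (Suc n) < e / 2"
        using reals_Archimedean[of "e / 2"] e by (auto simp: inverse_eq_divide)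
      obtain m where "y \<in> E n m" using y by blast
      then show ?thesis
        unfolding E_def using less_imp_le[OF n] by (intro exI[of _ m]) (blast intro: order_trans)
    qed
    have "Cauchy x"
    proof (rule metric_CauchyI)
      fix e :: real assume "e > 0"
      then obtain m where m: "\<And>s t. 0 < \<bar>s\<bar> \<Longrightarrow> \<bar>s\<bar> < 1 / real (Suc m) \<Longrightarrow> 0 < \<bar>t\<bar> \<Longrightarrow> \<bar>t\<bar> < 1 / real (Suc m)
        \<Longrightarrow> \<bar>dirquot g v y s - dirquot g v y t\<bar> \<le> e / 2"
        using small by metis
      have "dist (x i) (x j) < e" if "i \<ge> Suc m" "j \<ge> Suc m" for i j
      proof -
        have "\<bar>x i - x j\<bar> \<le> e / 2"
          unfolding x_def using that by (intro m) (auto simp: divide_simps)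
        then show ?thesis using \<open>e > 0\<close> by (simp add: dist_real_def)
      qed
      then show "\<exists>M. \<forall>i\<ge>M. \<forall>j\<ge>M. dist (x i) (x j) < e" by blast
    qed
    then obtain d where d: "x \<longlonglongrightarrow> d"
      using Cauchy_convergent convergent_def by blast
    have "(dirquot g v y \<longlongrightarrow> d) (at 0)"
      unfolding LIM_eq
    proof (intro allI impI)
      fix e :: real assume "e > 0"
      then obtain m where m: "\<And>s t. 0 < \<bar>s\<bar> \<Longrightarrow> \<bar>s\<bar> < 1 / real (Suc m) \<Longrightarrow> 0 < \<bar>t\<bar> \<Longrightarrow> \<bar>t\<bar> < 1 / real (Suc m)
        \<Longrightarrow> \<bar>dirquot g v y s - dirquot g v y t\<bar> \<le> e / 2"
        using small by metis
      show "\<exists>s>0. \<forall>x. x \<noteq> 0 \<and> norm (x - 0) < s \<longrightarrow> norm (dirquot g v y x - d) < e"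
      proof (intro exI[of _ "1 / real (Suc m)"] conjI allI impI)
        fix s :: real assume s: "s \<noteq> 0 \<and> norm (s - 0) < 1 / real (Suc m)"
        have "\<bar>dirquot g v y s - d\<bar> \<le> e / 2"
        proof (rule LIMSEQ_le_const2)
          show "(\<lambda>k. \<bar>dirquot g v y s - x k\<bar>) \<longlonglongrightarrow> \<bar>dirquot g v y s - d\<bar>"
            by (intro tendsto_intros d)
          show "\<exists>N. \<forall>k\<ge>N. \<bar>dirquot g v y s - x k\<bar> \<le> e / 2"
          proof (intro exI[of _ "Suc m"] allI impI)
            fix k assume "Suc m \<le> k"
            then show "\<bar>dirquot g v y s - x k\<bar> \<le> e / 2"
              unfolding x_def using s by (intro m) (auto simp: divide_simps)
          qed
        qed
        then show "norm (dirquot g v y s - d) < e" using \<open>e > 0\<close> by simp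
      qed simp
    qed
    then show "y \<in> {y. \<exists>d. (dirquot g v y \<longlongrightarrow> d) (at 0)}" by blast
  qed
  ultimately show ?thesis by simp
qed

text \<open>
  Fubini's theorem for \<open>(t, y) \<mapsto> y + t v\<close> transfers the one-dimensional statement to lines
  parallel to \<open>v\<close>.
\<close>

lemma AE_directional_derivative:
  fixes g :: "'a::euclidean_space \<Rightarrow> real"
  assumes lip: "L-lipschitz_on UNIV g"
  shows "AE y in lborel. (dirquot g v y \<longlongrightarrow> dirder g v y) (at 0)"
proof -
  define S where "S = - {y. \<exists>d. (dirquot g v y \<longlongrightarrow> d) (at 0)}"
  have [measurable]: "S \<in> sets borel"
    unfolding S_def using dirquot_limit_borel[OF lipschitz_on_continuous_on[OF lip]] by auto
  \<comment> \<open>The factor \<open>indicator {0..1} t\<close> has integral \<open>1\<close>, so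
    one order of integration returns the measure of \<open>S\<close>, while in the other order every
    line contributes \<open>0\<close>.\<close>
  define f :: "real \<Rightarrow> 'a \<Rightarrow> ennreal" where "f t y = indicator {0..1} t * indicator S (y + t *\<^sub>R v)" for t y
  have [measurable]: "case_prod f \<in> borel_measurable (lborel \<Otimes>\<^sub>M lborel)"
    unfolding f_def by measurable
  have line: "(\<integral>\<^sup>+t. f t y \<partial>lborel) = 0" for y
  proof -
    have "(L * norm v)-lipschitz_on UNIV (\<lambda>t. g (y + t *\<^sub>R v))"
    proof (rule lipschitz_onI)
      fix s t :: real
      show "dist (g (y + s *\<^sub>R v)) (g (y + t *\<^sub>R v)) \<le> L * norm v * dist s t"
        using lipschitz_onD[OF lip, of "y + s *\<^sub>R v" "y + t *\<^sub>R v"]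
        by (simp add: dist_norm flip: scaleR_diff_left) (simp add: mult_ac)
    qed (use lipschitz_on_nonneg[OF lip] in auto)
    then obtain N where N: "negligible N" "\<And>t. t \<notin> N \<Longrightarrow> (\<lambda>t. g (y + t *\<^sub>R v)) differentiable (at t)"
      by (rule lipschitz_ae_differentiable_real) blast
    have sub: "y + t *\<^sub>R v \<notin> S" if tN: "t \<notin> N" for t :: real
    proof -
      obtain d where "((\<lambda>t. g (y + t *\<^sub>R v)) has_field_derivative d) (at t)"
        using N(2)[OF tN] unfolding real_differentiable_def by blast
      then have "((\<lambda>h. (g (y + (t + h) *\<^sub>R v) - g (y + t *\<^sub>R v)) / h) \<longlongrightarrow> d) (at 0)"
        by (simp add: DERIV_def)
      then have "(dirquot g v (y + t *\<^sub>R v) \<longlongrightarrow> d) (at 0)"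
        by (simp add: dirquot_def[abs_def] scaleR_add_left add.assoc)
      then show ?thesis by (auto simp: S_def)
    qed
    have "AE t in lebesgue. t \<notin> N"
      using N(1) by (intro AE_not_in) (simp add: negligible_iff_null_sets)
    then have "AE t in lebesgue. f t y = 0"
      by (rule AE_mp) (auto intro!: AE_I2 simp: f_def indicator_def dest: sub)
    then have "(\<integral>\<^sup>+t. f t y \<partial>lebesgue) = 0"
      by (subst nn_integral_cong_AE[where v = "\<lambda>_. 0"]) auto
    moreover have "(\<lambda>t. f t y) \<in> borel_measurable lborel"
      unfolding f_def by measurable
    ultimately show ?thesis
      by (simp add: nn_integral_completion)
  qed
  have trans: "(\<integral>\<^sup>+y. indicator S (y + t *\<^sub>R v) \<partial>lborel) = emeasure lborel S" for t
  proof -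
    have "emeasure lborel S = (\<integral>\<^sup>+y. indicator S y \<partial>(distr lborel borel ((+) (t *\<^sub>R v))))"
      by (simp add: lborel_distr_plus)
    also have "\<dots> = (\<integral>\<^sup>+y. indicator S (t *\<^sub>R v + y) \<partial>lborel)"
      by (rule nn_integral_distr) auto
    finally show ?thesis by (simp add: add.commute)
  qed
  have "emeasure lborel S = (\<integral>\<^sup>+t. indicator {0..1::real} t * emeasure lborel S \<partial>lborel)"
    by (simp add: nn_integral_multc)
  also have "\<dots> = (\<integral>\<^sup>+t. (\<integral>\<^sup>+y. f t y \<partial>lborel) \<partial>lborel)"
    unfolding f_def by (subst nn_integral_cmult) (auto simp: trans)
  also have "\<dots> = (\<integral>\<^sup>+y. (\<integral>\<^sup>+t. f t y \<partial>lborel) \<partial>lborel)"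
    by (rule lborel_pair.Fubini'[symmetric]) simp
  also have "\<dots> = 0"
    by (simp add: line)
  finally have "S \<in> null_sets lborel"
    by (auto simp: null_sets_def)
  then have "AE y in lborel. y \<notin> S" by (rule AE_not_in)
  then show ?thesis
    by (rule AE_mp) (auto intro!: AE_I2 simp: S_def dirder_eq)
qed

text \<open>The difference quotient for \<open>v + w\<close> is the one for \<open>w\<close> plus
  the one for \<open>v\<close> at a point shifted by \<open>w / Suc k\<close>. Integrated over a
  box, the shift disappears in the limit. So the defect \<open>F\<close> of additivity has integral
  \<open>0\<close> over all boxes and vanishes almost everywhere by Lebesgue's differentiation
  theorem.\<close>

lemma AE_dirder_add:
  fixes g :: "'a::euclidean_space \<Rightarrow> real"
  assumes lip: "L-lipschitz_on UNIV g"
  shows "AE y in lebesgue. dirder g (v + w) y = dirder g v y + dirder g w y"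
proof -
  have [measurable]: "g \<in> borel_measurable borel"
    using lipschitz_on_continuous_on[OF lip] by (rule borel_measurable_continuous_onI)
  define q where "q v k y = dirquot g v y (1 / real (Suc k))" for v k and y :: 'a
  have qm [measurable]: "q v k \<in> borel_measurable borel" for v k
    unfolding q_def dirquot_def by measurable
  have Dm [measurable]: "dirder g v \<in> borel_measurable borel" for v
    unfolding dirder_def[abs_def] q_def[symmetric] by measurable
  have qb: "\<bar>q v k y\<bar> \<le> L * norm v" for v k y
    unfolding q_def by (rule dirquot_bound[OF lip])
  have qlim: "AE y in lborel. (\<lambda>k. q v k y) \<longlonglongrightarrow> dirder g v y" for v
    using AE_directional_derivative[OF lip, of v]
    unfolding q_def by (rule AE_mp) (intro AE_I2 impI dirquot_Suc_tendsto)
  define F where "F y = dirder g (v + w) y - dirder g v y - dirder g w y" for y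
  have int: "set_integrable lborel (cbox a b) (dirder g u)"
    and lim: "(\<lambda>k. LINT y:cbox a b|lborel. q u k y) \<longlonglongrightarrow> (LINT y:cbox a b|lborel. dirder g u y)" for a b u
  proof -
    have 1: "integrable lborel (\<lambda>y. indicator (cbox a b) y * (L * norm u))"
      by (intro integrable_mult_left) (auto simp: integrable_indicator_iff emeasure_lborel_cbox_eq)
    have 2: "AE y in lborel. (\<lambda>k. indicator (cbox a b) y *\<^sub>R q u k y) \<longlonglongrightarrow> indicator (cbox a b) y *\<^sub>R dirder g u y"
      using qlim[of u] by (rule AE_mp) (auto intro!: AE_I2 tendsto_intros)
    have 3: "AE y in lborel. norm (indicator (cbox a b) y *\<^sub>R q u k y) \<le> indicator (cbox a b) y * (L * norm u)" for k
      using qb by (auto intro!: AE_I2 simp: abs_mult indicator_def)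
    show "set_integrable lborel (cbox a b) (dirder g u)"
      unfolding set_integrable_def by (rule integrable_dominated_convergence[OF _ _ 1 2 3]) auto
    show "(\<lambda>k. LINT y:cbox a b|lborel. q u k y) \<longlonglongrightarrow> (LINT y:cbox a b|lborel. dirder g u y)"
      unfolding set_lebesgue_integral_def by (rule integral_dominated_convergence[OF _ _ 1 2 3]) auto
  qed
  have shift: "(\<lambda>k. LINT y:cbox a b|lborel. q v k (y + (1 / real (Suc k)) *\<^sub>R w))
      \<longlonglongrightarrow> (LINT y:cbox a b|lborel. dirder g v y)" for a b
  proof -
    \<comment> \<open>Translation invariance moves the shift from the quotient to the box. The
      indicators of the shifted boxes converge off the boundary of the box, a null set, and all
      these boxes lie in one ball, which yields an integrable bound.\<close>
    define s where "s k y = indicator (cbox a b) (y - (1 / real (Suc k)) *\<^sub>R w) *\<^sub>R q v k y" for k y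
    have eq: "(LINT y:cbox a b|lborel. q v k (y + (1 / real (Suc k)) *\<^sub>R w)) = (LINT y|lborel. s k y)" for k
    proof -
      let ?c = "(1 / real (Suc k)) *\<^sub>R w"
      have "(LINT y|lborel. s k y) = (LINT y|distr lborel borel ((+) ?c). s k y)"
        by (simp add: lborel_distr_plus)
      also have "\<dots> = (LINT y|lborel. s k (?c + y))"
        by (rule integral_distr) (auto simp: s_def)
      also have "\<dots> = (LINT y:cbox a b|lborel. q v k (y + ?c))"
        unfolding s_def set_lebesgue_integral_def by (simp add: add.commute)
      finally show ?thesis by simp
    qed
    have w0: "(\<lambda>k. (1 / real (Suc k)) *\<^sub>R w) \<longlonglongrightarrow> 0"
      using tendsto_scaleR[OF LIMSEQ_inverse_real_of_nat tendsto_const[of w]] by (simp add: inverse_eq_divide)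
    have "frontier (cbox a b) \<in> null_sets lborel"
      using negligible_convex_frontier[of "cbox a b"]
      by (auto simp: negligible_iff_null_sets null_sets_completion_iff)
    then have nf: "AE y in lborel. y \<notin> frontier (cbox a b)" by (rule AE_not_in)
    obtain r where r: "\<And>y. y \<in> cbox a b \<Longrightarrow> norm y \<le> r"
      using bounded_cbox[of a b] unfolding bounded_iff by blast
    have 1: "integrable lborel (\<lambda>y. indicator (cball (0::'a) (r + norm w)) y * (L * norm v))"
      using emeasure_bounded_finite[of "cball (0::'a) (r + norm w)"]
      by (intro integrable_mult_left) (auto simp: integrable_indicator_iff)
    have 2: "AE y in lborel. (\<lambda>k. s k y) \<longlonglongrightarrow> indicator (cbox a b) y *\<^sub>R dirder g v y"
      using qlim[of v] nf
    proof eventually_elim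
      case (elim y)
      have "(\<lambda>k. y - (1 / real (Suc k)) *\<^sub>R w) \<longlonglongrightarrow> y - 0"
        by (intro tendsto_intros w0)
      then have ylim: "(\<lambda>k. y - (1 / real (Suc k)) *\<^sub>R w) \<longlonglongrightarrow> y" by simp
      have "\<forall>\<^sub>F k in sequentially. indicat_real (cbox a b) (y - (1 / real (Suc k)) *\<^sub>R w) = indicator (cbox a b) y"
      proof (cases "y \<in> cbox a b")
        case True
        then have "y \<in> interior (cbox a b)"
          using elim(2) closure_subset by (auto simp: frontier_def)
        then have "\<forall>\<^sub>F k in sequentially. y - (1 / real (Suc k)) *\<^sub>R w \<in> interior (cbox a b)"
          using topological_tendstoD[OF ylim open_interior] by blast
        then show ?thesis
          by (rule eventually_mono) (use True in \<open>auto simp: indicator_def intro: subsetD[OF box_subset_cbox] simp del: of_nat_Suc\<close>)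
      next
        case False
        then have "\<forall>\<^sub>F k in sequentially. y - (1 / real (Suc k)) *\<^sub>R w \<in> - cbox a b"
          using topological_tendstoD[OF ylim, of "- cbox a b"] by (auto simp: open_Compl closed_cbox)
        then show ?thesis
          by (rule eventually_mono) (use False in \<open>auto simp: indicator_def\<close>)
      qed
      then have "(\<lambda>k. indicat_real (cbox a b) (y - (1 / real (Suc k)) *\<^sub>R w)) \<longlonglongrightarrow> indicator (cbox a b) y"
        by (rule tendsto_eventually)
      then show ?case
        unfolding s_def by (intro tendsto_scaleR elim(1))
    qed
    have 3: "AE y in lborel. norm (s k y) \<le> indicator (cball 0 (r + norm w)) y * (L * norm v)" for k
    proof (rule AE_I2)
      fix y
      show "norm (s k y) \<le> indicator (cball 0 (r + norm w)) y * (L * norm v)"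
      proof (cases "y - (1 / real (Suc k)) *\<^sub>R w \<in> cbox a b")
        case True
        then have "norm (y - (1 / real (Suc k)) *\<^sub>R w) \<le> r" using r by auto
        moreover have "norm ((1 / real (Suc k)) *\<^sub>R w) \<le> norm w"
          by (simp add: divide_simps distrib_left)
        ultimately have "norm y \<le> r + norm w"
          using norm_triangle_sub[of y "(1 / real (Suc k)) *\<^sub>R w"] by linarith
        then show ?thesis using qb True by (simp add: s_def)
      next
        case False
        then show ?thesis using lipschitz_on_nonneg[OF lip] by (simp add: s_def)
      qed
    qed
    have "(\<lambda>k. LINT y|lborel. s k y) \<longlonglongrightarrow> (LINT y|lborel. indicator (cbox a b) y *\<^sub>R dirder g v y)"
      by (rule integral_dominated_convergence[OF _ _ 1 2 3]) (auto simp: s_def)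
    then show ?thesis
      by (simp only: eq) (simp add: set_lebesgue_integral_def)
  qed
  have split: "q (v + w) k y = q v k (y + (1 / real (Suc k)) *\<^sub>R w) + q w k y" for k y
    by (simp add: q_def dirquot_def algebra_simps scaleR_add_right diff_divide_distrib)
  have qint: "set_integrable lborel (cbox a b) (q u k)"
      "set_integrable lborel (cbox a b) (\<lambda>y. q u k (y + (1 / real (Suc k)) *\<^sub>R w))" for a b u k
  proof -
    have 1: "integrable lborel (\<lambda>y. indicator (cbox a b) y * (L * norm u))"
      by (intro integrable_mult_left) (auto simp: integrable_indicator_iff emeasure_lborel_cbox_eq)
    show "set_integrable lborel (cbox a b) (q u k)"
      "set_integrable lborel (cbox a b) (\<lambda>y. q u k (y + (1 / real (Suc k)) *\<^sub>R w))"
      unfolding set_integrable_def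
      by (rule Bochner_Integration.integrable_bound[OF 1]; use qb in \<open>force intro!: AE_I2 simp: abs_mult indicator_def lipschitz_on_nonneg[OF lip]\<close>)+
  qed
  have Fint: "set_integrable lborel (cbox a b) F" for a b
    unfolding F_def by (intro set_integral_diff int)
  have F0: "integral (cbox a b) F = 0" for a b
  proof -
    have "(LINT y:cbox a b|lborel. q (v + w) k y) = (LINT y:cbox a b|lborel. q v k (y + (1 / real (Suc k)) *\<^sub>R w))
       + (LINT y:cbox a b|lborel. q w k y)" for k
      unfolding split by (rule set_integral_add(2)[OF qint(2) qint(1)])
    then have "(\<lambda>k. LINT y:cbox a b|lborel. q (v + w) k y) \<longlonglongrightarrow>
        (LINT y:cbox a b|lborel. dirder g v y) + (LINT y:cbox a b|lborel. dirder g w y)"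
      by (simp only:) (intro tendsto_add shift lim)
    then have "(LINT y:cbox a b|lborel. dirder g (v + w) y) =
        (LINT y:cbox a b|lborel. dirder g v y) + (LINT y:cbox a b|lborel. dirder g w y)"
      using lim[of a b "v + w"] LIMSEQ_unique by blast
    then have "(LINT y:cbox a b|lborel. F y) = 0"
      unfolding F_def using int[of a b] by (simp add: set_integral_diff)
    then show ?thesis
      using set_borel_integral_eq_integral(2)[OF Fint] by simp
  qed
  have "F integrable_on cbox a b" for a b
    by (rule set_borel_integral_eq_integral(1)[OF Fint])
  then obtain N where N: "negligible N" and FN: "\<And>x e. \<lbrakk>x \<notin> N; 0 < e\<rbrakk> \<Longrightarrow> \<exists>d>0. \<forall>h. 0 < h \<and> h < d \<longrightarrow>
        norm (integral (cbox x (x + h *\<^sub>R One)) F /\<^sub>R h ^ DIM('a) - F x) < e"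
    using integrable_ccontinuous_explicit[of F] by metis
  have "F x = 0" if xN: "x \<notin> N" for x
  proof (rule ccontr)
    assume "F x \<noteq> 0"
    then obtain d :: real where "d > 0" "\<forall>h. 0 < h \<and> h < d \<longrightarrow> norm (F x) < \<bar>F x\<bar>"
      using FN[OF xN, of "\<bar>F x\<bar>"] by (auto simp: F0 simp del: not_less)
    from spec[OF this(2), of "d / 2"] this(1) show False by simp
  qed
  then have "{x \<in> space lebesgue. \<not> dirder g (v + w) x = dirder g v x + dirder g w x} \<subseteq> N"
    unfolding F_def by force
  then show ?thesis
    using N by (intro AE_I'[of N]) (simp_all add: negligible_iff_null_sets)
qed

text \<open>Outside a null set the directional derivatives along a countable dense set
  \<open>C\<close> exist and depend linearly on the direction. As \<open>g\<close> is Lipschitz, its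
  difference quotients are equicontinuous in the direction, and compactness of the unit sphere makes
  their convergence uniform, which is differentiability.\<close>

theorem rademacher_real:
  fixes g :: "'a::euclidean_space \<Rightarrow> real"
  assumes lip: "L-lipschitz_on UNIV g"
  shows "AE y in lebesgue. g differentiable (at y)"
proof -
  have L0: "L \<ge> 0" using lip by (rule lipschitz_on_nonneg)
  obtain C :: "'a set" where C: "countable C" "\<And>X. open X \<Longrightarrow> X \<noteq> {} \<Longrightarrow> \<exists>d\<in>C. d \<in> X"
    by (rule countable_dense_setE) blast
  have lim: "AE y in lebesgue. (dirquot g v y \<longlongrightarrow> dirder g v y) (at 0)" for v
    using AE_directional_derivative[OF lip, of v] by (rule AE_completion)
  have lin: "AE y in lebesgue. dirder g (\<Sum>b\<in>A. (v \<bullet> b) *\<^sub>R b) y = (\<Sum>b\<in>A. (v \<bullet> b) * dirder g b y)"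
    if "A \<subseteq> Basis" for A and v :: 'a
    using finite_subset[OF that finite_Basis]
  proof induction
    case empty
    show ?case by (rule AE_I2) (auto simp: dirder_def dirquot_def intro!: limI)
  next
    case (insert b A)
    show ?case
      using insert(3) lim[of b] AE_dirder_add[OF lip, of "(v \<bullet> b) *\<^sub>R b" "\<Sum>b\<in>A. (v \<bullet> b) *\<^sub>R b"]
      by eventually_elim (use insert(1,2) in \<open>simp add: dirder_eq[OF dirder_scale]\<close>)
  qed
  have "AE y in lebesgue. \<forall>v\<in>C. (dirquot g v y \<longlongrightarrow> (\<Sum>b\<in>Basis. (v \<bullet> b) * dirder g b y)) (at 0)"
  proof (rule AE_ball_countable[THEN iffD2, OF C(1)], rule ballI)
    fix v
    show "AE y in lebesgue. (dirquot g v y \<longlongrightarrow> (\<Sum>b\<in>Basis. (v \<bullet> b) * dirder g b y)) (at 0)"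
      using lim[of v] lin[OF order_refl, of v] by eventually_elim (simp add: euclidean_representation)
  qed
  then show ?thesis
  proof eventually_elim
    case (elim y)
    define A where "A v = (\<Sum>b\<in>Basis. (v \<bullet> b) * dirder g b y)" for v
    define K where "K = (\<Sum>b\<in>(Basis::'a set). \<bar>dirder g b y\<bar>)"
    have K0: "K \<ge> 0" unfolding K_def by (simp add: sum_nonneg)
    have Ascale: "A (t *\<^sub>R v) = t * A v" for t v
      by (simp add: A_def sum_distrib_left mult_ac)
    have Adiff: "A v - A w = A (v - w)" for v w
      by (simp add: A_def inner_diff_left left_diff_distrib sum_subtractf)
    have Abound: "\<bar>A v\<bar> \<le> K * norm v" for v
      unfolding A_def K_def sum_distrib_right
      by (rule order_trans[OF sum_abs], rule sum_mono)
        (use Basis_le_norm[of _ v] in \<open>auto simp: abs_mult mult.commute intro!: mult_right_mono\<close>)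
    have blA: "bounded_linear A"
      by (rule bounded_linear_intro[where K = K])
        (use Abound in \<open>auto simp: A_def inner_add_left distrib_right distrib_left sum.distrib sum_distrib_left mult_ac\<close>)
    have "(g has_derivative A) (at y)"
      unfolding has_derivative_at_alt
    proof (intro conjI blA allI impI)
      fix e :: real assume e: "e > 0"
      \<comment> \<open>Replacing a unit vector by a net point at distance \<open>\<eta>\<close>
        costs \<open>L * \<eta>\<close> in \<open>g\<close> and \<open>K * \<eta>\<close> in
        \<open>A\<close> per unit length, together at most half of \<open>e\<close>. The other half
        is for the finitely many net directions.\<close>
      define \<eta> where "\<eta> = e / (2 * (L + K + 1))"
      have \<eta>: "\<eta> > 0" using e L0 K0 by (simp add: \<eta>_def)
      have \<eta>e: "(L + K) * \<eta> \<le> e / 2"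
      proof -
        have "(L + K) * \<eta> \<le> (L + K + 1) * \<eta>" using \<eta> by simp
        also have "\<dots> = e / 2" using L0 K0 by (simp add: \<eta>_def field_simps)
        finally show ?thesis .
      qed
      have "sphere (0::'a) 1 \<subseteq> (\<Union>v\<in>C. ball v \<eta>)"
      proof
        fix u :: 'a
        obtain v where "v \<in> C" "v \<in> ball u \<eta>"
          using C(2)[of "ball u \<eta>"] \<eta> by auto
        then show "u \<in> (\<Union>v\<in>C. ball v \<eta>)" by (auto simp: dist_commute)
      qed
      then obtain C' where C': "C' \<subseteq> C" "finite C'" "sphere (0::'a) 1 \<subseteq> (\<Union>v\<in>C'. ball v \<eta>)"
        by (rule compactE_image[OF compact_sphere, rotated]) auto
      have "\<forall>v\<in>C'. \<exists>\<delta>>0. \<forall>t. t \<noteq> 0 \<and> \<bar>t\<bar> < \<delta> \<longrightarrow> \<bar>dirquot g v y t - A v\<bar> < e / 2"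
      proof
        fix v assume "v \<in> C'"
        then have "(dirquot g v y \<longlongrightarrow> A v) (at 0)" using elim C' by (auto simp: A_def)
        then show "\<exists>\<delta>>0. \<forall>t. t \<noteq> 0 \<and> \<bar>t\<bar> < \<delta> \<longrightarrow> \<bar>dirquot g v y t - A v\<bar> < e / 2"
          unfolding LIM_eq using half_gt_zero[OF e] by (simp only: diff_zero real_norm_def)
      qed
      then obtain \<delta> where \<delta>: "\<And>v. v \<in> C' \<Longrightarrow> \<delta> v > 0"
          "\<And>v t. v \<in> C' \<Longrightarrow> t \<noteq> 0 \<Longrightarrow> \<bar>t\<bar> < \<delta> v \<Longrightarrow> \<bar>dirquot g v y t - A v\<bar> < e / 2"
        by metis
      define d where "d = Min (insert 1 (\<delta> ` C'))"
      have d: "d > 0" "\<And>v. v \<in> C' \<Longrightarrow> d \<le> \<delta> v"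
        unfolding d_def using C'(2) \<delta>(1) by auto
      show "\<exists>d>0. \<forall>z. norm (z - y) < d \<longrightarrow> norm (g z - g y - A (z - y)) \<le> e * norm (z - y)"
      proof (intro exI[of _ d] conjI allI impI d(1))
        fix z assume z: "norm (z - y) < d"
        show "norm (g z - g y - A (z - y)) \<le> e * norm (z - y)"
        proof (cases "z = y")
          case True
          then show ?thesis by (simp add: A_def)
        next
          case False
          define t where "t = norm (z - y)"
          have t: "t > 0" "t < d" using False z by (auto simp: t_def)
          define u where "u = (z - y) /\<^sub>R t"
          have zy: "z - y = t *\<^sub>R u" using t by (simp add: u_def)
          have "u \<in> sphere 0 1" using t by (simp add: u_def t_def)
          then obtain v where v: "v \<in> C'" "norm (u - v) < \<eta>"
            using C'(3) by (auto simp: dist_norm norm_minus_commute)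
          have "\<bar>dirquot g v y t - A v\<bar> < e / 2"
            using v t d(2)[of v] by (intro \<delta>(2)) auto
          moreover have "g (y + t *\<^sub>R v) - g y - t * A v = (dirquot g v y t - A v) * t"
            using t by (simp add: dirquot_def field_simps)
          ultimately have 1: "\<bar>g (y + t *\<^sub>R v) - g y - t * A v\<bar> \<le> e / 2 * t"
            using t by (simp add: abs_mult)
          have "z - (y + t *\<^sub>R v) = t *\<^sub>R (u - v)" using zy by (simp add: algebra_simps)
          then have "norm (z - (y + t *\<^sub>R v)) \<le> t * \<eta>" using v t by simp
          then have 2: "\<bar>g z - g (y + t *\<^sub>R v)\<bar> \<le> L * (t * \<eta>)"
            using lipschitz_onD[OF lip, of z "y + t *\<^sub>R v"] L0
            by (simp add: dist_norm) (meson mult_left_mono order_trans)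
          have "\<bar>A (u - v)\<bar> \<le> K * \<eta>"
            using Abound[of "u - v"] v(2) K0 by (meson less_imp_le mult_left_mono order_trans)
          then have 3: "\<bar>t * A v - A (z - y)\<bar> \<le> K * \<eta> * t"
            using t by (simp add: zy Ascale flip: Adiff right_diff_distrib) (simp add: abs_mult abs_minus_commute mult.commute)
          have "\<bar>g z - g y - A (z - y)\<bar> \<le> e / 2 * t + L * (t * \<eta>) + K * \<eta> * t"
            using 1 2 3 by linarith
          also have "\<dots> = (e / 2 + (L + K) * \<eta>) * t" by (simp add: algebra_simps)
          also have "\<dots> \<le> e * t" using \<eta>e t by (intro mult_right_mono) auto
          finally show ?thesis by (simp add: t_def)
        qed
      qed
    qed
    then show ?case by (auto simp: differentiable_def)
  qed
qed

section \<open>Second derivatives of convex functions\<close>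

lemma power2_norm_add: "(norm (a + v))\<^sup>2 = (norm a)\<^sup>2 + 2 * (a \<bullet> v) + (norm (v :: 'a::real_inner))\<^sup>2"
  by (simp add: power2_norm_eq_inner inner_add_left inner_add_right inner_commute)

lemma convex_on_subgradient:
  fixes E :: "'a::euclidean_space \<Rightarrow> real"
  assumes "convex_on UNIV E"
  obtains T where "\<And>z v. E z + T z \<bullet> v \<le> E (z + v)"
proof -
  have "\<exists>p. \<forall>v. E z + p \<bullet> v \<le> E (z + v)" for z
  proof -
    define S where "S = {(x, s). x = z \<and> s < E z}"
    define T where "T = {(x, s). E x \<le> s}"
    have "convex S"
    proof -
      have "S = {z} \<times> {..<E z}" by (auto simp: S_def)
      then show ?thesis by (simp add: convex_Times)
    qed
    moreover have "convex T"
    proof -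
      have "T = epigraph UNIV E" by (auto simp: T_def epigraph_def)
      then show ?thesis using assms by (simp add: convex_epigraph)
    qed
    moreover have "(z, E z - 1) \<in> S" "(z, E z) \<in> T" "S \<inter> T = {}"
      by (auto simp: S_def T_def)
    ultimately obtain a b where ab: "a \<noteq> 0" "\<forall>x\<in>S. a \<bullet> x \<le> b" "\<forall>x\<in>T. b \<le> a \<bullet> x"
      using separating_hyperplane_sets[of S T] by blast
    obtain \<alpha> \<beta> where a: "a = (\<alpha>, \<beta>)" by (metis prod.exhaust)
    have up: "b \<le> \<alpha> \<bullet> x + \<beta> * s" if "E x \<le> s" for x s
      using ab(3) that by (auto simp: T_def a)
    have low: "\<alpha> \<bullet> z + \<beta> * s \<le> b" if "s < E z" for s
      using ab(2) that by (auto simp: S_def a)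
    have "\<alpha> \<bullet> z + \<beta> * (E z - 1) \<le> \<alpha> \<bullet> z + \<beta> * E z"
      using low[of "E z - 1"] up[of z "E z"] by simp
    then have "\<beta> \<ge> 0" by (simp add: algebra_simps)
    have lowz: "\<alpha> \<bullet> z + \<beta> * E z \<le> b"
    proof (rule field_le_epsilon)
      fix e :: real assume e: "e > 0"
      have "\<alpha> \<bullet> z + \<beta> * (E z - e / (\<beta> + 1)) \<le> b"
        using low[of "E z - e / (\<beta> + 1)"] e \<open>\<beta> \<ge> 0\<close> by simp
      moreover have "\<beta> * (e / (\<beta> + 1)) \<le> e"
        using e \<open>\<beta> \<ge> 0\<close> by (simp add: divide_simps)
      ultimately show "\<alpha> \<bullet> z + \<beta> * E z \<le> b + e" by (simp add: right_diff_distrib)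
    qed
    \<comment> \<open>The separating hyperplane is not vertical: \<open>E\<close> is finite on the
      whole space, so with \<open>\<beta> = 0\<close> the inequality at \<open>z - \<alpha>\<close>
      would force \<open>\<alpha> = 0\<close>.\<close>
    have "\<beta> \<noteq> 0"
    proof
      assume "\<beta> = 0"
      then have "\<alpha> \<bullet> z \<le> \<alpha> \<bullet> (z - \<alpha>)"
        using lowz up[of "z - \<alpha>" "E (z - \<alpha>)"] by simp
      then have "\<alpha> \<bullet> \<alpha> \<le> 0" by (simp add: inner_diff_right)
      then have "\<alpha> = 0" by (metis inner_eq_zero_iff inner_ge_zero order_antisym)
      with \<open>\<beta> = 0\<close> ab(1) a show False by (simp add: zero_prod_def)
    qed
    with \<open>\<beta> \<ge> 0\<close> have b: "\<beta> > 0" by simp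
    show ?thesis
    proof (intro exI allI)
      fix v
      have "\<alpha> \<bullet> z + \<beta> * E z \<le> \<alpha> \<bullet> (z + v) + \<beta> * E (z + v)"
        using lowz up[of "z + v" "E (z + v)"] by simp
      then have "\<beta> * E z \<le> \<alpha> \<bullet> v + \<beta> * E (z + v)" by (simp add: inner_add_right)
      then show "E z + (- (\<alpha> /\<^sub>R \<beta>)) \<bullet> v \<le> E (z + v)"
        using b by (simp add: field_simps)
    qed
  qed
  then show thesis using that by metis
qed

lemma convex_quadratic_gap:
  fixes E :: "'a::real_inner \<Rightarrow> real"
  assumes "convex_on UNIV (\<lambda>z. \<kappa> * (norm z)\<^sup>2 - E z)"
  shows "E (z + v) + E (z - v) - 2 * E z \<le> 2 * \<kappa> * (norm v)\<^sup>2"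
proof -
  have "\<kappa> * (norm ((1/2) *\<^sub>R (z + v) + (1/2) *\<^sub>R (z - v)))\<^sup>2 - E ((1/2) *\<^sub>R (z + v) + (1/2) *\<^sub>R (z - v))
     \<le> (1/2) * (\<kappa> * (norm (z + v))\<^sup>2 - E (z + v)) + (1/2) * (\<kappa> * (norm (z - v))\<^sup>2 - E (z - v))"
    using convex_onD[OF assms, of "1/2" "z + v" "z - v"] by simp
  moreover have "(1/2) *\<^sub>R (z + v) + (1/2) *\<^sub>R (z - v) = z"
    by (simp add: algebra_simps flip: scaleR_add_left)
  moreover have "(norm (z + v))\<^sup>2 + (norm (z - v))\<^sup>2 = 2 * (norm z)\<^sup>2 + 2 * (norm v)\<^sup>2"
    by (simp add: power2_norm_eq_inner algebra_simps inner_commute)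
  then have "\<kappa> * (norm (z + v))\<^sup>2 + \<kappa> * (norm (z - v))\<^sup>2 = 2 * (\<kappa> * (norm z)\<^sup>2) + 2 * \<kappa> * (norm v)\<^sup>2"
    by (metis (no_types, opaque_lifting) distrib_left mult.assoc mult.left_commute)
  ultimately show ?thesis by (simp add: right_diff_distrib)
qed

lemma linear_le_quadratic_imp_zero:
  fixes u :: "'a::real_inner"
  assumes "\<And>v. u \<bullet> v \<le> C * (norm v)\<^sup>2"
  shows "u = 0"
proof (rule ccontr)
  assume "u \<noteq> 0"
  define t where "t = 1 / (\<bar>C\<bar> + 1)"
  have t: "t > 0" "C * t < 1" by (auto simp: t_def divide_simps)
  have "t * (norm u)\<^sup>2 \<le> (C * t) * (t * (norm u)\<^sup>2)"
    using assms[of "t *\<^sub>R u"] by (simp add: power2_norm_eq_inner power_mult_distrib) (simp add: power2_eq_square mult_ac)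
  moreover have "(C * t) * (t * (norm u)\<^sup>2) < 1 * (t * (norm u)\<^sup>2)"
    using t \<open>u \<noteq> 0\<close> by (intro mult_strict_right_mono) auto
  ultimately show False by simp
qed

text \<open>Comparing the bounds at \<open>b + w\<close>, with \<open>w\<close> in the direction of
  \<open>q - p\<close> and as long as \<open>b - a\<close>, gives the estimate. The upper bound is
  assumed only at \<open>a\<close>: in the theorem on sums it is known only at places of maxima,
  while \<open>b\<close> is arbitrary.\<close>

lemma sandwich_gradient_lipschitz:
  fixes f :: "'a::real_inner \<Rightarrow> real"
  assumes C: "C \<ge> 0"
    and a: "\<And>v. f a + p \<bullet> v \<le> f (a + v)" "\<And>v. f (a + v) \<le> f a + p \<bullet> v + C * (norm v)\<^sup>2"
    and b: "\<And>v. f b + q \<bullet> v \<le> f (b + v)"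
  shows "norm (q - p) \<le> 4 * C * norm (b - a)"
proof (cases "q = p \<or> a = b")
  case True
  then show ?thesis
  proof
    assume "a = b"
    have "q - p = 0"
    proof (rule linear_le_quadratic_imp_zero)
      show "(q - p) \<bullet> v \<le> C * (norm v)\<^sup>2" for v
        using a(2)[of v] b[of v] \<open>a = b\<close> by (simp add: inner_diff_left)
    qed
    then show ?thesis using C by simp
  qed (use C in simp)
next
  case False
  define t where "t = norm (b - a)"
  define n where "n = norm (q - p)"
  have t: "t > 0" "n > 0" using False by (auto simp: t_def n_def)
  define w where "w = (t / n) *\<^sub>R (q - p)"
  have nw: "norm w = t" using t by (simp add: w_def n_def)
  have "f b + q \<bullet> w \<le> f (b + w)" by (rule b)
  also have "\<dots> = f (a + ((b - a) + w))" by (simp add: algebra_simps)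
  also have "\<dots> \<le> f a + p \<bullet> ((b - a) + w) + C * (norm ((b - a) + w))\<^sup>2" by (rule a(2))
  also have "f a \<le> f b - p \<bullet> (b - a)" using a(1)[of "b - a"] by simp
  finally have "(q - p) \<bullet> w \<le> C * (norm ((b - a) + w))\<^sup>2"
    by (simp add: inner_add_right inner_diff_left)
  also have "\<dots> \<le> C * (2 * t)\<^sup>2"
    using norm_triangle_ineq[of "b - a" w] C nw by (intro mult_left_mono power_mono) (auto simp: t_def)
  also have "(q - p) \<bullet> w = t * n"
    using t unfolding w_def by (simp add: n_def power2_eq_square flip: power2_norm_eq_inner)
  finally have "t * n \<le> t * (4 * C * t)" by (simp add: power2_eq_square algebra_simps)
  then show ?thesis using t by (simp add: n_def t_def)
qed

text \<open>Convexity of both functions makes any selection \<open>T\<close> of subgradients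
  Lipschitz. Rademacher's theorem differentiates \<open>T\<close>, and the mean value theorem on the
  segment from \<open>z\<close> to \<open>z + v\<close> raises this to a second-order expansion of
  \<open>E\<close>. \<open>A\<close> stands for its quadratic form, so symmetry is not an
  issue.\<close>

lemma alexandrov_lipschitz_gradient:
  fixes E :: "'a::euclidean_space \<Rightarrow> real"
  assumes E: "convex_on UNIV E" and lE: "convex_on UNIV (\<lambda>z. \<kappa> * (norm z)\<^sup>2 - E z)"
  shows "AE z in lebesgue. \<exists>p A. linear A \<and> (\<forall>\<eta>>0. \<exists>\<delta>>0. \<forall>v. norm v < \<delta> \<longrightarrow>
           \<bar>E (z + v) - E z - p \<bullet> v - v \<bullet> A v\<bar> \<le> \<eta> * (norm v)\<^sup>2)"
proof -
  obtain T where T: "\<And>z v. E z + T z \<bullet> v \<le> E (z + v)"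
    by (rule convex_on_subgradient[OF E]) blast
  define C where "C = 2 * \<bar>\<kappa>\<bar>"
  have T2: "E (z + v) \<le> E z + T z \<bullet> v + C * (norm v)\<^sup>2" for z v
  proof -
    have "\<kappa> * (norm v)\<^sup>2 \<le> \<bar>\<kappa>\<bar> * (norm v)\<^sup>2" by (intro mult_right_mono) auto
    then show ?thesis
      using convex_quadratic_gap[OF lE, of z v] T[of z "- v"] by (simp add: C_def)
  qed
  have Tlip: "norm (T b - T a) \<le> 4 * C * norm (b - a)" for a b
    by (rule sandwich_gradient_lipschitz[OF _ T T2 T]) (simp add: C_def)
  have "AE z in lebesgue. \<forall>b\<in>Basis. (\<lambda>x. T x \<bullet> b) differentiable (at z)"
  proof (rule AE_finite_allI[OF finite_Basis])
    fix b :: 'a assume b: "b \<in> Basis"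
    have "(4 * C)-lipschitz_on UNIV (\<lambda>x. T x \<bullet> b)"
    proof (rule lipschitz_onI)
      fix x y :: 'a
      have "\<bar>(T x - T y) \<bullet> b\<bar> \<le> norm (T x - T y)" using Basis_le_norm[OF b] .
      then show "dist (T x \<bullet> b) (T y \<bullet> b) \<le> 4 * C * dist x y"
        using Tlip[of x y] by (simp add: dist_norm inner_diff_left)
    qed (simp add: C_def)
    then show "AE z in lebesgue. (\<lambda>x. T x \<bullet> b) differentiable (at z)"
      by (rule rademacher_real)
  qed
  then show ?thesis
  proof eventually_elim
    case (elim z)
    then have "\<forall>b\<in>Basis. \<exists>D. ((\<lambda>x. T x \<bullet> b) has_derivative D) (at z)"
      by (auto simp: differentiable_def)
    then obtain D where D: "\<And>b. b \<in> Basis \<Longrightarrow> ((\<lambda>x. T x \<bullet> b) has_derivative D b) (at z)"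
      by metis
    define A where "A v = (\<Sum>b\<in>Basis. D b v *\<^sub>R b)" for v
    have TA: "(T has_derivative A) (at z)"
      by (subst has_derivative_componentwise_within)
        (use D in \<open>auto simp: A_def inner_sum_left inner_Basis if_distrib if_distribR cong: if_cong\<close>)
    have linA: "linear A" using TA has_derivative_linear by blast
    show ?case
    proof (intro exI[of _ "T z"] exI[of _ "\<lambda>v. (1/2) *\<^sub>R A v"] conjI allI impI)
      show "linear (\<lambda>v. (1/2) *\<^sub>R A v)" using linA by (rule linear_compose_scale_right)
      fix \<eta> :: real assume \<eta>: "\<eta> > 0"
      obtain \<delta> where \<delta>: "\<delta> > 0" "\<And>y. norm (y - z) < \<delta> \<Longrightarrow> norm (T y - T z - A (y - z)) \<le> \<eta> * norm (y - z)"
        using TA \<eta> unfolding has_derivative_at_alt by metis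
      show "\<exists>\<delta>>0. \<forall>v. norm v < \<delta> \<longrightarrow> \<bar>E (z + v) - E z - T z \<bullet> v - v \<bullet> ((1/2) *\<^sub>R A v)\<bar> \<le> \<eta> * (norm v)\<^sup>2"
      proof (intro exI[of _ \<delta>] conjI \<delta>(1) allI impI)
        fix v :: 'a assume v: "norm v < \<delta>"
        \<comment> \<open>The Taylor remainder along the segment, up to a constant. Its derivative
          is the first-order remainder of \<open>T\<close>, paired with \<open>v\<close>.\<close>
        define \<phi> where "\<phi> t = E (z + t *\<^sub>R v) - t * (T z \<bullet> v) - t\<^sup>2 / 2 * (v \<bullet> A v)" for t
        have dE: "((\<lambda>t. E (z + t *\<^sub>R v)) has_real_derivative T (z + t *\<^sub>R v) \<bullet> v) (at t)" for t
          unfolding DERIV_def LIM_eq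
        proof (intro allI impI)
          fix e :: real assume e: "e > 0"
          define K where "K = C * (norm v)\<^sup>2 + 1"
          have K: "K > 0" unfolding K_def C_def by (intro add_nonneg_pos) auto
          show "\<exists>s>0. \<forall>h. h \<noteq> 0 \<and> norm (h - 0) < s \<longrightarrow>
              norm ((E (z + (t + h) *\<^sub>R v) - E (z + t *\<^sub>R v)) / h - T (z + t *\<^sub>R v) \<bullet> v) < e"
          proof (intro exI[of _ "e / K"] conjI allI impI)
            fix h :: real assume h: "h \<noteq> 0 \<and> norm (h - 0) < e / K"
            define y where "y = z + t *\<^sub>R v"
            have y: "z + (t + h) *\<^sub>R v = y + h *\<^sub>R v" by (simp add: y_def scaleR_add_left)
            have 1: "0 \<le> E (y + h *\<^sub>R v) - E y - h * (T y \<bullet> v)"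
              using T[of y "h *\<^sub>R v"] by simp
            have 2: "E (y + h *\<^sub>R v) - E y - h * (T y \<bullet> v) \<le> C * (norm v)\<^sup>2 * h\<^sup>2"
              using T2[of y "h *\<^sub>R v"] by (simp add: power_mult_distrib mult_ac)
            have "norm ((E (y + h *\<^sub>R v) - E y) / h - T y \<bullet> v) = \<bar>E (y + h *\<^sub>R v) - E y - h * (T y \<bullet> v)\<bar> / \<bar>h\<bar>"
              using h by (simp add: field_simps flip: abs_divide)
            also have "\<dots> \<le> (C * (norm v)\<^sup>2 * h\<^sup>2) / \<bar>h\<bar>"
              using 1 2 by (intro divide_right_mono) auto
            also have "\<dots> = C * (norm v)\<^sup>2 * \<bar>h\<bar>"
            proof -
              have "h\<^sup>2 / \<bar>h\<bar> = \<bar>h\<bar>" using h by (auto simp: power2_eq_square abs_if)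
              then show ?thesis by (metis times_divide_eq_right)
            qed
            also have "\<dots> \<le> K * \<bar>h\<bar>" by (intro mult_right_mono) (auto simp: K_def)
            also have "\<dots> < e" using h K by (simp add: field_simps)
            finally show "norm ((E (z + (t + h) *\<^sub>R v) - E (z + t *\<^sub>R v)) / h - T (z + t *\<^sub>R v) \<bullet> v) < e"
              unfolding y by (simp add: y_def)
          qed (use e K in simp)
        qed
        have d\<phi>: "(\<phi> has_real_derivative (T (z + t *\<^sub>R v) - T z - A (t *\<^sub>R v)) \<bullet> v) (at t)" for t
          unfolding \<phi>_def
          by (rule derivative_eq_intros dE refl | simp)+
            (simp add: inner_diff_left linear_scale[OF linA] inner_commute algebra_simps)
        have "\<exists>\<xi>. 0 < \<xi> \<and> \<xi> < 1 \<and> \<phi> 1 - \<phi> 0 = (1 - 0) * ((T (z + \<xi> *\<^sub>R v) - T z - A (\<xi> *\<^sub>R v)) \<bullet> v)"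
          by (rule MVT2) (use d\<phi> in auto)
        then obtain \<xi> where \<xi>: "0 < \<xi>" "\<xi> < 1" "\<phi> 1 - \<phi> 0 = (T (z + \<xi> *\<^sub>R v) - T z - A (\<xi> *\<^sub>R v)) \<bullet> v"
          by auto
        have "\<bar>\<phi> 1 - \<phi> 0\<bar> \<le> norm (T (z + \<xi> *\<^sub>R v) - T z - A (\<xi> *\<^sub>R v)) * norm v"
          unfolding \<xi>(3) by (rule Cauchy_Schwarz_ineq2)
        also have "norm (T (z + \<xi> *\<^sub>R v) - T z - A (\<xi> *\<^sub>R v)) \<le> \<eta> * norm (\<xi> *\<^sub>R v)"
        proof -
          have "norm (\<xi> *\<^sub>R v) \<le> norm v" using \<xi> by (simp add: mult_left_le_one_le)
          then show ?thesis using \<delta>(2)[of "z + \<xi> *\<^sub>R v"] v by simp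
        qed
        also have "\<eta> * norm (\<xi> *\<^sub>R v) * norm v \<le> \<eta> * norm v * norm v"
          using \<eta> \<xi> by (intro mult_right_mono mult_left_mono) (auto simp: mult_left_le_one_le)
        finally show "\<bar>E (z + v) - E z - T z \<bullet> v - v \<bullet> ((1/2) *\<^sub>R A v)\<bar> \<le> \<eta> * (norm v)\<^sup>2"
          using norm_ge_zero[of v] by (simp add: \<phi>_def power2_eq_square mult_ac mult_right_mono)
      qed
    qed
  qed
qed

text \<open>
  The largest convex minorant of \<open>\<kappa>|z|\<^sup>2 - U\<close> inherits the semiconcavity because the auxiliary
  function \<open>e\<close> in the proof is another convex minorant.
\<close>

lemma convex_hull_of_semiconcave:
  fixes U :: "'a::real_inner \<Rightarrow> real"
  assumes U: "convex_on UNIV U"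
    and g0: "convex_on UNIV g0" "\<And>z. g0 z \<le> \<kappa> * (norm z)\<^sup>2 - U z"
  obtains c where "convex_on UNIV c" "convex_on UNIV (\<lambda>z. \<kappa> * (norm z)\<^sup>2 - c z)"
    "\<And>z. c z \<le> \<kappa> * (norm z)\<^sup>2 - U z"
    "\<And>g z. convex_on UNIV g \<Longrightarrow> (\<And>z. g z \<le> \<kappa> * (norm z)\<^sup>2 - U z) \<Longrightarrow> g z \<le> c z"
proof -
  define M where "M = {g. convex_on UNIV g \<and> (\<forall>z. g z \<le> \<kappa> * (norm z)\<^sup>2 - U z)}"
  define c where "c z = (SUP g\<in>M. g z)" for z
  have ne: "M \<noteq> {}" using g0 by (auto simp: M_def)
  have bdd: "bdd_above ((\<lambda>g. g z) ` M)" for z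
    by (rule bdd_aboveI[of _ "\<kappa> * (norm z)\<^sup>2 - U z"]) (auto simp: M_def)
  have upper: "g z \<le> c z" if "g \<in> M" for g z
    unfolding c_def by (rule cSUP_upper[OF that bdd])
  have least: "c z \<le> K" if "\<And>g. g \<in> M \<Longrightarrow> g z \<le> K" for z K
    unfolding c_def by (rule cSUP_least[OF ne that])
  have c_le: "c z \<le> \<kappa> * (norm z)\<^sup>2 - U z" for z
    by (rule least) (auto simp: M_def)
  have c_conv: "convex_on UNIV c"
  proof (rule convex_onI)
    fix t x y :: _ assume t: "(0::real) < t" "t < 1"
    show "c ((1 - t) *\<^sub>R x + t *\<^sub>R y) \<le> (1 - t) * c x + t * c y"
    proof (rule least)
      fix g assume g: "g \<in> M"
      then have "g ((1 - t) *\<^sub>R x + t *\<^sub>R y) \<le> (1 - t) * g x + t * g y"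
        using t by (intro convex_onD) (auto simp: M_def)
      also have "\<dots> \<le> (1 - t) * c x + t * c y"
        using t upper[OF g] by (intro add_mono mult_left_mono) auto
      finally show "g ((1 - t) *\<^sub>R x + t *\<^sub>R y) \<le> (1 - t) * c x + t * c y" .
    qed
  qed simp
  have quad: "(1 - t) * (norm x)\<^sup>2 + t * (norm y)\<^sup>2 = (norm ((1 - t) *\<^sub>R x + t *\<^sub>R y))\<^sup>2 + t * (1 - t) * (norm (y - x))\<^sup>2"
    for t and x y :: 'a
    by (simp add: power2_norm_eq_inner inner_add_left inner_add_right inner_diff_left inner_diff_right inner_commute)
      (simp add: algebra_simps power2_eq_square)
  have c_semi: "convex_on UNIV (\<lambda>z. \<kappa> * (norm z)\<^sup>2 - c z)"
  proof (rule convex_onI)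
    fix t :: real and x y :: 'a assume t: "0 < t" "t < 1"
    define h where "h = y - x"
    define z where "z = (1 - t) *\<^sub>R x + t *\<^sub>R y"
    have xz: "x = z - t *\<^sub>R h" and yz: "y = z + (1 - t) *\<^sub>R h"
      by (simp_all add: z_def h_def algebra_simps)
    \<comment> \<open>The subtracted term is the defect computed in \<open>quad\<close> and cancels
      against the average of the squared norms. The translates are arranged so that at
      \<open>w = z\<close> they sit at \<open>x\<close> and \<open>y\<close>, where
      \<open>e z \<le> c z\<close> is the claim.\<close>
    define e where "e w = (1 - t) * c (w - t *\<^sub>R h) + t * c (w + (1 - t) *\<^sub>R h) - \<kappa> * (t * (1 - t) * (norm h)\<^sup>2)" for w
    have "e \<in> M"
      unfolding M_def
    proof (intro CollectI conjI allI)
      show "convex_on UNIV e"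
      proof (rule convex_onI)
        fix s :: real and a b :: 'a assume s: "0 < s" "s < 1"
        have "c ((1 - s) *\<^sub>R a + s *\<^sub>R b + k) \<le> (1 - s) * c (a + k) + s * c (b + k)" for k
          using convex_onD[OF c_conv, of s "a + k" "b + k"] s by (simp add: algebra_simps)
        from this[of "- t *\<^sub>R h"] this[of "(1 - t) *\<^sub>R h"] 
        have "(1 - t) * c ((1 - s) *\<^sub>R a + s *\<^sub>R b - t *\<^sub>R h) \<le> (1 - t) * ((1 - s) * c (a - t *\<^sub>R h) + s * c (b - t *\<^sub>R h))"
          "t * c ((1 - s) *\<^sub>R a + s *\<^sub>R b + (1 - t) *\<^sub>R h) \<le> t * ((1 - s) * c (a + (1 - t) *\<^sub>R h) + s * c (b + (1 - t) *\<^sub>R h))"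
          using t by (auto intro!: mult_left_mono)
        then show "e ((1 - s) *\<^sub>R a + s *\<^sub>R b) \<le> (1 - s) * e a + s * e b"
          unfolding e_def by (simp add: algebra_simps)
      qed simp
      fix w
      have w: "(1 - t) *\<^sub>R (w - t *\<^sub>R h) + t *\<^sub>R (w + (1 - t) *\<^sub>R h) = w"
        by (simp add: algebra_simps)
      have Uw: "U w \<le> (1 - t) * U (w - t *\<^sub>R h) + t * U (w + (1 - t) *\<^sub>R h)"
        using convex_onD[OF U, of t "w - t *\<^sub>R h" "w + (1 - t) *\<^sub>R h"] t by (simp add: w)
      have q: "(1 - t) * (norm (w - t *\<^sub>R h))\<^sup>2 + t * (norm (w + (1 - t) *\<^sub>R h))\<^sup>2 = (norm w)\<^sup>2 + t * (1 - t) * (norm h)\<^sup>2"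
      proof -
        have "w + (1 - t) *\<^sub>R h - (w - t *\<^sub>R h) = h" by (simp add: algebra_simps)
        then show ?thesis
          using quad[of t "w - t *\<^sub>R h" "w + (1 - t) *\<^sub>R h"] unfolding w by simp
      qed
      have "e w \<le> (1 - t) * (\<kappa> * (norm (w - t *\<^sub>R h))\<^sup>2 - U (w - t *\<^sub>R h))
          + t * (\<kappa> * (norm (w + (1 - t) *\<^sub>R h))\<^sup>2 - U (w + (1 - t) *\<^sub>R h)) - \<kappa> * (t * (1 - t) * (norm h)\<^sup>2)"
        unfolding e_def using t c_le by (intro diff_right_mono add_mono mult_left_mono) auto
      also have "\<dots> = \<kappa> * ((1 - t) * (norm (w - t *\<^sub>R h))\<^sup>2 + t * (norm (w + (1 - t) *\<^sub>R h))\<^sup>2)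
          - \<kappa> * (t * (1 - t) * (norm h)\<^sup>2) - ((1 - t) * U (w - t *\<^sub>R h) + t * U (w + (1 - t) *\<^sub>R h))"
        by (simp add: algebra_simps)
      also have "\<dots> \<le> \<kappa> * (norm w)\<^sup>2 - U w"
        unfolding q using Uw by (simp add: distrib_left)
      finally show "e w \<le> \<kappa> * (norm w)\<^sup>2 - U w" .
    qed
    then have "e z \<le> c z" by (rule upper)
    then have "(1 - t) * c x + t * c y - \<kappa> * (t * (1 - t) * (norm (y - x))\<^sup>2) \<le> c z"
      by (simp add: e_def flip: xz yz h_def)
    moreover have "\<kappa> * ((1 - t) * (norm x)\<^sup>2 + t * (norm y)\<^sup>2) = \<kappa> * (norm z)\<^sup>2 + \<kappa> * (t * (1 - t) * (norm (y - x))\<^sup>2)"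
      unfolding quad z_def by (simp add: distrib_left)
    ultimately show "\<kappa> * (norm ((1 - t) *\<^sub>R x + t *\<^sub>R y))\<^sup>2 - c ((1 - t) *\<^sub>R x + t *\<^sub>R y)
       \<le> (1 - t) * (\<kappa> * (norm x)\<^sup>2 - c x) + t * (\<kappa> * (norm y)\<^sup>2 - c y)"
      unfolding z_def[symmetric] by (simp add: algebra_simps)
  qed simp
  show thesis
    by (rule that[OF c_conv c_semi c_le]) (rule upper, simp add: M_def)
qed

section \<open>Upper semicontinuous functions\<close>

lemma usc_onD_nhds:
  assumes "usc_on A \<psi>" "z \<in> A" "\<psi> z < c"
  shows "\<forall>\<^sub>F w in inf (nhds z) (principal A). \<psi> w < c"
proof -
  have "\<forall>\<^sub>F w in at z within A. \<psi> w < c"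
    using assms by (auto simp: usc_on_def)
  then show ?thesis
    using assms(2,3) by (auto simp: eventually_inf_principal eventually_at_filter elim: eventually_mono)
qed

text \<open>The condition holds at \<open>z\<close> itself, so the punctured filter may be replaced
  by the filter that defines \<open>usc_reg\<close>. Most later arguments use this form.\<close>

lemma usc_on_iff_nhds:
  "usc_on A \<psi> \<longleftrightarrow> (\<forall>z\<in>A. \<psi> z < \<infinity> \<and> (\<forall>c. \<psi> z < c \<longrightarrow> (\<forall>\<^sub>F w in inf (nhds z) (principal A). \<psi> w < c)))"
  (is "_ \<longleftrightarrow> ?R")
proof
  assume "usc_on A \<psi>"
  then show ?R
    using usc_onD_nhds[of A \<psi>] by (auto simp: usc_on_def)
next
  assume R: ?R
  have "\<forall>\<^sub>F w in at z within A. \<psi> w < c" if "z \<in> A" "\<psi> z < c" for z c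
  proof -
    have "\<forall>\<^sub>F w in inf (nhds z) (principal A). \<psi> w < c" using R that by blast
    then show ?thesis
      by (auto simp: eventually_inf_principal eventually_at_filter elim: eventually_mono)
  qed
  with R show "usc_on A \<psi>" by (auto simp: usc_on_def)
qed

lemma usc_on_real_iff:
  "usc_on A (\<lambda>z. ereal (\<psi> z)) \<longleftrightarrow>
    (\<forall>z\<in>A. \<forall>c>\<psi> z. \<forall>\<^sub>F w in inf (nhds z) (principal A). \<psi> w < c)" (is "?L \<longleftrightarrow> ?R")
proof
  assume ?L
  then have "\<forall>\<^sub>F w in inf (nhds z) (principal A). ereal (\<psi> w) < ereal c" if "z \<in> A" "\<psi> z < c" for z c
    using usc_onD_nhds[of A "\<lambda>z. ereal (\<psi> z)" z "ereal c"] that by simp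
  then show ?R by simp
next
  assume R: ?R
  have "\<forall>\<^sub>F w in inf (nhds z) (principal A). ereal (\<psi> w) < c" if "z \<in> A" "ereal (\<psi> z) < c" for z c
    using R that by (cases c) auto
  then show ?L
    unfolding usc_on_iff_nhds by auto
qed

lemma usc_on_subset:
  assumes "usc_on A \<psi>" "B \<subseteq> A"
  shows "usc_on B \<psi>"
proof -
  have "inf (nhds z) (principal B) \<le> inf (nhds z) (principal A)" for z
    using assms(2) by (intro inf_mono) auto
  then show ?thesis
    using assms unfolding usc_on_iff_nhds by (meson filter_leD subsetD)
qed

lemma usc_on_sequentially:
  assumes "usc_on A \<psi>" "\<And>k. x k \<in> A" "x \<longlonglongrightarrow> l" "l \<in> A" "\<psi> l < c"
  shows "\<forall>\<^sub>F k in sequentially. \<psi> (x k) < c"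
proof -
  have "filterlim x (inf (nhds l) (principal A)) sequentially"
    using assms(2,3) by (auto simp: filterlim_inf filterlim_principal)
  then show ?thesis
    using usc_onD_nhds[OF assms(1,4,5)] by (auto simp: filterlim_iff)
qed

lemma tendsto_at_within_iff_nhds:
  "(g \<longlongrightarrow> g z) (at z within A) \<longleftrightarrow> (g \<longlongrightarrow> g z) (inf (nhds z) (principal A))" if "z \<in> A"
proof -
  have "(\<forall>\<^sub>F x in at z within A. g x \<in> S) \<longleftrightarrow> (\<forall>\<^sub>F x in inf (nhds z) (principal A). g x \<in> S)" if "g z \<in> S" for S
    unfolding eventually_inf_principal eventually_at_filter
    by (rule eventually_cong[OF always_eventually[of "\<lambda>_. True"]]) (use that in auto)
  then show ?thesis
    by (auto simp: tendsto_def)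
qed

lemma continuous_on_imp_tendsto_nhds:
  assumes "continuous_on A g" "z \<in> A"
  shows "(g \<longlongrightarrow> g z) (inf (nhds z) (principal A))"
  using assms tendsto_at_within_iff_nhds[OF assms(2), of g] by (simp add: continuous_on_def)

lemma usc_on_add:
  fixes \<psi> g :: "'a::topological_space \<Rightarrow> real"
  assumes "usc_on A (\<lambda>z. ereal (\<psi> z))" "usc_on A (\<lambda>z. ereal (g z))"
  shows "usc_on A (\<lambda>z. ereal (\<psi> z + g z))"
  unfolding usc_on_real_iff
proof (intro ballI allI impI)
  fix z c assume z: "z \<in> A" "\<psi> z + g z < c"
  define e where "e = (c - (\<psi> z + g z)) / 2"
  have e: "e > 0" using z by (simp add: e_def)
  have "\<forall>\<^sub>F w in inf (nhds z) (principal A). \<psi> w < \<psi> z + e"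
    using assms(1) z e by (auto simp: usc_on_real_iff)
  moreover have "\<forall>\<^sub>F w in inf (nhds z) (principal A). g w < g z + e"
    using assms(2) z e by (auto simp: usc_on_real_iff)
  ultimately show "\<forall>\<^sub>F w in inf (nhds z) (principal A). \<psi> w + g w < c"
    by eventually_elim (auto simp: e_def field_simps)
qed

lemma continuous_on_imp_usc_on:
  fixes g :: "'a::topological_space \<Rightarrow> real"
  assumes "continuous_on A g"
  shows "usc_on A (\<lambda>z. ereal (g z))"
  unfolding usc_on_real_iff using order_tendstoD(2)[OF continuous_on_imp_tendsto_nhds[OF assms]] by blast

lemma usc_on_add_continuous:
  fixes \<psi> g :: "'a::topological_space \<Rightarrow> real"
  assumes "usc_on A (\<lambda>z. ereal (\<psi> z))" "continuous_on A g"
  shows "usc_on A (\<lambda>z. ereal (\<psi> z + g z))"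
  by (rule usc_on_add[OF assms(1) continuous_on_imp_usc_on[OF assms(2)]])

lemma usc_on_translate:
  fixes g :: "'a::real_normed_vector \<Rightarrow> real"
  assumes usc: "usc_on A (\<lambda>z. ereal (g z))" and B: "\<And>v. v \<in> B \<Longrightarrow> z + v \<in> A"
  shows "usc_on B (\<lambda>v. ereal (g (z + v)))"
  unfolding usc_on_real_iff
proof (intro ballI allI impI)
  fix v c assume v: "v \<in> B" "g (z + v) < c"
  then have ev: "\<forall>\<^sub>F w in inf (nhds (z + v)) (principal A). g w < c"
    using usc B unfolding usc_on_real_iff by blast
  have "filterlim (\<lambda>v. z + v) (inf (nhds (z + v)) (principal A)) (inf (nhds v) (principal B))"
    unfolding filterlim_inf filterlim_principal
  proof
    show "((+) z \<longlongrightarrow> z + v) (inf (nhds v) (principal B))"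
      by (intro tendsto_intros filterlim_mono[OF filterlim_ident[of "nhds v"]]) auto
    show "\<forall>\<^sub>F x in inf (nhds v) (principal B). z + x \<in> A"
      unfolding eventually_inf_principal by (rule always_eventually) (use B in auto)
  qed
  then show "\<forall>\<^sub>F w in inf (nhds v) (principal B). g (z + w) < c"
    using ev by (auto simp: filterlim_iff)
qed

text \<open>Without a maximum every \<open>x\<close> is beaten by some \<open>Y x\<close>, and the
  sets where \<open>\<psi>\<close> stays below \<open>\<psi> (Y x)\<close> cover \<open>K\<close>.
  In a finite subcover the largest of these bounds is itself a value of \<open>\<psi>\<close> on
  \<open>K\<close> and would have to lie below another bound.\<close>

lemma usc_on_compact_attains_sup:
  assumes usc: "usc_on K \<psi>" and K: "compact K" "K \<noteq> {}"
  obtains x where "x \<in> K" "\<And>y. y \<in> K \<Longrightarrow> \<psi> y \<le> \<psi> x"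
proof (rule ccontr)
  assume "\<not> thesis"
  with that have "\<forall>x\<in>K. \<exists>y\<in>K. \<psi> x < \<psi> y" by (meson linorder_not_le)
  then obtain Y where Y: "\<And>x. x \<in> K \<Longrightarrow> Y x \<in> K" "\<And>x. x \<in> K \<Longrightarrow> \<psi> x < \<psi> (Y x)" by metis
  have "\<exists>U. open U \<and> x \<in> U \<and> (\<forall>w\<in>U \<inter> K. \<psi> w < \<psi> (Y x))" if "x \<in> K" for x
    using usc_onD_nhds[OF usc that Y(2)[OF that]]
    by (auto simp: eventually_inf_principal eventually_nhds)
  then obtain U where U: "\<And>x. x \<in> K \<Longrightarrow> open (U x)" "\<And>x. x \<in> K \<Longrightarrow> x \<in> U x"
      "\<And>x w. x \<in> K \<Longrightarrow> w \<in> U x \<inter> K \<Longrightarrow> \<psi> w < \<psi> (Y x)" by metis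
  have "K \<subseteq> (\<Union>x\<in>K. U x)" using U(2) by auto
  then obtain F where F: "F \<subseteq> K" "finite F" "K \<subseteq> (\<Union>x\<in>F. U x)"
    using compactE_image[OF K(1), of K U] U(1) by blast
  have "F \<noteq> {}" using F(3) K(2) by auto
  then have "Max ((\<lambda>x. \<psi> (Y x)) ` F) \<in> (\<lambda>x. \<psi> (Y x)) ` F"
    using F(2) by (intro Max_in) auto
  then obtain x where x: "x \<in> F" "Max ((\<lambda>x. \<psi> (Y x)) ` F) = \<psi> (Y x)" by auto
  have xm: "\<psi> (Y x') \<le> \<psi> (Y x)" if "x' \<in> F" for x'
    using F(2) that unfolding x(2)[symmetric] by (intro Max_ge) auto
  obtain x' where "x' \<in> F" "Y x \<in> U x'" using F x(1) Y(1) by blast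
  then have "\<psi> (Y x) < \<psi> (Y x')" using F(1) x(1) U(3) Y(1) by (meson IntI subsetD)
  with xm[OF \<open>x' \<in> F\<close>] show False by simp
qed

lemma usc_on_compact_attains_sup_real:
  fixes \<psi> :: "'a::topological_space \<Rightarrow> real"
  assumes "usc_on K (\<lambda>z. ereal (\<psi> z))" "compact K" "K \<noteq> {}"
  obtains x where "x \<in> K" "\<And>y. y \<in> K \<Longrightarrow> \<psi> y \<le> \<psi> x"
  using usc_on_compact_attains_sup[OF assms] by (metis ereal_less_eq(3))

section \<open>The theorem on sums\<close>

text \<open>The second-order superjet of viscosity theory, normalised without the factor 1/2, so
  that \<open>A\<close> plays the role of half a Hessian.\<close>

definition upper_jet :: "('a::real_inner \<Rightarrow> real) \<Rightarrow> 'a \<Rightarrow> 'a \<Rightarrow> ('a \<Rightarrow> 'a) \<Rightarrow> bool" where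
  "upper_jet g x p A \<longleftrightarrow> linear A \<and> (\<forall>\<eta>>0. \<exists>\<delta>>0. \<forall>v. norm v < \<delta> \<longrightarrow>
     g (x + v) \<le> g x + p \<bullet> v + v \<bullet> A v + \<eta> * (norm v)\<^sup>2)"

text \<open>
  Up to the quadratic term \<open>\<kappa>|z|\<^sup>2\<close>, the function \<open>U\<close> is the sup-convolution of \<open>g\<close>.
\<close>

lemma sup_convolution:
  fixes g :: "'a::euclidean_space \<Rightarrow> real"
  assumes usc: "usc_on K (\<lambda>z. ereal (g z))" and K: "compact K" "K \<noteq> {}"
  obtains U X where "convex_on UNIV U" "\<And>z. X z \<in> K"
    "\<And>z. U z = g (X z) - \<kappa> * (norm (X z))\<^sup>2 + 2 * \<kappa> * (X z \<bullet> z)"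
    "\<And>x z. x \<in> K \<Longrightarrow> g x - \<kappa> * (norm x)\<^sup>2 + 2 * \<kappa> * (x \<bullet> z) \<le> U z"
proof -
  \<comment> \<open>By completing the square this is \<open>g x - \<kappa> * (norm (x - z))\<^sup>2
    + \<kappa> * (norm z)\<^sup>2\<close>. The expanded form is affine in \<open>z\<close>, so the
    supremum over \<open>x\<close> is convex.\<close>
  define \<Phi> where "\<Phi> x z = g x - \<kappa> * (norm x)\<^sup>2 + 2 * \<kappa> * (x \<bullet> z)" for x z
  have "\<exists>x\<in>K. \<forall>y\<in>K. \<Phi> y z \<le> \<Phi> x z" for z
  proof -
    have "usc_on K (\<lambda>x. ereal (g x + (2 * \<kappa> * (x \<bullet> z) - \<kappa> * (norm x)\<^sup>2)))"
      by (intro usc_on_add_continuous usc continuous_intros)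
    then have "usc_on K (\<lambda>x. ereal (\<Phi> x z))" by (simp add: \<Phi>_def algebra_simps)
    then show ?thesis using usc_on_compact_attains_sup_real[OF _ K] by metis
  qed
  then obtain X where X: "\<And>z. X z \<in> K" "\<And>z y. y \<in> K \<Longrightarrow> \<Phi> y z \<le> \<Phi> (X z) z" by metis
  define U where "U z = \<Phi> (X z) z" for z
  have "convex_on UNIV U"
  proof (rule convex_onI)
    fix t :: real and a b :: 'a assume t: "0 < t" "t < 1"
    define z where "z = (1 - t) *\<^sub>R a + t *\<^sub>R b"
    have "U z = (1 - t) * \<Phi> (X z) a + t * \<Phi> (X z) b"
      unfolding U_def \<Phi>_def by (simp add: z_def inner_add_right algebra_simps)
    also have "\<dots> \<le> (1 - t) * U a + t * U b"
      unfolding U_def using t X by (intro add_mono mult_left_mono) auto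
    finally show "U ((1 - t) *\<^sub>R a + t *\<^sub>R b) \<le> (1 - t) * U a + t * U b" by (simp add: z_def)
  qed simp
  then show thesis
    using that[of U X] X by (simp add: U_def \<Phi>_def)
qed

text \<open>If no \<open>k\<close> worked, there would be pairs with one point on the sphere and
  with \<open>k * (norm (x - y))\<^sup>2\<close> bounded. They accumulate at a single point of the
  sphere, where \<open>g + h \<le> - c\<close> and semicontinuity contradict the value
  \<open>- c / 2\<close>. The margin \<open>c / 2\<close> leaves room for the linear perturbation in
  the theorem on sums.\<close>

lemma doubling_penalty:
  fixes g h :: "'a::euclidean_space \<Rightarrow> real"
  assumes g: "usc_on (cball 0 \<rho>) (\<lambda>z. ereal (g z))" and h: "usc_on (cball 0 \<rho>) (\<lambda>z. ereal (h z))"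
    and \<rho>: "\<rho> > 0" and c: "c > 0" and bd: "\<And>x. norm x = \<rho> \<Longrightarrow> g x + h x \<le> - c"
  obtains k :: nat where "k > 0" "\<And>x y. norm x \<le> \<rho> \<Longrightarrow> norm y \<le> \<rho> \<Longrightarrow> - c / 2 + real k * (norm (x - y))\<^sup>2 \<le> g x + h y
      \<Longrightarrow> norm x < \<rho> \<and> norm y < \<rho>"
proof (rule ccontr)
  assume nt: "\<not> thesis"
  have "\<exists>x y. norm x \<le> \<rho> \<and> norm y \<le> \<rho> \<and> - c / 2 + real (Suc k) * (norm (x - y))\<^sup>2 \<le> g x + h y
       \<and> (norm x = \<rho> \<or> norm y = \<rho>)" for k
  proof (rule ccontr)
    assume "\<not> ?thesis"
    then have "norm x < \<rho> \<and> norm y < \<rho>"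
      if "norm x \<le> \<rho>" "norm y \<le> \<rho>" "- c / 2 + real (Suc k) * (norm (x - y))\<^sup>2 \<le> g x + h y" for x y
      using that by (metis order_le_less)
    with nt that[of "Suc k"] show False by blast
  qed
  then obtain x y where xy: "\<And>k. norm (x k) \<le> \<rho>" "\<And>k. norm (y k) \<le> \<rho>"
      "\<And>k. - c / 2 + real (Suc k) * (norm (x k - y k))\<^sup>2 \<le> g (x k) + h (y k)"
      "\<And>k. norm (x k) = \<rho> \<or> norm (y k) = \<rho>" by metis
  have ne: "cball (0::'a) \<rho> \<noteq> {}" using \<rho> by auto
  obtain mg where mg: "\<And>z. norm z \<le> \<rho> \<Longrightarrow> g z \<le> mg"
    using usc_on_compact_attains_sup_real[OF g compact_cball ne] by (metis mem_cball_0)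
  obtain mh where mh: "\<And>z. norm z \<le> \<rho> \<Longrightarrow> h z \<le> mh"
    using usc_on_compact_attains_sup_real[OF h compact_cball ne] by (metis mem_cball_0)
  define B where "B = mg + mh + c / 2"
  have B: "real (Suc k) * (norm (x k - y k))\<^sup>2 \<le> B" for k
    using xy(3)[of k] mg[OF xy(1)[of k]] mh[OF xy(2)[of k]] by (simp add: B_def)
  have "(\<lambda>k. (norm (x k - y k))\<^sup>2) \<longlonglongrightarrow> 0"
  proof (rule tendsto_sandwich[OF _ _ tendsto_const])
    show "(\<lambda>k. B * inverse (real (Suc k))) \<longlonglongrightarrow> 0"
      using tendsto_mult_left[OF LIMSEQ_inverse_real_of_nat, of B] by simp
    show "\<forall>\<^sub>F k in sequentially. (norm (x k - y k))\<^sup>2 \<le> B * inverse (real (Suc k))"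
      using B by (auto intro!: always_eventually simp: divide_simps mult.commute simp del: of_nat_Suc)
  qed auto
  then have "(\<lambda>k. sqrt ((norm (x k - y k))\<^sup>2)) \<longlonglongrightarrow> sqrt 0" by (rule tendsto_real_sqrt)
  then have d0: "(\<lambda>k. x k - y k) \<longlonglongrightarrow> 0" by (simp add: tendsto_norm_zero_iff)
  obtain l s where l: "l \<in> cball 0 \<rho>" "strict_mono s" "(x \<circ> s) \<longlonglongrightarrow> l"
    using compact_cball[of "0::'a" \<rho>, unfolded compact_def] xy(1) by (metis mem_cball_0)
  have xl: "(\<lambda>k. x (s k)) \<longlonglongrightarrow> l" using l(3) by (simp add: o_def)
  have "(\<lambda>k. x (s k) - (x (s k) - y (s k))) \<longlonglongrightarrow> l - 0"
    using LIMSEQ_subseq_LIMSEQ[OF d0 l(2)] by (intro tendsto_diff xl) (simp add: o_def)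
  then have yl: "(\<lambda>k. y (s k)) \<longlonglongrightarrow> l" by simp
  have "(\<lambda>k. max (norm (x (s k))) (norm (y (s k)))) \<longlonglongrightarrow> max (norm l) (norm l)"
    by (intro tendsto_max tendsto_norm xl yl)
  moreover have "max (norm (x (s k))) (norm (y (s k))) = \<rho>" for k
    using xy(1,2,4)[of "s k"] by auto
  ultimately have "norm l = \<rho>" using LIMSEQ_unique[OF _ tendsto_const] by force
  then have gl: "g l + h l \<le> - c" by (rule bd)
  have "\<forall>\<^sub>F k in sequentially. ereal (g (x (s k))) < ereal (g l + c / 4)"
    by (rule usc_on_sequentially[OF g _ xl l(1)]) (use xy c in auto)
  moreover have "\<forall>\<^sub>F k in sequentially. ereal (h (y (s k))) < ereal (h l + c / 4)"
    by (rule usc_on_sequentially[OF h _ yl l(1)]) (use xy c in auto)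
  ultimately have "\<forall>\<^sub>F k in sequentially. False"
  proof eventually_elim
    case (elim k)
    have "0 \<le> real (Suc (s k)) * (norm (x (s k) - y (s k)))\<^sup>2" by simp
    moreover have "g (x (s k)) < g l + c / 4" "h (y (s k)) < h l + c / 4" using elim by simp_all
    ultimately show False using xy(3)[of "s k"] gl by linarith
  qed
  then show False by simp
qed

text \<open>
  Let \<open>U\<close> and \<open>W\<close> be the sup-convolutions of \<open>g\<close> and \<open>h\<close>. For all small \<open>p\<close> the function
  \<open>U + W - 2\<kappa>|z|\<^sup>2 - p \<bullet> z\<close> has a maximum, and \<open>p\<close> is a Lipschitz function of the place of
  the maximum; so the set \<open>A\<close> of these places is not negligible. Replacing first \<open>U\<close> and then \<open>W\<close> by
  the least majorant \<open>u\<close>, \<open>w\<close> whose second derivatives are at most those of \<open>2\<kappa>|z|\<^sup>2\<close> changes neither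
  the maxima nor the values on \<open>A\<close>, and \<open>u\<close> and \<open>w\<close> are twice differentiable almost everywhere.
\<close>

theorem theorem_on_sums:
  fixes g h :: "'a::euclidean_space \<Rightarrow> real"
  assumes g: "usc_on (cball 0 \<rho>) (\<lambda>z. ereal (g z))" and h: "usc_on (cball 0 \<rho>) (\<lambda>z. ereal (h z))"
    and \<rho>: "\<rho> > 0" and c: "c > 0" and bd: "\<And>x. norm x = \<rho> \<Longrightarrow> g x + h x \<le> - c"
    and at0: "g 0 + h 0 \<ge> 0"
  obtains x y p1 p2 A1 A2 where "norm x < \<rho>" "norm y < \<rho>" "upper_jet g x p1 A1" "upper_jet h y p2 A2"
    "\<And>v. v \<bullet> A1 v + v \<bullet> A2 v \<le> 0"
proof -
  have ne: "cball (0::'a) \<rho> \<noteq> {}" using \<rho> by auto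
  obtain kk :: nat where kk: "kk > 0" and interior: "\<And>x y. norm x \<le> \<rho> \<Longrightarrow> norm y \<le> \<rho> \<Longrightarrow>
      - c / 2 + real kk * (norm (x - y))\<^sup>2 \<le> g x + h y \<Longrightarrow> norm x < \<rho> \<and> norm y < \<rho>"
    by (rule doubling_penalty[OF g h \<rho> c bd]) auto
  \<comment> \<open>The factor \<open>2\<close> comes from
    \<open>|X - Y|^2 \<le> 2 |X - z|^2 + 2 |Y - z|^2\<close>: the two convolution penalties dominate
    the penalty \<open>kk\<close> between \<open>X z\<close> and \<open>Y z\<close>.\<close>
  define \<kappa> where "\<kappa> = 2 * real kk"
  have \<kappa>: "\<kappa> > 0" using kk by (simp add: \<kappa>_def)
  obtain U X where U: "convex_on UNIV U" "\<And>z. X z \<in> cball 0 \<rho>"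
    "\<And>z. U z = g (X z) - \<kappa> * (norm (X z))\<^sup>2 + 2 * \<kappa> * (X z \<bullet> z)"
    "\<And>x z. x \<in> cball 0 \<rho> \<Longrightarrow> g x - \<kappa> * (norm x)\<^sup>2 + 2 * \<kappa> * (x \<bullet> z) \<le> U z"
    using sup_convolution[OF g compact_cball ne, of \<kappa>] by metis
  obtain W Y where W: "convex_on UNIV W" "\<And>z. Y z \<in> cball 0 \<rho>"
    "\<And>z. W z = h (Y z) - \<kappa> * (norm (Y z))\<^sup>2 + 2 * \<kappa> * (Y z \<bullet> z)"
    "\<And>x z. x \<in> cball 0 \<rho> \<Longrightarrow> h x - \<kappa> * (norm x)\<^sup>2 + 2 * \<kappa> * (x \<bullet> z) \<le> W z"
    using sup_convolution[OF h compact_cball ne, of \<kappa>] by metis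
  have sq: "\<kappa> * (norm (a - z))\<^sup>2 = \<kappa> * (norm a)\<^sup>2 - 2 * \<kappa> * (a \<bullet> z) + \<kappa> * (norm z)\<^sup>2" for a z :: 'a
    by (simp add: power2_norm_eq_inner inner_diff_left inner_diff_right inner_commute algebra_simps)
  have Uz: "U z - \<kappa> * (norm z)\<^sup>2 = g (X z) - \<kappa> * (norm (X z - z))\<^sup>2" for z
    unfolding U(3) sq by simp
  have Wz: "W z - \<kappa> * (norm z)\<^sup>2 = h (Y z) - \<kappa> * (norm (Y z - z))\<^sup>2" for z
    unfolding W(3) sq by simp
  define S where "S p z = U z + W z - 2 * \<kappa> * (norm z)\<^sup>2 - p \<bullet> z" for p z
  have Sz: "S p z = g (X z) - \<kappa> * (norm (X z - z))\<^sup>2 + (h (Y z) - \<kappa> * (norm (Y z - z))\<^sup>2) - p \<bullet> z" for p z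
    unfolding S_def Uz[symmetric] Wz[symmetric] by simp
  have S0: "S p 0 \<ge> 0" for p
    using U(4)[of 0 0] W(4)[of 0 0] at0 \<rho> by (simp add: S_def)
  obtain mg where mg: "\<And>z. norm z \<le> \<rho> \<Longrightarrow> g z \<le> mg"
    using usc_on_compact_attains_sup_real[OF g compact_cball ne] by (metis mem_cball_0)
  obtain mh where mh: "\<And>z. norm z \<le> \<rho> \<Longrightarrow> h z \<le> mh"
    using usc_on_compact_attains_sup_real[OF h compact_cball ne] by (metis mem_cball_0)
  \<comment> \<open>Beyond \<open>R\<close> the distance \<open>s\<close> of \<open>z\<close> to the
    ball is at least \<open>1 / \<kappa>\<close>, so that
    \<open>\<kappa> * s\<^sup>2 \<ge> s\<close> absorbs the linear term, and it exceeds
    \<open>\<bar>mg + mh + \<rho>\<bar>\<close>, which makes \<open>S p z\<close> negative.\<close>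
  define R where "R = \<rho> + 1 + 1 / \<kappa> + \<bar>mg + mh + \<rho>\<bar>"
  have R: "R > 0" using \<rho> \<kappa> by (simp add: R_def add_pos_nonneg)
  have far: "S p z < 0" if p: "norm p \<le> 1" and z: "norm z \<ge> R" for p z
  proof -
    define s where "s = norm z - \<rho>"
    have s: "s \<ge> 1 / \<kappa>" "s > \<bar>mg + mh + \<rho>\<bar>" "s > 0" 
      using z \<kappa> unfolding s_def R_def by (auto intro: less_le_trans[OF zero_less_one] simp: add_pos_nonneg)
        (smt (verit) zero_less_divide_1_iff)+
    have d: "\<kappa> * s\<^sup>2 \<le> \<kappa> * (norm (a - z))\<^sup>2" if "norm a \<le> \<rho>" for a
      using norm_triangle_ineq3[of z a] that s \<kappa>
      by (intro mult_left_mono power_mono) (auto simp: s_def norm_minus_commute)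
    have "- (p \<bullet> z) \<le> norm p * norm z"
      using Cauchy_Schwarz_ineq2[of p z] by linarith
    also have "\<dots> \<le> norm z" using p by (simp add: mult_left_le_one_le)
    finally have "- (p \<bullet> z) \<le> s + \<rho>" by (simp add: s_def)
    then have "S p z \<le> mg + mh - 2 * (\<kappa> * s\<^sup>2) + s + \<rho>"
      unfolding Sz using mg[of "X z"] mh[of "Y z"] d[of "X z"] d[of "Y z"] U(2)[of z] W(2)[of z] by simp
    moreover have "\<kappa> * s\<^sup>2 \<ge> s"
    proof -
      have "1 * s \<le> (\<kappa> * s) * s" using s \<kappa> by (intro mult_right_mono) (auto simp: divide_simps mult.commute)
      then show ?thesis by (simp add: power2_eq_square mult_ac)
    qed
    ultimately show ?thesis using s(2) by linarith
  qed
  have contS: "continuous_on UNIV (S p)" for p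
    unfolding S_def[abs_def]
    by (intro continuous_intros convex_on_continuous U(1) W(1)) auto
  have ex_max: "\<exists>z. norm z \<le> R \<and> S p z \<ge> 0 \<and> (\<forall>z'. S p z' \<le> S p z)" if p: "norm p \<le> 1" for p
  proof -
    obtain z where z: "norm z \<le> R" "\<And>z'. norm z' \<le> R \<Longrightarrow> S p z' \<le> S p z"
      using continuous_attains_sup[of "cball 0 R" "S p"] R continuous_on_subset[OF contS] by force
    have "S p z \<ge> 0" using z(2)[of 0] S0[of p] R by simp
    then show ?thesis
      using z far[OF p] by (meson less_le_not_le linorder_le_cases order_trans)
  qed
  \<comment> \<open>For such \<open>p\<close> the term \<open>p \<bullet> z\<close> is at most
    \<open>c / 2\<close> in absolute value when \<open>norm z \<le> R\<close>, the margin granted by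
    \<open>doubling_penalty\<close>.\<close>
  define \<delta>0 where "\<delta>0 = min 1 (c / (2 * R))"
  have \<delta>0: "\<delta>0 > 0" using c R by (simp add: \<delta>0_def)
  define A where "A = {z. \<exists>p. norm p < \<delta>0 \<and> (\<forall>z'. S p z' \<le> S p z)}"
  \<comment> \<open>A subgradient of \<open>U + W\<close>. At a maximum of \<open>S p\<close> it
    must equal the gradient of the quadratic function touching from above, so \<open>p\<close> is
    recovered from the place \<open>z\<close> as
    \<open>\<xi> z - (4 * \<kappa>) *\<^sub>R z\<close>.\<close>
  define \<xi> where "\<xi> z = (2 * \<kappa>) *\<^sub>R (X z + Y z)" for z
  have subU: "U z + (2 * \<kappa> * (X z \<bullet> v)) \<le> U (z + v)" for z v
    using U(4)[OF U(2)[of z], of "z + v"] U(3)[of z] by (simp add: inner_add_right algebra_simps)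
  have subW: "W z + (2 * \<kappa> * (Y z \<bullet> v)) \<le> W (z + v)" for z v
    using W(4)[OF W(2)[of z], of "z + v"] W(3)[of z] by (simp add: inner_add_right algebra_simps)
  have sub: "(U z + W z) + \<xi> z \<bullet> v \<le> U (z + v) + W (z + v)" for z v
    using subU[of z v] subW[of z v] by (simp add: \<xi>_def inner_add_left algebra_simps)
  have touch: "U (z + v) + W (z + v) \<le> (U z + W z) + ((4 * \<kappa>) *\<^sub>R z + p) \<bullet> v + 2 * \<kappa> * (norm v)\<^sup>2"
    if "\<forall>z'. S p z' \<le> S p z" for p z v
    using spec[OF that, of "z + v"] unfolding S_def power2_norm_add by (simp add: inner_add_left inner_add_right algebra_simps)
  have grad: "\<xi> z = (4 * \<kappa>) *\<^sub>R z + p" if "\<forall>z'. S p z' \<le> S p z" for p z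
  proof -
    have "\<xi> z - ((4 * \<kappa>) *\<^sub>R z + p) = 0"
    proof (rule linear_le_quadratic_imp_zero)
      fix v show "(\<xi> z - ((4 * \<kappa>) *\<^sub>R z + p)) \<bullet> v \<le> 2 * \<kappa> * (norm v)\<^sup>2"
        using sub[of z v] touch[OF that, of v] by (simp add: inner_diff_left)
    qed
    then show ?thesis by simp
  qed
  have \<xi>lip: "norm (\<xi> b - \<xi> a) \<le> 8 * \<kappa> * norm (b - a)" if a: "a \<in> A" for a b
  proof -
    obtain p where p: "\<forall>z'. S p z' \<le> S p a" using a by (auto simp: A_def)
    have "norm (\<xi> b - \<xi> a) \<le> 4 * (2 * \<kappa>) * norm (b - a)"
      by (rule sandwich_gradient_lipschitz[where f = "\<lambda>z. U z + W z"])
        (use sub touch[OF p] \<kappa> in \<open>auto simp flip: grad[OF p]\<close>)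
    then show ?thesis by simp
  qed
  have "\<not> negligible A"
  proof
    assume neg: "negligible A"
    define P where "P z = \<xi> z - (4 * \<kappa>) *\<^sub>R z" for z
    have "negligible (P ` A)"
    proof (rule negligible_locally_Lipschitz_image[OF _ neg])
      fix a assume a: "a \<in> A"
      have "norm (P y - P a) \<le> (12 * \<kappa>) * norm (y - a)" for y
      proof -
        have "P y - P a = (\<xi> y - \<xi> a) - (4 * \<kappa>) *\<^sub>R (y - a)" by (simp add: P_def algebra_simps)
        then have "norm (P y - P a) \<le> norm (\<xi> y - \<xi> a) + norm ((4 * \<kappa>) *\<^sub>R (y - a))"
          by (metis norm_triangle_ineq4)
        then show ?thesis using \<xi>lip[OF a, of y] \<kappa> by simp
      qed
      then show "\<exists>T B. open T \<and> a \<in> T \<and> (\<forall>y\<in>A \<inter> T. norm (P y - P a) \<le> B * norm (y - a))"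
        by (intro exI[of _ UNIV] exI[of _ "12 * \<kappa>"]) auto
    qed simp
    moreover have "ball 0 \<delta>0 \<subseteq> P ` A"
    proof
      fix p :: 'a assume "p \<in> ball 0 \<delta>0"
      then have p: "norm p < \<delta>0" by simp
      then have "norm p \<le> 1" by (simp add: \<delta>0_def)
      then obtain z where z: "\<forall>z'. S p z' \<le> S p z" using ex_max by blast
      then have "z \<in> A" using p by (auto simp: A_def)
      moreover have "P z = p" using grad[OF z] by (simp add: P_def)
      ultimately show "p \<in> P ` A" by blast
    qed
    ultimately have "negligible (ball (0::'a) \<delta>0)" by (rule negligible_subset)
    then show False using \<delta>0 open_not_negligible[of "ball (0::'a) \<delta>0"] by simp
  qed
  have convex_affine: "convex_on UNIV (\<lambda>z. V z - p \<bullet> z - m)" if "convex_on UNIV V" for V :: "'a \<Rightarrow> real" and p m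
  proof -
    have "convex_on UNIV (\<lambda>z. V z + (- (p \<bullet> z) - m))"
      by (rule convex_on_add[OF that]) (auto intro!: convex_onI simp: inner_add_right algebra_simps)
    then show ?thesis by (simp add: algebra_simps)
  qed
  \<comment> \<open>A single maximum provides a convex minorant, without which the hull in
    \<open>convex_hull_of_semiconcave\<close> would be a supremum over the empty set.\<close>
  obtain z0 p0 where z0: "\<forall>z'. S p0 z' \<le> S p0 z0"
    using ex_max[of 0] by auto
  obtain cU where cU: "convex_on UNIV cU" "convex_on UNIV (\<lambda>z. 2 * \<kappa> * (norm z)\<^sup>2 - cU z)"
    "\<And>z. cU z \<le> 2 * \<kappa> * (norm z)\<^sup>2 - U z"
    "\<And>g z. convex_on UNIV g \<Longrightarrow> (\<And>z. g z \<le> 2 * \<kappa> * (norm z)\<^sup>2 - U z) \<Longrightarrow> g z \<le> cU z"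
  proof (rule convex_hull_of_semiconcave[OF U(1) convex_affine[OF W(1), of p0 "S p0 z0"], of "2 * \<kappa>"])
    show "W z - p0 \<bullet> z - S p0 z0 \<le> 2 * \<kappa> * (norm z)\<^sup>2 - U z" for z
      using spec[OF z0, of z] by (simp add: S_def)
  qed blast
  define u where "u z = 2 * \<kappa> * (norm z)\<^sup>2 - cU z" for z
  have uU: "U z \<le> u z" for z using cU(3)[of z] by (simp add: u_def)
  \<comment> \<open>Each maximum makes \<open>W\<close> minus an affine function a convex minorant,
    hence a minorant of the hull \<open>cU\<close>. So the inequality survives the replacement of
    \<open>U\<close> by \<open>u\<close>, for all \<open>p\<close> at once.\<close>
  have uW: "u z' + W z' \<le> 2 * \<kappa> * (norm z')\<^sup>2 + p \<bullet> z' + S p z" if "\<forall>z'. S p z' \<le> S p z" for p z z'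
  proof -
    have "W z' - p \<bullet> z' - S p z \<le> cU z'"
    proof (rule cU(4)[OF convex_affine[OF W(1)]])
      show "W w - p \<bullet> w - S p z \<le> 2 * \<kappa> * (norm w)\<^sup>2 - U w" for w
        using spec[OF that, of w] by (simp add: S_def)
    qed
    then show ?thesis by (simp add: u_def)
  qed
  have convu: "convex_on UNIV u" using cU(2) by (simp add: u_def[abs_def])
  obtain cW where cW: "convex_on UNIV cW" "convex_on UNIV (\<lambda>z. 2 * \<kappa> * (norm z)\<^sup>2 - cW z)"
    "\<And>z. cW z \<le> 2 * \<kappa> * (norm z)\<^sup>2 - W z"
    "\<And>g z. convex_on UNIV g \<Longrightarrow> (\<And>z. g z \<le> 2 * \<kappa> * (norm z)\<^sup>2 - W z) \<Longrightarrow> g z \<le> cW z"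
  proof (rule convex_hull_of_semiconcave[OF W(1) convex_affine[OF convu, of p0 "S p0 z0"], of "2 * \<kappa>"])
    show "u z - p0 \<bullet> z - S p0 z0 \<le> 2 * \<kappa> * (norm z)\<^sup>2 - W z" for z
      using uW[OF z0, of z] by simp
  qed blast
  define w where "w z = 2 * \<kappa> * (norm z)\<^sup>2 - cW z" for z
  have wW: "W z \<le> w z" for z using cW(3)[of z] by (simp add: w_def)
  have uw: "u z' + w z' \<le> 2 * \<kappa> * (norm z')\<^sup>2 + p \<bullet> z' + S p z" if "\<forall>z'. S p z' \<le> S p z" for p z z'
  proof -
    have "u z' - p \<bullet> z' - S p z \<le> cW z'"
    proof (rule cW(4)[OF convex_affine[OF convu]])
      show "u y - p \<bullet> y - S p z \<le> 2 * \<kappa> * (norm y)\<^sup>2 - W y" for y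
        using uW[OF that, of y] by simp
    qed
    then show ?thesis by (simp add: w_def)
  qed
  have convw: "convex_on UNIV w" using cW(2) by (simp add: w_def[abs_def])
  define exp2 where "exp2 E z p B \<longleftrightarrow> linear B \<and> (\<forall>\<eta>>0. \<exists>\<delta>>0. \<forall>v. norm v < \<delta> \<longrightarrow>
           \<bar>E (z + v) - E z - p \<bullet> v - v \<bullet> B v\<bar> \<le> \<eta> * (norm v)\<^sup>2)" for E :: "'a \<Rightarrow> real" and z p B
  have "AE z in lebesgue. \<exists>p B. exp2 u z p B"
    unfolding exp2_def by (rule alexandrov_lipschitz_gradient[OF convu, of "2 * \<kappa>"]) (simp add: u_def cU(1))
  moreover have "AE z in lebesgue. \<exists>p B. exp2 w z p B"
    unfolding exp2_def by (rule alexandrov_lipschitz_gradient[OF convw, of "2 * \<kappa>"]) (simp add: w_def cW(1))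
  ultimately have "AE z in lebesgue. (\<exists>p B. exp2 u z p B) \<and> (\<exists>p B. exp2 w z p B)"
    by eventually_elim blast
  then obtain N where N: "N \<in> null_sets lebesgue"
      "{z \<in> space lebesgue. \<not> ((\<exists>p B. exp2 u z p B) \<and> (\<exists>p B. exp2 w z p B))} \<subseteq> N"
    unfolding eventually_ae_filter by blast
  have "\<not> A \<subseteq> N"
    using N(1) \<open>\<not> negligible A\<close> negligible_subset by (auto simp: negligible_iff_null_sets[symmetric])
  then obtain z p1 B1 p2 B2 where z: "z \<in> A" and B1: "exp2 u z p1 B1" and B2: "exp2 w z p2 B2"
    using N(2)[unfolded space_completion space_lborel space_borel] by blast
  obtain p where p: "norm p < \<delta>0" "\<forall>z'. S p z' \<le> S p z" using z by (auto simp: A_def)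
  have "norm z \<le> R" 
    using far[of p z] S0[of p] spec[OF p(2), of 0] p(1) by (force simp: \<delta>0_def)
  have Sp0: "S p z \<ge> 0" using S0[of p] spec[OF p(2), of 0] by linarith
  have eq: "u z + w z = 2 * \<kappa> * (norm z)\<^sup>2 + p \<bullet> z + S p z" "u z = U z" "w z = W z"
    using uU[of z] wW[of z] uw[OF p(2), of z] by (auto simp: S_def)
  have lB1: "linear B1" and lB2: "linear B2" using B1 B2 by (auto simp: exp2_def)
  have quad_le: "v \<bullet> B1 v + v \<bullet> B2 v \<le> 2 * \<kappa> * (norm v)\<^sup>2" for v
  proof (cases "v = 0")
    case False
    show ?thesis
    proof (rule field_le_epsilon)
      fix e :: real assume e: "e > 0"
      define \<eta> where "\<eta> = e / (2 * (norm v)\<^sup>2)"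
      have \<eta>: "\<eta> > 0" using e False by (simp add: \<eta>_def)
      obtain \<delta>1 where \<delta>1: "\<delta>1 > 0" "\<And>v. norm v < \<delta>1 \<Longrightarrow> \<bar>u (z + v) - u z - p1 \<bullet> v - v \<bullet> B1 v\<bar> \<le> \<eta> * (norm v)\<^sup>2"
        using B1 \<eta> unfolding exp2_def by metis
      obtain \<delta>2 where \<delta>2: "\<delta>2 > 0" "\<And>v. norm v < \<delta>2 \<Longrightarrow> \<bar>w (z + v) - w z - p2 \<bullet> v - v \<bullet> B2 v\<bar> \<le> \<eta> * (norm v)\<^sup>2"
        using B2 \<eta> unfolding exp2_def by metis
      define t where "t = min \<delta>1 \<delta>2 / (2 * norm v)"
      have t: "t > 0" "norm (t *\<^sub>R v) < \<delta>1" "norm (t *\<^sub>R v) < \<delta>2"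
        using False \<delta>1(1) \<delta>2(1) by (auto simp: t_def min_def)
      let ?a = "t *\<^sub>R v"
      \<comment> \<open>Adding the expansions at \<open>?a\<close> and \<open>- ?a\<close> cancels
        all first-order terms, and dividing by \<open>t\<^sup>2\<close> isolates the quadratic
        forms.\<close>
      have 1: "p1 \<bullet> ?a + ?a \<bullet> B1 ?a - \<eta> * (norm ?a)\<^sup>2 \<le> u (z + ?a) - u z"
              "p1 \<bullet> (- ?a) + ?a \<bullet> B1 ?a - \<eta> * (norm ?a)\<^sup>2 \<le> u (z + - ?a) - u z"
        using \<delta>1(2)[OF t(2)] \<delta>1(2)[of "- ?a"] t(2) by (auto simp: linear_neg[OF lB1])
      have 2: "p2 \<bullet> ?a + ?a \<bullet> B2 ?a - \<eta> * (norm ?a)\<^sup>2 \<le> w (z + ?a) - w z"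
              "p2 \<bullet> (- ?a) + ?a \<bullet> B2 ?a - \<eta> * (norm ?a)\<^sup>2 \<le> w (z + - ?a) - w z"
        using \<delta>2(2)[OF t(3)] \<delta>2(2)[of "- ?a"] t(3) by (auto simp: linear_neg[OF lB2])
      have 3: "u (z + ?a) - u z + (w (z + ?a) - w z) \<le> 4 * \<kappa> * (z \<bullet> ?a) + 2 * \<kappa> * (norm ?a)\<^sup>2 + p \<bullet> ?a"
        using uw[OF p(2), of "z + ?a"] eq(1) unfolding power2_norm_add by (simp add: inner_add_right algebra_simps)
      have 4: "u (z + - ?a) - u z + (w (z + - ?a) - w z) \<le> - (4 * \<kappa> * (z \<bullet> ?a)) + 2 * \<kappa> * (norm ?a)\<^sup>2 - p \<bullet> ?a"
        using uw[OF p(2), of "z + - ?a"] eq(1) unfolding power2_norm_add by (simp add: inner_add_right inner_diff_right algebra_simps)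
      have "?a \<bullet> B1 ?a + ?a \<bullet> B2 ?a \<le> 2 * \<kappa> * (norm ?a)\<^sup>2 + 2 * (\<eta> * (norm ?a)\<^sup>2)"
        using 1 2 3 4 by (simp del: norm_scaleR inner_scaleR_left inner_scaleR_right)
      then have "t\<^sup>2 * (v \<bullet> B1 v + v \<bullet> B2 v) \<le> t\<^sup>2 * (2 * \<kappa> * (norm v)\<^sup>2 + 2 * (\<eta> * (norm v)\<^sup>2))"
        by (simp add: linear_scale[OF lB1] linear_scale[OF lB2] power_mult_distrib)
          (simp add: power2_eq_square algebra_simps)
      then have "v \<bullet> B1 v + v \<bullet> B2 v \<le> 2 * \<kappa> * (norm v)\<^sup>2 + 2 * (\<eta> * (norm v)\<^sup>2)"
        using t(1) by simp
      also have "2 * (\<eta> * (norm v)\<^sup>2) = e" using False by (simp add: \<eta>_def)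
      finally show "v \<bullet> B1 v + v \<bullet> B2 v \<le> 2 * \<kappa> * (norm v)\<^sup>2 + e" .
    qed
  qed simp
  have in_ball: "norm (X z) < \<rho> \<and> norm (Y z) < \<rho>"
  proof (rule interior)
    show "norm (X z) \<le> \<rho>" "norm (Y z) \<le> \<rho>" using U(2)[of z] W(2)[of z] by auto
    have "\<bar>p \<bullet> z\<bar> \<le> norm p * norm z" by (rule Cauchy_Schwarz_ineq2)
    also have "\<dots> \<le> \<delta>0 * R" using p(1) \<open>norm z \<le> R\<close> \<delta>0 by (intro mult_mono) auto
    also have "\<dots> \<le> c / (2 * R) * R" using R by (intro mult_right_mono) (auto simp: \<delta>0_def)
    also have "\<dots> = c / 2" using R by simp
    finally have "- c / 2 \<le> p \<bullet> z" by simp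
    moreover have "real kk * (norm (X z - Y z))\<^sup>2 \<le> \<kappa> * (norm (X z - z))\<^sup>2 + \<kappa> * (norm (Y z - z))\<^sup>2"
    proof -
      have "(norm (X z - Y z))\<^sup>2 \<le> 2 * (norm (X z - z))\<^sup>2 + 2 * (norm (Y z - z))\<^sup>2"
      proof -
        have "norm (X z - Y z) \<le> norm (X z - z) + norm (Y z - z)"
          using norm_triangle_ineq4[of "X z - z" "Y z - z"] by simp
        then have "(norm (X z - Y z))\<^sup>2 \<le> (norm (X z - z) + norm (Y z - z))\<^sup>2" by (intro power_mono) auto
        also have "\<dots> \<le> 2 * (norm (X z - z))\<^sup>2 + 2 * (norm (Y z - z))\<^sup>2"
          using zero_le_power2[of "norm (X z - z) - norm (Y z - z)"] by (simp add: power2_sum power2_diff)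
        finally show ?thesis .
      qed
      then have "real kk * (norm (X z - Y z))\<^sup>2 \<le> real kk * (2 * (norm (X z - z))\<^sup>2 + 2 * (norm (Y z - z))\<^sup>2)"
        by (intro mult_left_mono) auto
      then show ?thesis by (simp add: \<kappa>_def algebra_simps)
    qed
    ultimately show "- c / 2 + real kk * (norm (X z - Y z))\<^sup>2 \<le> g (X z) + h (Y z)"
      using Sp0 unfolding Sz by linarith
  qed
  \<comment> \<open>Moving \<open>x\<close> and \<open>z\<close> by the same \<open>v\<close> keeps
    \<open>x - z\<close> fixed, so the expansion of \<open>V'\<close> at \<open>z\<close> bounds
    \<open>G\<close> near \<open>x\<close> without loss. Undoing the quadratic term of the
    convolution accounts for \<open>(2 * \<kappa>) *\<^sub>R z\<close> in the gradient and
    \<open>\<kappa> *\<^sub>R v\<close> in the quadratic part.\<close>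
  have jet: "upper_jet G x (q - (2 * \<kappa>) *\<^sub>R z) (\<lambda>v. B v - \<kappa> *\<^sub>R v)"
    if x: "norm x < \<rho>" and V: "V z = G x - \<kappa> * (norm x)\<^sup>2 + 2 * \<kappa> * (x \<bullet> z)"
      "\<And>x z. x \<in> cball 0 \<rho> \<Longrightarrow> G x - \<kappa> * (norm x)\<^sup>2 + 2 * \<kappa> * (x \<bullet> z) \<le> V z"
      and V': "\<And>z. V z \<le> V' z" "V' z = V z" and B: "exp2 V' z q B" for G V V' x q B
    unfolding upper_jet_def
  proof (intro conjI allI impI)
    show "linear (\<lambda>v. B v - \<kappa> *\<^sub>R v)"
      using B unfolding exp2_def by (auto intro!: linear_compose_sub linear_scaleR)
    fix \<eta> :: real assume \<eta>: "\<eta> > 0"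
    then obtain \<delta> where \<delta>: "\<delta> > 0" "\<And>v. norm v < \<delta> \<Longrightarrow> \<bar>V' (z + v) - V' z - q \<bullet> v - v \<bullet> B v\<bar> \<le> \<eta> * (norm v)\<^sup>2"
      using B unfolding exp2_def by metis
    show "\<exists>\<delta>>0. \<forall>v. norm v < \<delta> \<longrightarrow>
        G (x + v) \<le> G x + (q - (2 * \<kappa>) *\<^sub>R z) \<bullet> v + v \<bullet> (B v - \<kappa> *\<^sub>R v) + \<eta> * (norm v)\<^sup>2"
    proof (intro exI[of _ "min \<delta> (\<rho> - norm x)"] conjI allI impI)
      fix v :: 'a assume v: "norm v < min \<delta> (\<rho> - norm x)"
      then have "x + v \<in> cball 0 \<rho>" using norm_triangle_ineq[of x v] by simp
      then have "G (x + v) - \<kappa> * (norm (x + v))\<^sup>2 + 2 * \<kappa> * ((x + v) \<bullet> (z + v)) \<le> V' (z + v)"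
        using V(2) V'(1) order_trans by blast
      moreover have "V' (z + v) \<le> V' z + q \<bullet> v + v \<bullet> B v + \<eta> * (norm v)\<^sup>2"
        using \<delta>(2)[of v] v by simp
      ultimately show "G (x + v) \<le> G x + (q - (2 * \<kappa>) *\<^sub>R z) \<bullet> v + v \<bullet> (B v - \<kappa> *\<^sub>R v) + \<eta> * (norm v)\<^sup>2"
        unfolding V'(2) V(1) power2_norm_add
        by (simp add: inner_add_left inner_add_right inner_diff_left inner_diff_right inner_commute
            algebra_simps flip: power2_norm_eq_inner)
    qed (use \<delta> x in auto)
  qed
  show thesis
  proof (rule that)
    show "norm (X z) < \<rho>" "norm (Y z) < \<rho>" using in_ball by auto
    show "upper_jet g (X z) (p1 - (2 * \<kappa>) *\<^sub>R z) (\<lambda>v. B1 v - \<kappa> *\<^sub>R v)"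
      using jet[OF conjunct1[OF in_ball] U(3,4) uU eq(2) B1] .
    show "upper_jet h (Y z) (p2 - (2 * \<kappa>) *\<^sub>R z) (\<lambda>v. B2 v - \<kappa> *\<^sub>R v)"
      using jet[OF conjunct2[OF in_ball] W(3,4) wW eq(3) B2] .
    show "v \<bullet> (B1 v - \<kappa> *\<^sub>R v) + v \<bullet> (B2 v - \<kappa> *\<^sub>R v) \<le> 0" for v
      using quad_le[of v] by (simp add: inner_diff_right power2_norm_eq_inner)
  qed
qed

section \<open>Complex subspaces and Hermitian forms\<close>

lemma linear_imp_continuous_on:
  fixes A :: "'a::euclidean_space \<Rightarrow> 'b::real_normed_vector"
  shows "linear A \<Longrightarrow> continuous_on S A"
  by (simp add: linear_continuous_on linear_conv_bounded_linear)

lemma inner_i_mult: "(\<i> *s v) \<bullet> (\<i> *s w) = v \<bullet> (w :: complex^'n)"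
  by (auto simp: inner_vec_def inner_complex_def intro!: sum.cong)

lemma norm_i_mult [simp]: "norm (\<i> *s v) = norm (v :: complex^'n)"
  by (simp add: norm_eq_sqrt_inner inner_i_mult)

lemma i_mult_i_mult [simp]: "\<i> *s (\<i> *s v) = - (v :: complex^'n)"
  by (simp add: vec_eq_iff)

lemma i_mult_eq_0_iff [simp]: "\<i> *s v = 0 \<longleftrightarrow> v = (0 :: complex^'n)"
  by (simp add: vec_eq_iff)

lemma linear_i_mult: "linear (\<lambda>v :: complex^'n. \<i> *s v)"
  by (rule linearI) (simp_all add: vec_eq_iff algebra_simps scaleR_conv_of_real)

lemma scaleR_eq_vector_scalar_mult: "r *\<^sub>R v = complex_of_real r *s (v :: complex^'n)"
  by (simp add: vec_eq_iff complex_eq_iff)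

lemma vector_scalar_mult_Re_Im: "c *s v = Re c *\<^sub>R v + Im c *\<^sub>R (\<i> *s (v :: complex^'n))"
  by (simp add: vec_eq_iff complex_eq_iff)

lemma complex_subspace_imp_subspace: "vec.subspace V \<Longrightarrow> subspace (V :: (complex^'n) set)"
  by (auto simp: subspace_def vec.subspace_def scaleR_eq_vector_scalar_mult)

lemma complex_subspace_i_mult: "vec.subspace V \<Longrightarrow> v \<in> V \<Longrightarrow> \<i> *s v \<in> (V :: (complex^'n) set)"
  by (auto simp: vec.subspace_def)

lemma complex_subspace_of_dim:
  fixes V :: "(complex^'n) set"
  assumes V: "vec.subspace V" and k: "k \<le> vec.dim V"
  obtains S where "vec.subspace S" "S \<subseteq> V" "vec.dim S = k"
proof -
  obtain B where B: "finite B" "B \<subseteq> V" "vec.independent B" "vec.span B = V" "card B = vec.dim V"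
    by (rule vec.basis_subspace_exists[OF V]) blast
  obtain C where C: "C \<subseteq> B" "card C = k"
    using k B(1,5) by (metis obtain_subset_with_card_n)
  show thesis
  proof (rule that)
    show "vec.subspace (vec.span C)" by (rule vec.subspace_span)
    show "vec.span C \<subseteq> V" using vec.span_mono[OF C(1)] B(4) by simp
    show "vec.dim (vec.span C) = k"
      using vec.dim_span_eq_card_independent[of C] vec.independent_mono[OF B(3) C(1)] C(2) by simp
  qed
qed

text \<open>
  Each induction step splits off a vector \<open>b\<close> with \<open>\<beta> b b < 0\<close> and passes to its orthogonal complement.
\<close>

lemma hermitian_nonneg_subspace:
  fixes \<beta> :: "complex^'n \<Rightarrow> complex^'n \<Rightarrow> real"
  assumes add: "\<And>u v w. \<beta> (u + v) w = \<beta> u w + \<beta> v w" and scale: "\<And>t v w. \<beta> (t *\<^sub>R v) w = t * \<beta> v w"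
    and sym: "\<And>v w. \<beta> v w = \<beta> w v" and herm: "\<And>v w. \<beta> (\<i> *s v) (\<i> *s w) = \<beta> v w"
    and V: "vec.subspace V" "q + r + 1 \<le> vec.dim V"
    and nd: "\<And>S. vec.subspace S \<Longrightarrow> S \<subseteq> V \<Longrightarrow> vec.dim S = q + 1 \<Longrightarrow> \<exists>v\<in>S. v \<noteq> 0 \<and> \<beta> v v \<ge> 0"
  obtains S where "vec.subspace S" "S \<subseteq> V" "vec.dim S = r + 1" "\<And>v. v \<in> S \<Longrightarrow> \<beta> v v \<ge> 0"
proof -
  have add': "\<beta> w (u + v) = \<beta> w u + \<beta> w v" and scale': "\<beta> w (t *\<^sub>R v) = t * \<beta> w v" for t u v w
    using add scale sym by metis+
  have zero: "\<beta> 0 w = 0" for w using scale[of 0 0 w] by simp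
  have neg: "\<beta> w (- v) = - \<beta> w v" for v w using scale'[of w "-1" v] by simp
  have neg': "\<beta> (- v) w = - \<beta> v w" for v w using scale[of "-1" v w] by simp
  have vi: "\<beta> v (\<i> *s v) = 0" for v
    using herm[of v "\<i> *s v"] sym[of "\<i> *s v" v] neg[of "\<i> *s v" v] by simp
  \<comment> \<open>Invariance under multiplication by \<open>\<i>\<close> makes
    \<open>\<beta>\<close> the real part of a Hermitian form, whose diagonal scales with
    \<open>|c|^2\<close>.\<close>
  have cc: "\<beta> (c *s v) (c *s v) = ((Re c)\<^sup>2 + (Im c)\<^sup>2) * \<beta> v v" for c v
    unfolding vector_scalar_mult_Re_Im[of c v] add add' scale scale' herm
    by (simp add: vi sym[of "\<i> *s v" v] power2_eq_square algebra_simps)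
  have "\<exists>S. vec.subspace S \<and> S \<subseteq> V \<and> vec.dim S = r + 1 \<and> (\<forall>v\<in>S. \<beta> v v \<ge> 0)"
    using V nd
  proof (induction q arbitrary: V)
    case 0
    obtain S where S: "vec.subspace S" "S \<subseteq> V" "vec.dim S = r + 1"
      using complex_subspace_of_dim[OF 0(1), of "r + 1"] 0(2) by auto
    have "\<beta> v v \<ge> 0" if v: "v \<in> S" for v
    proof (cases "v = 0")
      case False
      have "vec.independent {v}" using False by simp
      then have "vec.dim (vec.span {v}) = 0 + 1" using vec.dim_span_eq_card_independent by fastforce
      moreover have "vec.span {v} \<subseteq> V" using 0(1) v S(2) by (intro vec.span_minimal) auto
      ultimately obtain w where w: "w \<in> vec.span {v}" "w \<noteq> 0" "\<beta> w w \<ge> 0"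
        using 0(3)[OF vec.subspace_span] by blast
      then obtain c where "w = c *s v" by (auto simp: vec.span_singleton)
      then have "0 \<le> ((Re c)\<^sup>2 + (Im c)\<^sup>2) * \<beta> v v" "c \<noteq> 0" using w cc by auto
      then show ?thesis
        by (metis add_nonneg_eq_0_iff complex_eq_0 less_eq_real_def sum_power2_gt_zero_iff zero_le_mult_iff
            zero_le_power2 linorder_not_le)
    qed (simp add: zero)
    with S show ?case by blast
  next
    case (Suc q)
    show ?case
    proof (cases "\<exists>b\<in>V. \<beta> b b < 0")
      case False
      obtain S where "vec.subspace S" "S \<subseteq> V" "vec.dim S = r + 1"
        using complex_subspace_of_dim[OF Suc.prems(1), of "r + 1"] Suc.prems(2) by auto
      with False show ?thesis by (meson linorder_not_le subsetD)
    next
      case True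
      then obtain b where b: "b \<in> V" "\<beta> b b < 0" by blast
      \<comment> \<open>The complex orthogonal complement of \<open>b\<close>: since
        \<open>\<beta>\<close> is only the real part of the Hermitian form, orthogonality to
        \<open>\<i> *s b\<close> has to be asked as well.\<close>
      define V' where "V' = {v \<in> V. \<beta> v b = 0 \<and> \<beta> v (\<i> *s b) = 0}"
      have V'sub: "vec.subspace V'"
      proof (rule vec.subspaceI)
        show "0 \<in> V'" using vec.subspace_0[OF Suc.prems(1)] by (simp add: V'_def zero)
        show "x + y \<in> V'" if "x \<in> V'" "y \<in> V'" for x y
          using that vec.subspace_add[OF Suc.prems(1)] by (simp add: V'_def add)
        fix c x assume x: "x \<in> V'"
        have "\<beta> (\<i> *s x) b = - \<beta> x (\<i> *s b)" using herm[of "\<i> *s x" b] neg'[of x "\<i> *s b"] by simp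
        moreover have "\<beta> (\<i> *s x) (\<i> *s b) = \<beta> x b" by (rule herm)
        ultimately show "c *s x \<in> V'"
          using x vec.subspace_scale[OF Suc.prems(1), of x c]
          by (simp add: V'_def) (simp add: vector_scalar_mult_Re_Im[of c x] add scale)
      qed
      have bnot: "b \<notin> V'" using b by (simp add: V'_def)
      have "V \<subseteq> vec.span (insert b V')"
      proof
        fix v assume v: "v \<in> V"
        define c where "c = Complex (\<beta> v b / \<beta> b b) (\<beta> v (\<i> *s b) / \<beta> b b)"
        have 1: "\<beta> (v - c *s b) w = \<beta> v w - Re c * \<beta> b w - Im c * \<beta> (\<i> *s b) w" for w
        proof -
          have "\<beta> (v - c *s b) w = \<beta> v w - \<beta> (c *s b) w"
            using add[of v "- (c *s b)" w] neg'[of "c *s b" w] by simp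
          then show ?thesis by (simp add: vector_scalar_mult_Re_Im[of c b] add scale)
        qed
        have "\<beta> (v - c *s b) b = 0"
          unfolding 1 using b vi[of b] sym[of "\<i> *s b" b] by (simp add: c_def)
        moreover have "\<beta> (v - c *s b) (\<i> *s b) = 0"
          unfolding 1 herm using b vi[of b] by (simp add: c_def)
        moreover have "v - c *s b \<in> V"
          using v b vec.subspace_diff[OF Suc.prems(1)] vec.subspace_scale[OF Suc.prems(1)] by blast
        ultimately have "v - c *s b \<in> V'" by (simp add: V'_def)
        then show "v \<in> vec.span (insert b V')"
          using vec.span_insert[of b V'] vec.span_base by blast
      qed
      then have "vec.dim V \<le> vec.dim (insert b V')" by (rule vec.dim_mono)
      also have "\<dots> \<le> vec.dim V' + 1" by (simp add: vec.dim_insert)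
      finally have dimV': "q + r + 1 \<le> vec.dim V'" using Suc.prems(2) by simp
      \<comment> \<open>Adding \<open>b\<close> to \<open>S\<close> reaches the dimension
        \<open>Suc q + 1\<close> of the hypothesis on \<open>V\<close>, and the
        \<open>b\<close>-component of the vector found there is removed again. As
        \<open>\<beta> b b < 0\<close>, the removal cannot decrease the form.\<close>
      have key: "\<exists>v\<in>S. v \<noteq> 0 \<and> \<beta> v v \<ge> 0" if S: "vec.subspace S" "S \<subseteq> V'" "vec.dim S = q + 1" for S
      proof -
        have spS: "vec.span S = S" using S(1) vec.span_eq_iff by blast
        have "b \<notin> vec.span S" using S(2) bnot unfolding spS by blast
        then have "vec.dim (vec.span (insert b S)) = Suc q + 1"
          using S(3) by (simp add: vec.dim_insert)
        moreover have "vec.span (insert b S) \<subseteq> V"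
          using S(2) b(1) Suc.prems(1) by (intro vec.span_minimal) (auto simp: V'_def)
        ultimately obtain v where v: "v \<in> vec.span (insert b S)" "v \<noteq> 0" "\<beta> v v \<ge> 0"
          using Suc.prems(3)[OF vec.subspace_span] by blast
        then obtain c where c: "v - c *s b \<in> S" by (auto simp: vec.span_insert spS)
        define s where "s = v - c *s b"
        have vs: "v = s + c *s b" by (simp add: s_def)
        have sS: "s \<in> S" using c by (simp add: s_def)
        then have "\<beta> s b = 0" "\<beta> s (\<i> *s b) = 0" using S(2) by (auto simp: V'_def)
        then have "\<beta> s (c *s b) = 0" by (simp add: vector_scalar_mult_Re_Im[of c b] add' scale')
        then have eq: "\<beta> v v = \<beta> s s + ((Re c)\<^sup>2 + (Im c)\<^sup>2) * \<beta> b b"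
          unfolding vs by (simp add: add add' cc sym[of "c *s b" s])
        have le: "((Re c)\<^sup>2 + (Im c)\<^sup>2) * \<beta> b b \<le> 0"
          using b(2) by (simp add: mult_le_0_iff)
        have "s \<noteq> 0"
        proof
          assume "s = 0"
          then have "0 \<le> ((Re c)\<^sup>2 + (Im c)\<^sup>2) * \<beta> b b" using eq v(3) by (simp add: zero)
          then have "(Re c)\<^sup>2 + (Im c)\<^sup>2 = 0"
            using b(2) le by (metis linorder_not_less mult_eq_0_iff order_antisym order_less_irrefl)
          then have "c = 0" by (simp add: complex_eq_iff sum_power2_eq_zero_iff)
          then show False using vs \<open>s = 0\<close> v(2) by simp
        qed
        then show ?thesis using sS eq le v(3) by (intro bexI[of _ s]) auto
      qed
      have "\<exists>S. vec.subspace S \<and> S \<subseteq> V' \<and> vec.dim S = r + 1 \<and> (\<forall>v\<in>S. \<beta> v v \<ge> 0)"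
        by (rule Suc.IH[OF V'sub dimV']) (rule key)
      moreover have "V' \<subseteq> V" by (auto simp: V'_def)
      ultimately show ?thesis by (meson order_trans)
    qed
  qed
  then show thesis using that by blast
qed

section \<open>Quadratic test functions\<close>

text \<open>
  The Levi form of the quadratic function \<open>v \<mapsto> v \<bullet> A v\<close>.
\<close>

definition levi :: "(complex^'n \<Rightarrow> complex^'n) \<Rightarrow> complex^'n \<Rightarrow> real" where
  "levi A v = v \<bullet> A v + (\<i> *s v) \<bullet> A (\<i> *s v)"

definition levi_neg :: "(complex^'n \<Rightarrow> complex^'n) \<Rightarrow> (complex^'n) set \<Rightarrow> bool" where
  "levi_neg A V \<longleftrightarrow> linear A \<and> (\<forall>v\<in>V. v \<noteq> 0 \<longrightarrow> levi A v < 0)"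

lemma levi_negD:
  assumes "levi_neg A V"
  shows "linear A" "\<And>v. v \<in> V \<Longrightarrow> v \<noteq> 0 \<Longrightarrow> levi A v < 0"
  using assms by (auto simp: levi_neg_def)

lemma levi_neg_subset: "levi_neg A V \<Longrightarrow> S \<subseteq> V \<Longrightarrow> levi_neg A S"
  by (auto simp: levi_neg_def)

lemma continuous_on_levi: "linear A \<Longrightarrow> continuous_on S (levi A)"
proof -
  assume A: "linear A"
  have cA: "continuous_on T A" and cJ: "continuous_on T (\<lambda>v :: complex^'a. \<i> *s v)" for T
    by (rule linear_imp_continuous_on[OF A], rule linear_imp_continuous_on[OF linear_i_mult])
  show ?thesis
    unfolding levi_def[abs_def]
    by (intro continuous_intros cA cJ continuous_on_compose2[OF cA[of UNIV] cJ]) auto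
qed

lemma levi_scaleR: "linear A \<Longrightarrow> levi A (t *\<^sub>R v) = t\<^sup>2 * levi A v"
  by (simp add: levi_def linear_scale linear_scale[OF linear_i_mult] power2_eq_square algebra_simps)

lemma levi_add_scaleR: "levi (\<lambda>v. A v + c *\<^sub>R v) v = levi A v + 2 * c * (norm v)\<^sup>2"
  by (simp add: levi_def inner_add_right inner_i_mult power2_norm_eq_inner)

lemma levi_neg_uniform:
  fixes V :: "(complex^'n) set"
  assumes V: "vec.subspace V" and A: "levi_neg A V"
  obtains c where "c > 0" "\<And>v. v \<in> V \<Longrightarrow> levi A v \<le> - c * (norm v)\<^sup>2"
proof -
  note linA = levi_negD(1)[OF A]
  define S where "S = sphere 0 1 \<inter> V"
  have S: "compact S"
    unfolding S_def by (intro compact_Int_closed compact_sphere closed_subspace complex_subspace_imp_subspace V)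
  have "\<exists>c>0. \<forall>v\<in>S. levi A v \<le> - c"
  proof (cases "S = {}")
    case False
    then obtain w where w: "w \<in> S" "\<And>v. v \<in> S \<Longrightarrow> levi A v \<le> levi A w"
      using continuous_attains_sup[OF S _ continuous_on_levi[OF linA]] by metis
    then have "levi A w < 0" using A by (auto simp: levi_neg_def S_def)
    then show ?thesis using w(2) by (intro exI[of _ "- levi A w"]) auto
  qed (auto intro: exI[of _ 1])
  then obtain c where c: "c > 0" "\<And>v. v \<in> S \<Longrightarrow> levi A v \<le> - c" by blast
  have "levi A v \<le> - c * (norm v)\<^sup>2" if v: "v \<in> V" for v
  proof (cases "v = 0")
    case True
    then show ?thesis by (simp add: levi_def)
  next
    case False
    define u where "u = (1 / norm v) *\<^sub>R v"
    have "u \<in> S"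
      using False v subspace_scale[OF complex_subspace_imp_subspace[OF V] v] by (simp add: S_def u_def)
    then have "(norm v)\<^sup>2 * levi A u \<le> (norm v)\<^sup>2 * (- c)" by (intro mult_left_mono c(2)) auto
    moreover have "levi A v = (norm v)\<^sup>2 * levi A u"
      using False by (simp add: u_def levi_scaleR[OF linA] power_divide)
    ultimately show ?thesis by (simp add: mult.commute)
  qed
  with c(1) show thesis using that by blast
qed

text \<open>Subtracting the form at \<open>\<i> *s v\<close> removes the Levi form and leaves the
  real part of a holomorphic polynomial. Thus every quadratic function is a pluriharmonic one plus
  half its Levi form, which is how quadratic test functions are tied to
  \<open>q_psh\<close>.\<close>

lemma pluriharmonic_on_quadratic:
  fixes A :: "complex^'n \<Rightarrow> complex^'n"
  assumes A: "linear A"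
  shows "pluriharmonic_on W (\<lambda>x. a + p \<bullet> (x - z) + ((x - z) \<bullet> A (x - z) - (\<i> *s (x - z)) \<bullet> A (\<i> *s (x - z))) / 2)"
proof -
  define J :: "complex^'n \<Rightarrow> complex^'n" where "J v = \<i> *s v" for v
  have J: "linear J" unfolding J_def by (rule linear_i_mult)
  \<comment> \<open>The symmetrised matrix of the quadratic part: \<open>p + G (x - z)\<close> is
    the gradient and \<open>G\<close> the Hessian. The adjoints occur because \<open>A\<close> may
    be non-symmetric.\<close>
  define G where "G w = (1/2) *\<^sub>R (A w + adjoint A w - adjoint J (A (J w)) - adjoint J (adjoint A (J w)))" for w
  have linG: "linear G"
    unfolding G_def
    by (intro linear_compose_scale_right linear_compose_sub linear_compose_add A adjoint_linear
        linear_compose[unfolded o_def, OF linear_compose[unfolded o_def, OF J A] adjoint_linear]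
        linear_compose[unfolded o_def, OF linear_compose[unfolded o_def, OF J adjoint_linear[OF A]] adjoint_linear] J)
  then have blG: "bounded_linear G" by (simp add: linear_conv_bounded_linear)
  have uG: "u \<bullet> G w = (u \<bullet> A w + w \<bullet> A u - J u \<bullet> A (J w) - J w \<bullet> A (J u)) / 2" for u w
    unfolding G_def using adjoint_works[OF A] adjoint_works[OF J]
    by (simp add: inner_add_right inner_diff_right) (simp add: inner_commute)
  have vG: "v \<bullet> G v + J v \<bullet> G (J v) = 0" for v
    unfolding uG by (simp add: J_def linear_neg[OF A] field_simps)
  define h1 where "h1 x = blinfun_inner_right (p + G (x - z))" for x
  define h2 where "h2 = Blinfun (\<lambda>u. blinfun_inner_right (G u) :: (complex^'n) \<Rightarrow>\<^sub>L real)"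
  have bl2: "bounded_linear (\<lambda>u. blinfun_inner_right (G u) :: (complex^'n) \<Rightarrow>\<^sub>L real)"
    by (rule bounded_linear_compose[OF bounded_linear_blinfun_inner_right blG])
  have h2: "blinfun_apply h2 = (\<lambda>u. blinfun_inner_right (G u))"
    unfolding h2_def by (rule bounded_linear_Blinfun_apply[OF bl2])
  show ?thesis
    unfolding pluriharmonic_on_def
  proof (intro exI[of _ h1] exI[of _ "\<lambda>_. h2"] conjI ballI allI)
    fix x assume "x \<in> W"
    have dA: "((\<lambda>x. A (x - z)) has_derivative A) (at x)"
      by (rule bounded_linear.has_derivative) (use A in \<open>auto intro!: derivative_eq_intros simp: linear_conv_bounded_linear\<close>)
    have dJ: "((\<lambda>x. J (x - z)) has_derivative J) (at x)"
      by (rule bounded_linear.has_derivative) (use J in \<open>auto intro!: derivative_eq_intros simp: linear_conv_bounded_linear\<close>)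
    have dAJ: "((\<lambda>x. A (J (x - z))) has_derivative (\<lambda>u. A (J u))) (at x)"
      by (rule bounded_linear.has_derivative[OF _ dJ]) (use A in \<open>simp add: linear_conv_bounded_linear\<close>)
    have "((\<lambda>x. a + p \<bullet> (x - z) + ((x - z) \<bullet> A (x - z) - J (x - z) \<bullet> A (J (x - z))) / 2) has_derivative
        (\<lambda>u. 0 + p \<bullet> u + ((x - z) \<bullet> A u + u \<bullet> A (x - z) - (J (x - z) \<bullet> A (J u) + J u \<bullet> A (J (x - z)))) / 2)) (at x)"
      by (rule derivative_eq_intros dA dJ dAJ refl | simp)+
    also have "(\<lambda>u. 0 + p \<bullet> u + ((x - z) \<bullet> A u + u \<bullet> A (x - z) - (J (x - z) \<bullet> A (J u) + J u \<bullet> A (J (x - z)))) / 2)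
       = blinfun_apply (h1 x)"
      unfolding h1_def by (rule ext) (simp add: inner_add_left inner_commute[of "G _"] uG algebra_simps add_divide_distrib diff_divide_distrib)
    finally show "((\<lambda>x. a + p \<bullet> (x - z) + ((x - z) \<bullet> A (x - z) - (\<i> *s (x - z)) \<bullet> A (\<i> *s (x - z))) / 2)
        has_derivative blinfun_apply (h1 x)) (at x)"
      by (simp add: J_def)
    have dG: "((\<lambda>x. p + G (x - z)) has_derivative G) (at x)"
      by (auto intro!: derivative_eq_intros bounded_linear.has_derivative[OF blG])
    show "(h1 has_derivative blinfun_apply h2) (at x)"
      unfolding h1_def h2
      by (rule bounded_linear.has_derivative[OF bounded_linear_blinfun_inner_right dG])
    show "blinfun_apply (blinfun_apply h2 v) v + blinfun_apply (blinfun_apply h2 (\<i> *s v)) (\<i> *s v) = 0" for v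
      using vG[of v] by (simp add: h2 J_def inner_commute)
  qed (rule continuous_on_const)
qed

text \<open>
  Together, \<open>q_pshD\<close> and \<open>q_pshI\<close> characterise \<open>q\<close>-plurisubharmonic functions by
  quadratic test functions whose Levi form is negative on a complex subspace of dimension \<open>q + 1\<close>. This
  criterion is infinitesimal, hence the notion is local.
\<close>

lemma q_pshD:
  fixes U :: "(complex^'n) set"
  assumes psh: "q_psh q U \<psi>" and z: "z \<in> U" "\<psi> z = ereal a"
    and V: "vec.subspace V" "vec.dim V = q + 1" and A: "levi_neg A V"
    and \<delta>: "\<delta> > 0" and touch: "\<And>v. v \<in> V \<Longrightarrow> norm v < \<delta> \<Longrightarrow> \<psi> (z + v) \<le> ereal (a + p \<bullet> v + v \<bullet> A v)"
  shows False
proof -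
  obtain c where c: "c > 0" "\<And>v. v \<in> V \<Longrightarrow> levi A v \<le> - c * (norm v)\<^sup>2"
    using levi_neg_uniform[OF V(1) A] by blast
  obtain \<epsilon> where \<epsilon>: "\<epsilon> > 0" "cball z \<epsilon> \<subseteq> U"
  proof -
    have "open U" using psh by (simp add: q_psh_def)
    then show ?thesis using that z(1) open_contains_cball by metis
  qed
  define \<rho> where "\<rho> = min \<epsilon> (\<delta> / 2)"
  have \<rho>: "\<rho> > 0" "\<rho> < \<delta>" "cball z \<rho> \<subseteq> U" using \<epsilon> \<delta> by (auto simp: \<rho>_def)
  \<comment> \<open>The pluriharmonic part of the test function, lowered by
    \<open>c / 2 * \<rho>\<^sup>2\<close>. On the sphere the omitted half of the Levi form is at
    most \<open>- c / 2 * \<rho>\<^sup>2\<close>, so \<open>k\<close> still dominates there, but at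
    the centre it lies below \<open>a\<close>.\<close>
  define k where "k x = (a - c / 2 * \<rho>\<^sup>2) + p \<bullet> (x - z) + ((x - z) \<bullet> A (x - z) - (\<i> *s (x - z)) \<bullet> A (\<i> *s (x - z))) / 2" for x
  have kph: "pluriharmonic_on UNIV k"
    unfolding k_def[abs_def] by (rule pluriharmonic_on_quadratic[OF levi_negD(1)[OF A]])
  define P where "P = (\<lambda>v. z + v) ` V"
  have P: "complex_affine_subspace (q + 1) P"
    unfolding complex_affine_subspace_def P_def using V by blast
  have bd: "\<psi> w \<le> ereal (k w)" if "w \<in> sphere z \<rho> \<inter> P" for w
  proof -
    obtain v where v: "w = z + v" "v \<in> V" "norm v = \<rho>"
      using \<open>w \<in> sphere z \<rho> \<inter> P\<close> by (auto simp: P_def dist_norm)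
    have "\<psi> w \<le> ereal (a + p \<bullet> v + v \<bullet> A v)" using touch v \<rho> by simp
    also have "a + p \<bullet> v + v \<bullet> A v \<le> k w"
      using c(2)[OF v(2)] by (simp add: k_def v(1,3) levi_def field_simps)
    finally show ?thesis by simp
  qed
  have "z = z + 0" by simp
  then have zP: "z \<in> P" unfolding P_def using vec.subspace_0[OF V(1)] by blast
  have "\<forall>w\<in>cball z \<rho> \<inter> P. \<psi> w \<le> ereal (k w)"
    using psh P \<rho>(1,3) kph bd unfolding q_psh_def by (metis open_UNIV subset_UNIV)
  then have "ereal a \<le> ereal (k z)" using zP \<rho>(1) z(2) by force
  moreover have "k z < a" using c(1) \<rho>(1) by (simp add: k_def linear_0[OF levi_negD(1)[OF A]])
  ultimately show False by simp
qed

lemma second_order_taylor: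
  fixes h :: "'a::real_normed_vector \<Rightarrow> real"
  assumes W: "open W" "z \<in> W" and h1: "\<And>x. x \<in> W \<Longrightarrow> (h has_derivative blinfun_apply (h1 x)) (at x)"
    and h2: "(h1 has_derivative blinfun_apply h2) (at z)" and \<eta>: "\<eta> > 0"
  shows "\<exists>\<delta>>0. \<forall>v. norm v < \<delta> \<longrightarrow>
     \<bar>h (z + v) - h z - blinfun_apply (h1 z) v - blinfun_apply (blinfun_apply h2 v) v / 2\<bar> \<le> \<eta> * (norm v)\<^sup>2"
proof -
  obtain \<delta>1 where \<delta>1: "\<delta>1 > 0" "\<And>y. norm (y - z) < \<delta>1 \<Longrightarrow> norm (h1 y - h1 z - blinfun_apply h2 (y - z)) \<le> \<eta> * norm (y - z)"
    using h2 \<eta> unfolding has_derivative_at_alt by metis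
  obtain \<delta>2 where \<delta>2: "\<delta>2 > 0" "ball z \<delta>2 \<subseteq> W" using W open_contains_ball by blast
  show ?thesis
  proof (intro exI[of _ "min \<delta>1 \<delta>2"] conjI allI impI)
    fix v :: 'a assume v: "norm v < min \<delta>1 \<delta>2"
    define \<phi> where "\<phi> t = h (z + t *\<^sub>R v) - t * blinfun_apply (h1 z) v - t\<^sup>2 / 2 * blinfun_apply (blinfun_apply h2 v) v" for t
    have small: "norm (t *\<^sub>R v) \<le> norm v" if "0 \<le> t" "t \<le> 1" for t
      using that by (simp add: mult_left_le_one_le)
    have d: "(\<phi> has_real_derivative blinfun_apply (h1 (z + t *\<^sub>R v) - h1 z - blinfun_apply h2 (t *\<^sub>R v)) v) (at t)"
      if t: "0 \<le> t" "t \<le> 1" for t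
    proof -
      have "z + t *\<^sub>R v \<in> W" using small[OF t] v \<delta>2 by (auto simp: dist_norm intro!: subsetD[OF \<delta>2(2)])
      then have "((\<lambda>t. h (z + t *\<^sub>R v)) has_derivative (\<lambda>s. blinfun_apply (h1 (z + t *\<^sub>R v)) (s *\<^sub>R v))) (at t)"
        by (intro has_derivative_compose[OF _ h1]) (auto intro!: derivative_eq_intros)
      then have "((\<lambda>t. h (z + t *\<^sub>R v)) has_real_derivative blinfun_apply (h1 (z + t *\<^sub>R v)) v) (at t)"
        by (simp add: has_field_derivative_def blinfun.scaleR_right mult.commute[of _ "blinfun_apply _ _"])
      then show ?thesis
        unfolding \<phi>_def
        by (auto intro!: derivative_eq_intros simp: blinfun.diff_left blinfun.add_left blinfun.scaleR_left blinfun.scaleR_right algebra_simps)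
    qed
    have "\<exists>\<xi>. 0 < \<xi> \<and> \<xi> < 1 \<and> \<phi> 1 - \<phi> 0 = (1 - 0) * blinfun_apply (h1 (z + \<xi> *\<^sub>R v) - h1 z - blinfun_apply h2 (\<xi> *\<^sub>R v)) v"
      by (rule MVT2) (use d in auto)
    then obtain \<xi> where \<xi>: "0 < \<xi>" "\<xi> < 1" "\<phi> 1 - \<phi> 0 = blinfun_apply (h1 (z + \<xi> *\<^sub>R v) - h1 z - blinfun_apply h2 (\<xi> *\<^sub>R v)) v"
      by auto
    have "\<bar>\<phi> 1 - \<phi> 0\<bar> \<le> norm (h1 (z + \<xi> *\<^sub>R v) - h1 z - blinfun_apply h2 (\<xi> *\<^sub>R v)) * norm v"
      unfolding \<xi>(3) using norm_blinfun[of "h1 (z + \<xi> *\<^sub>R v) - h1 z - blinfun_apply h2 (\<xi> *\<^sub>R v)" v] by simp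
    also have "\<dots> \<le> (\<eta> * norm (\<xi> *\<^sub>R v)) * norm v"
      using \<delta>1(2)[of "z + \<xi> *\<^sub>R v"] small[of \<xi>] \<xi> v by (intro mult_right_mono) auto
    also have "\<dots> \<le> (\<eta> * norm v) * norm v"
      using small[of \<xi>] \<xi> \<eta> by (intro mult_right_mono mult_left_mono) auto
    finally show "\<bar>h (z + v) - h z - blinfun_apply (h1 z) v - blinfun_apply (blinfun_apply h2 v) v / 2\<bar> \<le> \<eta> * (norm v)\<^sup>2"
      by (simp add: \<phi>_def power2_eq_square mult_ac)
  qed (use \<delta>1 \<delta>2 in auto)
qed

lemma usc_on_add_continuous_ereal:
  assumes usc: "usc_on A \<psi>" and g: "continuous_on A g"
  shows "usc_on A (\<lambda>z. \<psi> z + ereal (g z))"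
  unfolding usc_on_iff_nhds
proof (intro ballI conjI allI impI)
  fix z assume z: "z \<in> A"
  then have "\<psi> z < \<infinity>" using usc by (simp add: usc_on_def)
  then show "\<psi> z + ereal (g z) < \<infinity>" by auto
  fix c assume c: "\<psi> z + ereal (g z) < c"
  then have "\<psi> z < c - ereal (g z)" by (simp add: ereal_less_minus)
  then obtain d where d: "\<psi> z < ereal d" "ereal d < c - ereal (g z)"
    using ereal_dense2 by blast
  have 1: "\<forall>\<^sub>F w in inf (nhds z) (principal A). \<psi> w < ereal d"
    by (rule usc_onD_nhds[OF usc z d(1)])
  have "(g \<longlongrightarrow> g z) (inf (nhds z) (principal A))"
    using g z tendsto_at_within_iff_nhds[OF z, of g] by (simp add: continuous_on_def)
  then have gl: "((\<lambda>w. ereal (d + g w)) \<longlongrightarrow> ereal (d + g z)) (inf (nhds z) (principal A))"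
    by (intro tendsto_intros)
  have "ereal (d + g z) < c" using d(2) by (cases c) auto
  from order_tendstoD(2)[OF gl this] 1
  show "\<forall>\<^sub>F w in inf (nhds z) (principal A). \<psi> w + ereal (g w) < c"
  proof eventually_elim
    case (elim w)
    have "\<psi> w + ereal (g w) \<le> ereal d + ereal (g w)" using elim(2) by (intro add_right_mono) auto
    then show ?case using elim(1) by simp
  qed
qed

lemma linear_eq_inner:
  fixes f :: "'a::euclidean_space \<Rightarrow> real"
  assumes "linear f"
  shows "f v = (\<Sum>b\<in>Basis. f b *\<^sub>R b) \<bullet> v"
proof -
  have "f v = f (\<Sum>b\<in>Basis. (v \<bullet> b) *\<^sub>R b)" by (simp add: euclidean_representation)
  also have "\<dots> = (\<Sum>b\<in>Basis. (v \<bullet> b) * f b)" by (simp add: linear_sum[OF assms] linear_scale[OF assms])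
  finally show ?thesis unfolding inner_sum_left inner_scaleR_left by (simp add: inner_commute[of v] mult.commute)
qed

lemma q_pshI:
  fixes U :: "(complex^'n) set"
  assumes U: "open U" and q: "q < CARD('n)" and usc: "usc_on U \<psi>"
    and visc: "\<And>z a p A V \<delta>. \<lbrakk>z \<in> U; \<psi> z = ereal a; vec.subspace V; vec.dim V = q + 1; levi_neg A V; \<delta> > 0;
       \<And>v. v \<in> V \<Longrightarrow> norm v < \<delta> \<Longrightarrow> \<psi> (z + v) \<le> ereal (a + p \<bullet> v + v \<bullet> A v)\<rbrakk> \<Longrightarrow> False"
  shows "q_psh q U \<psi>"
  unfolding q_psh_def
proof (intro conjI allI impI U q usc)
  fix P :: "(complex^'n) set" and c \<rho> W h
  assume H: "complex_affine_subspace (q + 1) P \<and> 0 < \<rho> \<and> cball c \<rho> \<subseteq> U \<and> open W \<and> cball c \<rho> \<subseteq> W \<and>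
       pluriharmonic_on W h \<and> (\<forall>z\<in>sphere c \<rho> \<inter> P. \<psi> z \<le> ereal (h z))"
  then have \<rho>: "\<rho> > 0" and cU: "cball c \<rho> \<subseteq> U" and W: "open W" "cball c \<rho> \<subseteq> W"
    and bd: "\<And>z. z \<in> sphere c \<rho> \<Longrightarrow> z \<in> P \<Longrightarrow> \<psi> z \<le> ereal (h z)" by auto
  obtain a0 V where V: "vec.subspace V" "vec.dim V = q + 1" and P: "P = (\<lambda>v. a0 + v) ` V"
    using H by (auto simp: complex_affine_subspace_def)
  obtain h1 :: "complex^'n \<Rightarrow> (complex^'n) \<Rightarrow>\<^sub>L real" and h2 :: "complex^'n \<Rightarrow> (complex^'n) \<Rightarrow>\<^sub>L (complex^'n) \<Rightarrow>\<^sub>L real"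
    where h1: "\<And>x. x \<in> W \<Longrightarrow> (h has_derivative blinfun_apply (h1 x)) (at x)"
      and h2: "\<And>x. x \<in> W \<Longrightarrow> (h1 has_derivative blinfun_apply (h2 x)) (at x)"
      and lap: "\<And>x v. x \<in> W \<Longrightarrow> blinfun_apply (blinfun_apply (h2 x) v) v
                   + blinfun_apply (blinfun_apply (h2 x) (\<i> *s v)) (\<i> *s v) = 0"
    using H unfolding pluriharmonic_on_def by metis
  show "\<forall>z\<in>cball c \<rho> \<inter> P. \<psi> z \<le> ereal (h z)"
  proof (rule ccontr)
    assume "\<not> ?thesis"
    then obtain z0 where z0: "z0 \<in> cball c \<rho>" "z0 \<in> P" "ereal (h z0) < \<psi> z0" by (auto simp: not_le)
    have "\<psi> z0 < \<infinity>" using usc z0(1) cU by (auto simp: usc_on_def)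
    then obtain t where t: "\<psi> z0 = ereal t" using z0(3) by (cases "\<psi> z0") auto
    \<comment> \<open>The term \<open>\<epsilon> |z - c|^2\<close> uses half of the excess at
      \<open>z0\<close>. On the sphere the perturbed function is at most
      \<open>\<epsilon> * \<rho>\<^sup>2\<close>, which its value at \<open>z0\<close> exceeds, so
      its maximum lies inside.\<close>
    define \<epsilon> where "\<epsilon> = (t - h z0) / (2 * \<rho>\<^sup>2)"
    have ht: "h z0 < t" using z0(3) t by simp
    then have \<epsilon>: "\<epsilon> > 0" "\<epsilon> * \<rho>\<^sup>2 < t - h z0" using \<rho> by (auto simp: \<epsilon>_def)
    define K where "K = cball c \<rho> \<inter> P"
    have Pclosed: "closed P"
      unfolding P by (intro closed_translation closed_subspace complex_subspace_imp_subspace V(1))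
    have K: "compact K" "K \<noteq> {}" unfolding K_def using z0 Pclosed by (auto intro: compact_Int_closed)
    define g where "g z = \<epsilon> * (norm (z - c))\<^sup>2 - h z" for z
    define \<theta> where "\<theta> z = \<psi> z + ereal (g z)" for z
    have conth: "continuous_on K h"
    proof (rule continuous_at_imp_continuous_on, rule ballI)
      fix x assume "x \<in> K"
      then have "x \<in> W" using W by (auto simp: K_def)
      then show "isCont h x" using h1 has_derivative_continuous by blast
    qed
    have "usc_on K \<theta>"
      unfolding \<theta>_def g_def
      by (intro usc_on_add_continuous_ereal usc_on_subset[OF usc] continuous_intros conth) (use cU in \<open>auto simp: K_def\<close>)
    then obtain z1 where z1: "z1 \<in> K" "\<And>y. y \<in> K \<Longrightarrow> \<theta> y \<le> \<theta> z1"
      by (rule usc_on_compact_attains_sup[OF _ K]) blast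
    have "\<theta> z0 > ereal (\<epsilon> * \<rho>\<^sup>2)"
    proof -
      have "0 \<le> \<epsilon> * (norm (z0 - c))\<^sup>2" using \<epsilon>(1) by simp
      then show ?thesis using \<epsilon>(2) by (simp add: \<theta>_def t g_def)
    qed
    then have big: "\<theta> z1 > ereal (\<epsilon> * \<rho>\<^sup>2)" using z1(2)[of z0] z0 by (auto simp: K_def)
    have notsph: "z1 \<notin> sphere c \<rho>"
    proof
      assume s: "z1 \<in> sphere c \<rho>"
      then have "\<psi> z1 \<le> ereal (h z1)" using bd z1(1) by (auto simp: K_def)
      then have "\<theta> z1 \<le> ereal (h z1) + ereal (g z1)" unfolding \<theta>_def by (rule add_right_mono)
      also have "\<dots> = ereal (\<epsilon> * \<rho>\<^sup>2)" using s by (simp add: g_def dist_norm norm_minus_commute)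
      finally show False using big by simp
    qed
    have z1U: "z1 \<in> U" "z1 \<in> W" using z1(1) cU W by (auto simp: K_def)
    have "\<psi> z1 < \<infinity>" using usc z1U by (auto simp: usc_on_def)
    then obtain a where a: "\<psi> z1 = ereal a" using big by (cases "\<psi> z1") (auto simp: \<theta>_def)
    have ball: "norm (z1 - c) < \<rho>" using z1(1) notsph by (auto simp: K_def dist_norm norm_minus_commute)
    obtain \<delta>1 where \<delta>1: "\<delta>1 > 0" "\<And>v. norm v < \<delta>1 \<Longrightarrow>
       \<bar>h (z1 + v) - h z1 - blinfun_apply (h1 z1) v - blinfun_apply (blinfun_apply (h2 z1) v) v / 2\<bar> \<le> (\<epsilon> / 2) * (norm v)\<^sup>2"
      using second_order_taylor[OF W(1) z1U(2) h1 h2[OF z1U(2)], of "\<epsilon> / 2"] \<epsilon>(1) by auto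
    define \<delta> where "\<delta> = min \<delta>1 (\<rho> - norm (z1 - c))"
    define A0 where "A0 u = (\<Sum>b\<in>Basis. blinfun_apply (blinfun_apply (h2 z1) u) b *\<^sub>R b)" for u
    have A0: "v \<bullet> A0 u = blinfun_apply (blinfun_apply (h2 z1) u) v" for u v
      using linear_eq_inner[OF bounded_linear.linear[OF blinfun.bounded_linear_right[of "blinfun_apply (h2 z1) u"]], of v]
      by (simp add: A0_def inner_commute)
    have linA0: "linear A0"
      unfolding A0_def
      by (rule linearI) (simp_all add: blinfun.add_left blinfun.add_right blinfun.scaleR_left blinfun.scaleR_right
          scaleR_add_left sum.distrib scaleR_sum_right)
    \<comment> \<open>The Taylor error takes one half of the \<open>- \<epsilon>\<close> gained by
      the perturbation. The Hessian of \<open>h\<close> contributes nothing to the Levi form, so the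
      remaining \<open>- \<epsilon> / 2\<close> makes it negative on every subspace.\<close>
    define A where "A u = (1/2) *\<^sub>R A0 u + (- \<epsilon> / 2) *\<^sub>R u" for u
    have "levi (\<lambda>u. (1/2) *\<^sub>R A0 u) v = 0" for v
      using lap[OF z1U(2), of v] by (simp add: levi_def A0)
    then have leviA: "levi A v = - \<epsilon> * (norm v)\<^sup>2" for v
      unfolding A_def levi_add_scaleR by simp
    have "linear A"
      unfolding A_def by (intro linear_compose_add linear_compose_scale_right linA0 linear_scaleR)
    then have "levi_neg A V" unfolding levi_neg_def leviA using \<epsilon>(1) by auto
    define p where "p = (\<Sum>b\<in>Basis. blinfun_apply (h1 z1) b *\<^sub>R b) - (2 * \<epsilon>) *\<^sub>R (z1 - c)"
    have p: "p \<bullet> v = blinfun_apply (h1 z1) v - 2 * \<epsilon> * ((z1 - c) \<bullet> v)" for v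
      using linear_eq_inner[OF bounded_linear.linear[OF blinfun.bounded_linear_right[of "h1 z1"]], of v]
      by (simp add: p_def inner_diff_left)
    show False
    proof (rule visc[OF z1U(1) a V \<open>levi_neg A V\<close>])
      show "\<delta> > 0" using \<delta>1(1) ball by (simp add: \<delta>_def)
      fix v assume v: "v \<in> V" "norm v < \<delta>"
      have "z1 + v \<in> P"
      proof -
        obtain w where w: "w \<in> V" "z1 = a0 + w" using z1(1) by (auto simp: K_def P)
        then have "z1 + v = a0 + (w + v)" by (simp add: add.assoc)
        then show ?thesis unfolding P using vec.subspace_add[OF V(1) w(1) v(1)] by blast
      qed
      moreover have "norm (z1 + v - c) \<le> norm (z1 - c) + norm v"
        using norm_triangle_ineq[of "z1 - c" v] by (simp add: algebra_simps)
      ultimately have "z1 + v \<in> K" using v(2) by (simp add: K_def \<delta>_def dist_norm norm_minus_commute)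
      then have "\<psi> (z1 + v) + ereal (g (z1 + v)) \<le> ereal (a + g z1)"
        using z1(2) by (simp add: \<theta>_def a)
      then have "\<psi> (z1 + v) \<le> ereal (a + g z1 - g (z1 + v))" by (cases "\<psi> (z1 + v)") auto
      also have "a + g z1 - g (z1 + v) \<le> a + p \<bullet> v + v \<bullet> A v"
      proof -
        have "h (z1 + v) \<le> h z1 + blinfun_apply (h1 z1) v + v \<bullet> A0 v / 2 + (\<epsilon> / 2) * (norm v)\<^sup>2"
        proof -
          have "norm v < \<delta>1" using v(2) by (simp add: \<delta>_def)
          from \<delta>1(2)[OF this] show ?thesis unfolding A0 by linarith
        qed
        moreover have "\<epsilon> * (norm (z1 + v - c))\<^sup>2 = \<epsilon> * (norm (z1 - c))\<^sup>2 + 2 * \<epsilon> * ((z1 - c) \<bullet> v) + \<epsilon> * (norm v)\<^sup>2"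
        proof -
          have "z1 + v - c = (z1 - c) + v" by simp
          then have "(norm (z1 + v - c))\<^sup>2 = (norm (z1 - c))\<^sup>2 + 2 * ((z1 - c) \<bullet> v) + (norm v)\<^sup>2"
            by (simp only: power2_norm_add)
          then show ?thesis by (simp add: distrib_left)
        qed
        moreover have "v \<bullet> A v = v \<bullet> A0 v / 2 - \<epsilon> / 2 * (norm v)\<^sup>2"
          by (simp add: A_def inner_add_right inner_diff_right power2_norm_eq_inner)
        ultimately show ?thesis
          unfolding g_def p by linarith
      qed
      finally show "\<psi> (z1 + v) \<le> ereal (a + p \<bullet> v + v \<bullet> A v)" by simp
    qed
  qed
qed

section \<open>Calculus of real-valued \<open>q\<close>-plurisubharmonic functions\<close>

lemma q_pshD_real:
  fixes U :: "(complex^'n) set"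
  assumes "q_psh q U (\<lambda>z. ereal (\<psi> z))" "z \<in> U" "vec.subspace V" "vec.dim V = q + 1" "levi_neg A V" "\<delta> > 0"
    and "\<And>v. v \<in> V \<Longrightarrow> norm v < \<delta> \<Longrightarrow> \<psi> (z + v) \<le> \<psi> z + p \<bullet> v + v \<bullet> A v"
  shows False
  by (rule q_pshD[OF assms(1,2) refl assms(3-6), of p]) (use assms(7) in simp)

lemma q_pshI_real:
  fixes U :: "(complex^'n) set"
  assumes "open U" "q < CARD('n)" "usc_on U (\<lambda>z. ereal (\<psi> z))"
    and "\<And>z p A V \<delta>. \<lbrakk>z \<in> U; vec.subspace V; vec.dim V = q + 1; levi_neg A V; \<delta> > 0;
       \<And>v. v \<in> V \<Longrightarrow> norm v < \<delta> \<Longrightarrow> \<psi> (z + v) \<le> \<psi> z + p \<bullet> v + v \<bullet> A v\<rbrakk> \<Longrightarrow> False"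
  shows "q_psh q U (\<lambda>z. ereal (\<psi> z))"
proof (rule q_pshI[OF assms(1-3)])
  fix z a p A \<delta> and V :: "(complex^'n) set"
  assume "z \<in> U" "ereal (\<psi> z) = ereal a" "vec.subspace V" "vec.dim V = q + 1" "levi_neg A V" "0 < (\<delta> :: real)"
    "\<And>v. v \<in> V \<Longrightarrow> norm v < \<delta> \<Longrightarrow> ereal (\<psi> (z + v)) \<le> ereal (a + p \<bullet> v + v \<bullet> A v)"
  then show False using assms(4)[of z V A \<delta> p] by simp
qed

lemma q_pshD_open: "q_psh q U \<psi> \<Longrightarrow> open U"
  and q_pshD_less: "q_psh q (U :: (complex^'n) set) \<psi> \<Longrightarrow> q < CARD('n)"
  and q_pshD_usc: "q_psh q U \<psi> \<Longrightarrow> usc_on U \<psi>"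
  by (auto simp: q_psh_def)

lemma q_psh_subset:
  assumes "q_psh q U \<psi>" "open S" "S \<subseteq> U"
  shows "q_psh q S \<psi>"
  using assms usc_on_subset unfolding q_psh_def by (meson order_trans)

lemma q_psh_mono:
  fixes U :: "(complex^'n) set"
  assumes psh: "q_psh q U (\<lambda>z. ereal (\<psi> z))" and qr: "q \<le> r" "r < CARD('n)"
  shows "q_psh r U (\<lambda>z. ereal (\<psi> z))"
proof (rule q_pshI_real)
  fix z p A \<delta> and V :: "(complex^'n) set"
  assume z: "z \<in> U" and V: "vec.subspace V" "vec.dim V = r + 1" and A: "levi_neg A V" and \<delta>: "0 < (\<delta> :: real)"
    and le: "\<And>v. v \<in> V \<Longrightarrow> norm v < \<delta> \<Longrightarrow> \<psi> (z + v) \<le> \<psi> z + p \<bullet> v + v \<bullet> A v"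
  obtain S where S: "vec.subspace S" "S \<subseteq> V" "vec.dim S = q + 1"
    using complex_subspace_of_dim[OF V(1), of "q + 1"] V(2) qr(1) by auto
  show False
    by (rule q_pshD_real[OF psh z S(1,3) levi_neg_subset[OF A S(2)] \<delta>]) (use le S(2) in blast)
qed (use q_pshD_open[OF psh] q_pshD_usc[OF psh] qr in auto)

lemma q_psh_cmult:
  fixes U :: "(complex^'n) set"
  assumes psh: "q_psh q U (\<lambda>z. ereal (\<psi> z))" and k: "k > 0"
  shows "q_psh q U (\<lambda>z. ereal (k * \<psi> z))"
proof (rule q_pshI_real)
  show "usc_on U (\<lambda>z. ereal (k * \<psi> z))"
    unfolding usc_on_real_iff
  proof (intro ballI allI impI)
    fix z c assume "z \<in> U" "k * \<psi> z < c"
    moreover from this have "\<psi> z < c / k" using k by (simp add: pos_less_divide_eq mult.commute)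
    ultimately have "\<forall>\<^sub>F w in inf (nhds z) (principal U). \<psi> w < c / k"
      using q_pshD_usc[OF psh] unfolding usc_on_real_iff by blast
    then show "\<forall>\<^sub>F w in inf (nhds z) (principal U). k * \<psi> w < c"
      by eventually_elim (use k in \<open>simp add: field_simps\<close>)
  qed
  fix z p A \<delta> and V :: "(complex^'n) set"
  assume z: "z \<in> U" and V: "vec.subspace V" "vec.dim V = q + 1" and A: "levi_neg A V" and \<delta>: "0 < (\<delta> :: real)"
    and le: "\<And>v. v \<in> V \<Longrightarrow> norm v < \<delta> \<Longrightarrow> k * \<psi> (z + v) \<le> k * \<psi> z + p \<bullet> v + v \<bullet> A v"
  have "levi (\<lambda>v. (1 / k) *\<^sub>R A v) v = levi A v / k" for v
    by (simp add: levi_def add_divide_distrib)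
  then have A': "levi_neg (\<lambda>v. (1 / k) *\<^sub>R A v) V"
    using A k by (auto simp: levi_neg_def divide_neg_pos intro: linear_compose_scale_right)
  show False
  proof (rule q_pshD_real[OF psh z V A' \<delta>])
    fix v assume "v \<in> V" "norm v < \<delta>"
    from le[OF this] show "\<psi> (z + v) \<le> \<psi> z + ((1 / k) *\<^sub>R p) \<bullet> v + v \<bullet> ((1 / k) *\<^sub>R A v)"
      using k by (simp add: field_simps)
  qed
qed (use q_pshD_open[OF psh] q_pshD_less[OF psh] in auto)

text \<open>\<open>T\<close> has codimension at most \<open>q\<close>, so it meets every test
  subspace of dimension \<open>q + 1\<close> in a nonzero vector. There a quadratic function
  touching from above has at least the Levi form of \<open>A\<close>, which is nonnegative.\<close>

lemma q_psh_quadratic: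
  fixes A :: "complex^'n \<Rightarrow> complex^'n"
  assumes U: "open U" and q: "q < CARD('n)" and A: "linear A"
    and T: "vec.subspace T" "CARD('n) \<le> q + vec.dim T" and pos: "\<And>v. v \<in> T \<Longrightarrow> levi A v \<ge> 0"
  shows "q_psh q U (\<lambda>x. ereal (a + p \<bullet> (x - z) + (x - z) \<bullet> A (x - z)))"
proof (rule q_pshI_real[OF U q])
  have cA: "continuous_on W A" for W
    by (rule linear_imp_continuous_on[OF A])
  then show "usc_on U (\<lambda>x. ereal (a + p \<bullet> (x - z) + (x - z) \<bullet> A (x - z)))"
    by (intro continuous_on_imp_usc_on continuous_intros continuous_on_compose2[OF cA[of UNIV]]) auto
  fix x p' A' \<delta> and V :: "(complex^'n) set"
  assume V: "vec.subspace V" "vec.dim V = q + 1" and A': "levi_neg A' V" and \<delta>: "0 < (\<delta> :: real)"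
    and le: "\<And>v. v \<in> V \<Longrightarrow> norm v < \<delta> \<Longrightarrow> a + p \<bullet> (x + v - z) + (x + v - z) \<bullet> A (x + v - z)
        \<le> a + p \<bullet> (x - z) + (x - z) \<bullet> A (x - z) + p' \<bullet> v + v \<bullet> A' v"
  note A'lin = levi_negD(1)[OF A']
  have comp: "v \<bullet> A v \<le> v \<bullet> A' v" if v: "v \<in> V" for v
  proof (cases "v = 0")
    case False
    define t where "t = \<delta> / (2 * norm v)"
    have t: "t > 0" "norm (t *\<^sub>R v) < \<delta>" using False \<delta> by (auto simp: t_def)
    have tv: "t *\<^sub>R v \<in> V" "- (t *\<^sub>R v) \<in> V"
      using subspace_scale[OF complex_subspace_imp_subspace[OF V(1)] v]
        subspace_neg[OF complex_subspace_imp_subspace[OF V(1)]] by auto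
    define w where "w = t *\<^sub>R v"
    have exp: "(x + u - z) \<bullet> A (x + u - z) = (x - z) \<bullet> A (x - z) + (x - z) \<bullet> A u + u \<bullet> A (x - z) + u \<bullet> A u" for u
    proof -
      have "x + u - z = (x - z) + u" by simp
      then show ?thesis by (simp only: linear_add[OF A] inner_add_left inner_add_right)
    qed
    have "w \<bullet> A w \<le> w \<bullet> A' w"
      using le[OF tv(1) t(2)] le[OF tv(2)] t(2) unfolding w_def[symmetric] exp
      by (simp add: linear_neg[OF A] linear_neg[OF A'lin] inner_diff_right inner_add_right)
    then have "t\<^sup>2 * (v \<bullet> A v) \<le> t\<^sup>2 * (v \<bullet> A' v)"
      by (simp add: w_def linear_scale[OF A] linear_scale[OF A'lin] power2_eq_square mult.assoc)
    then show ?thesis using t by simp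
  qed simp
  have "vec.dim (V \<inter> T) \<noteq> 0"
    using vec.dim_sums_Int[OF V(1) T(1)] T(2) V(2)
      dim_subset_UNIV_cart_gen[of "{x + y |x y. x \<in> V \<and> y \<in> T}"] by (simp del: vec.dim_eq_0)
  then obtain v where v: "v \<in> V" "v \<in> T" "v \<noteq> 0" by auto
  have "levi A v \<le> levi A' v"
    using comp[OF v(1)] comp[OF complex_subspace_i_mult[OF V(1) v(1)]] by (simp add: levi_def)
  then show False using pos[OF v(2)] levi_negD(2)[OF A' v(1,3)] by simp
qed

lemma q_psh_const:
  assumes "open U" "q < CARD('n)"
  shows "q_psh q (U :: (complex^'n) set) (\<lambda>z. ereal c)"
proof -
  have "q_psh q U (\<lambda>x. ereal (c + 0 \<bullet> (x - 0) + (x - 0) \<bullet> (\<lambda>_. 0) (x - 0)))"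
    by (rule q_psh_quadratic[OF assms, where T = UNIV]) (auto simp: levi_def vec_dim_card linear_zero simp del: vec.dim_UNIV)
  then show ?thesis by simp
qed

text \<open>
  Adding to the quadratic function a large multiple of the squared distance to \<open>V\<close> does not change its
  Levi form on \<open>V\<close>.
\<close>

lemma penalize_normal_directions:
  fixes \<theta> :: "complex^'n \<Rightarrow> real"
  assumes usc: "usc_on (cball z \<rho>0) (\<lambda>z. ereal (\<theta> z))" and \<rho>0: "\<rho>0 > 0" and V: "vec.subspace V"
    and A: "levi_neg A V" and \<delta>: "\<delta> > 0"
    and le: "\<And>v. v \<in> V \<Longrightarrow> norm v < \<delta> \<Longrightarrow> \<theta> (z + v) \<le> \<theta> z + p \<bullet> v + v \<bullet> A v"
  obtains A' \<rho> \<kappa> where "0 < \<rho>" "\<rho> \<le> \<rho>0" "\<kappa> > 0" "levi_neg A' V"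
    "\<And>v. norm v = \<rho> \<Longrightarrow> \<theta> (z + v) \<le> \<theta> z + p \<bullet> v + v \<bullet> A' v - \<kappa>"
proof -
  note linA = levi_negD(1)[OF A]
  obtain c where c: "c > 0" "\<And>v. v \<in> V \<Longrightarrow> levi A v \<le> - c * (norm v)\<^sup>2"
    using levi_neg_uniform[OF V A] by blast
  have Vr: "subspace V" by (rule complex_subspace_imp_subspace[OF V])
  obtain B where B: "B \<subseteq> V" "pairwise orthogonal B" "\<And>x. x \<in> B \<Longrightarrow> norm x = 1" "independent B" "span B = V"
    using orthonormal_basis_subspace[OF Vr] by metis
  have finB: "finite B" using B(4) independent_imp_finite by blast
  define Pr where "Pr v = (\<Sum>b\<in>B. (v \<bullet> b) *\<^sub>R b)" for v
  have linPr: "linear Pr"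
    unfolding Pr_def by (rule linearI) (simp_all add: inner_add_left scaleR_add_left sum.distrib scaleR_sum_right)
  have PrV: "Pr v \<in> V" for v
    unfolding Pr_def by (rule subspace_sum[OF Vr]) (use B(1) in \<open>auto intro: subspace_scale[OF Vr]\<close>)
  have Prb: "(v - Pr v) \<bullet> b = 0" if b: "b \<in> B" for v b
  proof -
    have "Pr v \<bullet> b = (\<Sum>b'\<in>B. (v \<bullet> b') * (b' \<bullet> b))" by (simp add: Pr_def inner_sum_left)
    also have "\<dots> = (\<Sum>b'\<in>B. if b' = b then v \<bullet> b else 0)"
    proof (rule sum.cong[OF refl])
      fix b' assume b': "b' \<in> B"
      show "(v \<bullet> b') * (b' \<bullet> b) = (if b' = b then v \<bullet> b else 0)"
        using B(2,3) b b' by (auto simp: pairwise_def orthogonal_def norm_eq_1)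
    qed
    also have "\<dots> = v \<bullet> b" using finB b by simp
    finally show ?thesis by (simp add: inner_diff_left)
  qed
  have orth: "(v - Pr v) \<bullet> w = 0" if "w \<in> V" for v w
  proof -
    have "w \<in> span B" using that B(5) by simp
    then show ?thesis
      by (induction rule: span_induct_alt) (use Prb in \<open>auto simp: inner_add_right\<close>)
  qed
  have PrV_id: "Pr v = v" if "v \<in> V" for v
  proof -
    have "(v - Pr v) \<bullet> (v - Pr v) = 0"
      using orth[OF subspace_diff[OF Vr that PrV[of v]]] .
    then show ?thesis by simp
  qed
  have normPr: "v \<bullet> (v - Pr v) = (norm (v - Pr v))\<^sup>2" for v
    using orth[OF PrV[of v], of v] by (simp add: power2_norm_eq_inner inner_diff_left inner_diff_right inner_commute)
  define \<rho> where "\<rho> = min (\<delta> / 2) \<rho>0"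
  have \<rho>: "\<rho> > 0" "\<rho> < \<delta>" "\<rho> \<le> \<rho>0" using \<delta> \<rho>0 by (auto simp: \<rho>_def)
  \<comment> \<open>\<open>A1\<close> spends one half of the slack \<open>c\<close> of the Levi form
    on \<open>V\<close>. In return the inequality is strict by
    \<open>c / 4 * \<rho>\<^sup>2 = 2 * \<kappa>\<close> on the part of the sphere in
    \<open>V\<close>.\<close>
  define A1 where "A1 v = A v + (c / 4) *\<^sub>R v" for v
  define s where "s v = \<theta> (z + v) - \<theta> z - p \<bullet> v - v \<bullet> A1 v" for v
  define \<kappa> where "\<kappa> = c / 8 * \<rho>\<^sup>2"
  have \<kappa>: "\<kappa> > 0" using c \<rho> by (simp add: \<kappa>_def)
  have sV: "s v \<le> - 2 * \<kappa>" if "v \<in> V" "norm v = \<rho>" for v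
    using le[of v] that \<rho>(2) by (simp add: s_def A1_def \<kappa>_def inner_add_right flip: power2_norm_eq_inner)
  have contA: "continuous_on T A" for T
    by (rule linear_imp_continuous_on[OF linA])
  have usc_s: "usc_on (sphere 0 \<rho>) (\<lambda>v. ereal (s v))"
  proof -
    have 1: "usc_on (sphere 0 \<rho>) (\<lambda>v. ereal (\<theta> (z + v)))"
      by (rule usc_on_translate[OF usc]) (use \<rho>(3) in \<open>simp add: dist_norm\<close>)
    have "usc_on (sphere 0 \<rho>) (\<lambda>v. ereal (\<theta> (z + v) + (- \<theta> z - p \<bullet> v - v \<bullet> A1 v)))"
      unfolding A1_def by (intro usc_on_add_continuous[OF 1] continuous_intros contA)
    then show ?thesis by (simp add: s_def algebra_simps)
  qed
  \<comment> \<open>If every \<open>k\<close> failed, the bad points on the sphere would accumulate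
    at a point of \<open>V\<close>. By \<open>sV\<close> the margin there is
    \<open>2 * \<kappa>\<close>, and semicontinuity preserves half of it nearby.\<close>
  have "\<exists>k::nat. \<forall>v. norm v = \<rho> \<longrightarrow> s v - real k * (norm (v - Pr v))\<^sup>2 \<le> - \<kappa>"
  proof (rule ccontr)
    assume "\<not> ?thesis"
    then obtain x where x: "\<And>k. norm (x k) = \<rho>" "\<And>k. - \<kappa> < s (x k) - real k * (norm (x k - Pr (x k)))\<^sup>2"
      by (meson linorder_not_le)
    obtain l \<sigma> where l: "l \<in> sphere 0 \<rho>" "strict_mono \<sigma>" "(x \<circ> \<sigma>) \<longlonglongrightarrow> l"
      using compact_sphere[of "0::complex^'n" \<rho>, unfolded compact_def] x(1) by (metis mem_sphere_0)
    have xl: "(\<lambda>k. x (\<sigma> k)) \<longlonglongrightarrow> l" using l(3) by (simp add: o_def)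
    obtain m where m: "\<And>v. norm v = \<rho> \<Longrightarrow> s v \<le> m"
      using usc_on_compact_attains_sup_real[OF usc_s compact_sphere] l(1) by (metis empty_iff mem_sphere_0)
    have Pc: "(\<lambda>k. (norm (x (\<sigma> k) - Pr (x (\<sigma> k))))\<^sup>2) \<longlonglongrightarrow> (norm (l - Pr l))\<^sup>2"
      using linPr by (intro tendsto_intros xl bounded_linear.tendsto[OF _ xl]) (simp add: linear_conv_bounded_linear)
    have "(norm (l - Pr l))\<^sup>2 \<le> 0"
    proof (rule LIMSEQ_le[OF LIMSEQ_Suc[OF Pc]])
      show "(\<lambda>k. (m + \<kappa>) * inverse (real (Suc k))) \<longlonglongrightarrow> 0"
        using tendsto_mult_left[OF LIMSEQ_inverse_real_of_nat, of "m + \<kappa>"] by simp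
      have "(norm (x (\<sigma> (Suc k)) - Pr (x (\<sigma> (Suc k)))))\<^sup>2 \<le> (m + \<kappa>) * inverse (real (Suc k))" (is "?P \<le> _") for k
      proof -
        have "Suc k \<le> \<sigma> (Suc k)" using l(2) by (rule seq_suble)
        then have "real (Suc k) * ?P \<le> real (\<sigma> (Suc k)) * ?P"
          by (intro mult_right_mono) (auto simp del: of_nat_Suc)
        also have "\<dots> \<le> m + \<kappa>"
          using x(2)[of "\<sigma> (Suc k)"] m[OF x(1)[of "\<sigma> (Suc k)"]] by simp
        finally show ?thesis by (simp add: field_simps del: of_nat_Suc)
      qed
      then show "\<exists>N. \<forall>k\<ge>N. (norm (x (\<sigma> (Suc k)) - Pr (x (\<sigma> (Suc k)))))\<^sup>2 \<le> (m + \<kappa>) * inverse (real (Suc k))" by blast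
    qed
    then have "l - Pr l = 0" by simp
    then have "l \<in> V" using PrV[of l] by simp
    then have "s l \<le> - 2 * \<kappa>" using l(1) by (intro sV) auto
    then have "ereal (s l) < ereal (- \<kappa>)" using \<kappa> by simp
    then have "\<forall>\<^sub>F k in sequentially. ereal (s (x (\<sigma> k))) < ereal (- \<kappa>)"
      by (intro usc_on_sequentially[OF usc_s _ xl l(1)]) (use x(1) in auto)
    then obtain k where "s (x (\<sigma> k)) < - \<kappa>" by (auto simp: eventually_sequentially)
    moreover have "0 \<le> real (\<sigma> k) * (norm (x (\<sigma> k) - Pr (x (\<sigma> k))))\<^sup>2" by simp
    ultimately show False using x(2)[of "\<sigma> k"] by linarith
  qed
  then obtain k :: nat where k: "\<And>v. norm v = \<rho> \<Longrightarrow> s v - real k * (norm (v - Pr v))\<^sup>2 \<le> - \<kappa>" by blast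
  define A' where "A' v = A1 v + real k *\<^sub>R (v - Pr v)" for v
  show thesis
  proof (rule that[OF \<rho>(1,3) \<kappa>])
    show "levi_neg A' V"
      unfolding levi_neg_def
    proof (intro conjI ballI impI)
      show "linear A'"
        unfolding A'_def A1_def
        by (intro linear_compose_add linear_compose_sub linear_compose_scale_right linA linPr linear_id[unfolded id_def] linear_scaleR)
      fix v assume v: "v \<in> V" "v \<noteq> 0"
      have "levi A' v = levi A1 v"
        using PrV_id[OF v(1)] PrV_id[OF complex_subspace_i_mult[OF V v(1)]] by (simp add: levi_def A'_def)
      also have "\<dots> \<le> - (c / 2) * (norm v)\<^sup>2"
        unfolding A1_def levi_add_scaleR using c(2)[OF v(1)] by simp
      also have "\<dots> < 0" using c(1) v(2) by simp
      finally show "levi A' v < 0" .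
    qed
    show "\<theta> (z + v) \<le> \<theta> z + p \<bullet> v + v \<bullet> A' v - \<kappa>" if "norm v = \<rho>" for v
      using k[OF that] by (simp add: s_def A'_def inner_add_right normPr)
  qed
qed

text \<open>The inequality on the sphere forces a maximum of the difference into the open ball.
  Expanding the quadratic function about that point changes only its affine part, so it is a
  forbidden test function there.\<close>

lemma q_psh_no_strict_bump:
  fixes U :: "(complex^'n) set"
  assumes psh: "q_psh q U (\<lambda>z. ereal (\<psi> z))" and \<rho>: "\<rho> > 0" "cball z \<rho> \<subseteq> U"
    and V: "vec.subspace V" "vec.dim V = q + 1" and A: "levi_neg A V" and w: "norm w \<le> \<rho>"
    and lt: "\<And>v. norm v = \<rho> \<Longrightarrow> \<psi> (z + v) - p \<bullet> v - v \<bullet> A v < \<psi> (z + w) - p \<bullet> w - w \<bullet> A w"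
  shows False
proof -
  note linA = levi_negD(1)[OF A]
  define \<theta> where "\<theta> x = \<psi> x - p \<bullet> (x - z) - (x - z) \<bullet> A (x - z)" for x
  have contA: "continuous_on T A" for T
    by (rule linear_imp_continuous_on[OF linA])
  have "usc_on (cball z \<rho>) (\<lambda>x. ereal (\<psi> x + (- p \<bullet> (x - z) - (x - z) \<bullet> A (x - z))))"
    by (intro usc_on_add_continuous usc_on_subset[OF q_pshD_usc[OF psh] \<rho>(2)] continuous_intros
        continuous_on_compose2[OF contA[of UNIV]]) auto
  then have "usc_on (cball z \<rho>) (\<lambda>x. ereal (\<theta> x))" by (simp add: \<theta>_def algebra_simps)
  moreover have "cball z \<rho> \<noteq> {}" using \<rho>(1) by simp
  ultimately obtain x where x: "x \<in> cball z \<rho>" "\<And>y. y \<in> cball z \<rho> \<Longrightarrow> \<theta> y \<le> \<theta> x"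
    using usc_on_compact_attains_sup_real[OF _ compact_cball] by metis
  have "\<theta> (z + w) \<le> \<theta> x" using w by (intro x(2)) (simp add: dist_norm)
  have "norm (x - z) \<noteq> \<rho>"
  proof
    assume "norm (x - z) = \<rho>"
    then have "\<theta> x < \<theta> (z + w)" using lt[of "x - z"] by (simp add: \<theta>_def)
    then show False using \<open>\<theta> (z + w) \<le> \<theta> x\<close> by simp
  qed
  then have ball: "norm (x - z) < \<rho>" using x(1) by (simp add: dist_norm norm_minus_commute)
  show False
  proof (rule q_pshD_real[OF psh _ V A, of x "\<rho> - norm (x - z)" "p + A (x - z) + adjoint A (x - z)"])
    show "x \<in> U" using x(1) \<rho>(2) by blast
    show "0 < \<rho> - norm (x - z)" using ball by simp
    fix v :: "complex^'n" assume v: "norm v < \<rho> - norm (x - z)"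
    have e: "x + v - z = (x - z) + v" by simp
    have "norm (x + v - z) \<le> \<rho>"
      unfolding e using norm_triangle_ineq[of "x - z" v] v by simp
    then have "x + v \<in> cball z \<rho>" by (simp add: dist_norm norm_minus_commute)
    from x(2)[OF this] show "\<psi> (x + v) \<le> \<psi> x + (p + A (x - z) + adjoint A (x - z)) \<bullet> v + v \<bullet> A v"
      unfolding \<theta>_def e linear_add[OF linA] inner_add_left inner_add_right
      using adjoint_works[OF linA, of v "x - z"] by (simp add: inner_commute)
  qed
qed

text \<open>
  Slodkowski's theorem. If the sum failed the test on \<open>V\<close>, the theorem on sums would give jets of \<open>\<psi>\<close>
  and \<open>\<phi>\<close> whose Levi forms add up to a negative form on \<open>V\<close>. The first form is nonnegative on a
  subspace of \<open>V\<close> of dimension \<open>r + 1\<close>, where the second one is then negative: a contradiction.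
\<close>

theorem q_psh_add:
  fixes U :: "(complex^'n) set"
  assumes psi: "q_psh q U (\<lambda>z. ereal (\<psi> z))" and phi: "q_psh r U (\<lambda>z. ereal (\<phi> z))" and qr: "q + r < CARD('n)"
  shows "q_psh (q + r) U (\<lambda>z. ereal (\<psi> z + \<phi> z))"
proof (rule q_pshI_real[OF q_pshD_open[OF psi] qr])
  show usc: "usc_on U (\<lambda>z. ereal (\<psi> z + \<phi> z))"
    by (rule usc_on_add[OF q_pshD_usc[OF psi] q_pshD_usc[OF phi]])
  fix z p A \<delta> and V :: "(complex^'n) set"
  assume z: "z \<in> U" and V: "vec.subspace V" "vec.dim V = q + r + 1" and A: "levi_neg A V" and \<delta>: "0 < (\<delta> :: real)"
    and le: "\<And>v. v \<in> V \<Longrightarrow> norm v < \<delta> \<Longrightarrow> \<psi> (z + v) + \<phi> (z + v) \<le> \<psi> z + \<phi> z + p \<bullet> v + v \<bullet> A v"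
  obtain \<rho>0 where \<rho>0: "\<rho>0 > 0" "cball z \<rho>0 \<subseteq> U"
    using q_pshD_open[OF psi] z open_contains_cball by metis
  obtain A' \<rho> \<kappa> where \<rho>: "0 < \<rho>" "\<rho> \<le> \<rho>0" and \<kappa>: "\<kappa> > 0" and A': "levi_neg A' V"
    and sph: "\<And>v. norm v = \<rho> \<Longrightarrow> \<psi> (z + v) + \<phi> (z + v) \<le> \<psi> z + \<phi> z + p \<bullet> v + v \<bullet> A' v - \<kappa>"
    using penalize_normal_directions[OF usc_on_subset[OF usc \<rho>0(2)] \<rho>0(1) V(1) A \<delta> le] by metis
  note linA' = levi_negD(1)[OF A']
  obtain c where c: "c > 0" "\<And>v. v \<in> V \<Longrightarrow> levi A' v \<le> - c * (norm v)\<^sup>2"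
    using levi_neg_uniform[OF V(1) A'] by blast
  have in_U: "z + v \<in> U" if "norm v \<le> \<rho>" for v
    using that \<rho> by (intro subsetD[OF \<rho>0(2)]) (simp add: dist_norm)
  have contA': "continuous_on T A'" for T
    by (rule linear_imp_continuous_on[OF linA'])
  have shift: "usc_on (cball 0 \<rho>) (\<lambda>v. ereal (g (z + v)))" if "usc_on U (\<lambda>z. ereal (g z))" for g :: "complex^'n \<Rightarrow> real"
    by (rule usc_on_translate[OF that]) (use in_U in simp)
  \<comment> \<open>The whole test function is put into \<open>G\<close>. The theorem on sums yields
    jets of \<open>G\<close> at \<open>x\<close> and of \<open>H\<close> at a possibly different
    \<open>y\<close>, and since the test function is quadratic, its Levi form at \<open>x\<close> is
    still that of \<open>A'\<close>.\<close>
  define G where "G v = \<psi> (z + v) + (- \<psi> z - p \<bullet> v - v \<bullet> A' v)" for v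
  define H where "H v = \<phi> (z + v) + (- \<phi> z)" for v
  have uG: "usc_on (cball 0 \<rho>) (\<lambda>v. ereal (G v))"
    unfolding G_def by (intro usc_on_add_continuous shift q_pshD_usc[OF psi] continuous_intros contA')
  have uH: "usc_on (cball 0 \<rho>) (\<lambda>v. ereal (H v))"
    unfolding H_def by (intro usc_on_add_continuous shift q_pshD_usc[OF phi] continuous_intros)
  have "G v + H v \<le> - \<kappa>" if "norm v = \<rho>" for v
    using sph[OF that] by (simp add: G_def H_def)
  moreover have "G 0 + H 0 \<ge> 0" by (simp add: G_def H_def linear_0[OF linA'])
  ultimately obtain x y p1 p2 A1 A2 where x: "norm x < \<rho>" and y: "norm y < \<rho>"
      and j1: "upper_jet G x p1 A1" and j2: "upper_jet H y p2 A2" and sum: "\<And>v. v \<bullet> A1 v + v \<bullet> A2 v \<le> 0"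
    using theorem_on_sums[OF uG uH \<rho>(1) \<kappa>] by metis
  have lin1: "linear A1" and lin2: "linear A2" using j1 j2 by (auto simp: upper_jet_def)
  \<comment> \<open>The Levi forms of \<open>B1\<close> and \<open>B2\<close> gain
    \<open>2 * \<eta>\<close> each, together \<open>c / 2\<close>, which leaves half of the
    negativity of \<open>A'\<close>.\<close>
  define \<eta> where "\<eta> = c / 8"
  have \<eta>: "\<eta> > 0" using c by (simp add: \<eta>_def)
  define B1 where "B1 v = (A' v + A1 v) + \<eta> *\<^sub>R v" for v
  define B2 where "B2 v = A2 v + \<eta> *\<^sub>R v" for v
  have linB1: "linear B1" and linB2: "linear B2"
    unfolding B1_def B2_def by (intro linear_compose_add linA' lin1 lin2 linear_scaleR)+
  obtain \<delta>1 where \<delta>1: "\<delta>1 > 0" "\<And>v. norm v < \<delta>1 \<Longrightarrow> G (x + v) \<le> G x + p1 \<bullet> v + v \<bullet> A1 v + \<eta> * (norm v)\<^sup>2"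
    using j1 \<eta> unfolding upper_jet_def by metis
  obtain \<delta>2 where \<delta>2: "\<delta>2 > 0" "\<And>v. norm v < \<delta>2 \<Longrightarrow> H (y + v) \<le> H y + p2 \<bullet> v + v \<bullet> A2 v + \<eta> * (norm v)\<^sup>2"
    using j2 \<eta> unfolding upper_jet_def by metis
  have t1: "\<psi> ((z + x) + v) \<le> \<psi> (z + x) + (p + p1 + A' x + adjoint A' x) \<bullet> v + v \<bullet> B1 v" if "norm v < \<delta>1" for v
    using \<delta>1(2)[OF that] adjoint_works[OF linA', of v x]
    unfolding G_def B1_def linear_add[OF linA'] inner_add_left inner_add_right
    by (simp add: add.assoc inner_commute flip: power2_norm_eq_inner)
  have t2: "\<phi> ((z + y) + v) \<le> \<phi> (z + y) + p2 \<bullet> v + v \<bullet> B2 v" if "norm v < \<delta>2" for v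
    using \<delta>2(2)[OF that]
    unfolding H_def B2_def inner_add_right by (simp add: add.assoc flip: power2_norm_eq_inner)
  have levi_sum: "levi B1 v + levi B2 v \<le> - (c / 2) * (norm v)\<^sup>2" if v: "v \<in> V" for v
  proof -
    have "levi B1 v = levi (\<lambda>v. A' v + A1 v) v + 2 * \<eta> * (norm v)\<^sup>2" unfolding B1_def by (rule levi_add_scaleR)
    moreover have "levi (\<lambda>v. A' v + A1 v) v = levi A' v + levi A1 v" by (simp add: levi_def inner_add_right)
    moreover have "levi B2 v = levi A2 v + 2 * \<eta> * (norm v)\<^sup>2" unfolding B2_def by (rule levi_add_scaleR)
    moreover have "levi A1 v + levi A2 v \<le> 0" using sum[of v] sum[of "\<i> *s v"] by (simp add: levi_def)
    ultimately show ?thesis using c(2)[OF v] by (simp add: \<eta>_def)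
  qed
  \<comment> \<open>The polarised Levi form of \<open>B1\<close>, symmetrised so that
    \<open>hermitian_nonneg_subspace\<close> applies.\<close>
  define \<beta> where "\<beta> v w = (v \<bullet> B1 w + w \<bullet> B1 v + (\<i> *s v) \<bullet> B1 (\<i> *s w) + (\<i> *s w) \<bullet> B1 (\<i> *s v)) / 2" for v w
  have \<beta>levi: "\<beta> v v = levi B1 v" for v by (simp add: \<beta>_def levi_def)
  have lin_i: "\<i> *s (u + v) = \<i> *s u + \<i> *s v" "\<i> *s (t *\<^sub>R v) = t *\<^sub>R (\<i> *s v)" for u v :: "complex^'n" and t
    using linear_add[OF linear_i_mult] linear_scale[OF linear_i_mult] by auto
  obtain S where S: "vec.subspace S" "S \<subseteq> V" "vec.dim S = r + 1" "\<And>v. v \<in> S \<Longrightarrow> \<beta> v v \<ge> 0"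
  proof (rule hermitian_nonneg_subspace[of \<beta> V q r])
    show "\<beta> (u + v) w = \<beta> u w + \<beta> v w" for u v w
      by (simp add: \<beta>_def lin_i linear_add[OF linB1] inner_add_left inner_add_right add_divide_distrib)
    show "\<beta> (t *\<^sub>R v) w = t * \<beta> v w" for t v w
      by (simp add: \<beta>_def lin_i linear_scale[OF linB1]) (simp add: algebra_simps)
    show "\<beta> v w = \<beta> w v" for v w by (simp add: \<beta>_def)
    show "\<beta> (\<i> *s v) (\<i> *s w) = \<beta> v w" for v w by (simp add: \<beta>_def linear_neg[OF linB1])
    show "vec.subspace V" "q + r + 1 \<le> vec.dim V" using V by auto
    fix S assume S: "vec.subspace S" "S \<subseteq> V" "vec.dim S = q + 1"
    show "\<exists>v\<in>S. v \<noteq> 0 \<and> \<beta> v v \<ge> 0"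
    proof (rule ccontr)
      assume "\<not> ?thesis"
      then have "levi_neg B1 S" using linB1 by (auto simp: levi_neg_def \<beta>levi not_le)
      then show False
        using q_pshD_real[OF psi in_U[OF less_imp_le[OF x]] S(1,3) _ \<delta>1(1) t1] by blast
    qed
  qed blast
  have "levi_neg B2 S"
    unfolding levi_neg_def
  proof (intro conjI ballI impI linB2)
    fix v assume v: "v \<in> S" "v \<noteq> 0"
    then have "0 < (c / 2) * (norm v)\<^sup>2" using c(1) by simp
    then show "levi B2 v < 0" using levi_sum[of v] S(2,4) v(1) by (force simp: \<beta>levi)
  qed
  then show False
    using q_pshD_real[OF phi in_U[OF less_imp_le[OF y]] S(1,3) _ \<delta>2(1) t2] by blast
qed

text \<open>At each point the glued function takes the value of \<open>\<psi>\<close> or of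
  \<open>s\<close>, and that function lies below it nearby. So whatever touches the glued function
  from above touches a \<open>q\<close>-plurisubharmonic one. \<open>le\<close> secures upper
  semicontinuity at the boundary of \<open>W\<close> in \<open>D\<close>.\<close>

lemma q_psh_glue:
  fixes D :: "(complex^'n) set"
  assumes psi: "q_psh q D (\<lambda>z. ereal (\<psi> z))" and s: "q_psh q W (\<lambda>z. ereal (s z))" and W: "W \<subseteq> D"
    and le: "\<And>p. p \<in> D - W \<Longrightarrow> \<forall>\<^sub>F w in inf (nhds p) (principal W). s w \<le> \<psi> w"
  shows "q_psh q D (\<lambda>z. ereal (if z \<in> W then max (\<psi> z) (s z) else \<psi> z))"
proof -
  define \<gamma> where "\<gamma> z = (if z \<in> W then max (\<psi> z) (s z) else \<psi> z)" for z
  have W_open: "open W" by (rule q_pshD_open[OF s])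
  have "usc_on D (\<lambda>z. ereal (\<gamma> z))"
    unfolding usc_on_real_iff
  proof (intro ballI allI impI)
    fix z c assume z: "z \<in> D" "\<gamma> z < c"
    have "\<psi> z < c" using z(2) by (simp add: \<gamma>_def split: if_splits)
    then have ev1: "\<forall>\<^sub>F w in inf (nhds z) (principal D). \<psi> w < c"
      using q_pshD_usc[OF psi] z(1) unfolding usc_on_real_iff by blast
    have "\<forall>\<^sub>F w in inf (nhds z) (principal D). w \<in> W \<longrightarrow> \<psi> w < c \<longrightarrow> s w < c"
    proof (cases "z \<in> W")
      case True
      then have "s z < c" using z(2) by (simp add: \<gamma>_def)
      then have "\<forall>\<^sub>F w in inf (nhds z) (principal W). s w < c"
        using q_pshD_usc[OF s] True unfolding usc_on_real_iff by blast
      then show ?thesis by (auto simp: eventually_inf_principal elim: eventually_mono)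
    next
      case False
      then have "\<forall>\<^sub>F w in inf (nhds z) (principal W). s w \<le> \<psi> w" using le z(1) by blast
      then show ?thesis by (auto simp: eventually_inf_principal elim: eventually_mono)
    qed
    with ev1 show "\<forall>\<^sub>F w in inf (nhds z) (principal D). \<gamma> w < c"
      by eventually_elim (auto simp: \<gamma>_def)
  qed
  then have "q_psh q D (\<lambda>z. ereal (\<gamma> z))"
  proof (rule q_pshI_real[OF q_pshD_open[OF psi] q_pshD_less[OF psi]])
    fix z p A \<delta> and V :: "(complex^'n) set"
    assume z: "z \<in> D" and V: "vec.subspace V" "vec.dim V = q + 1" and A: "levi_neg A V" and \<delta>: "0 < (\<delta> :: real)"
      and touch: "\<And>v. v \<in> V \<Longrightarrow> norm v < \<delta> \<Longrightarrow> \<gamma> (z + v) \<le> \<gamma> z + p \<bullet> v + v \<bullet> A v"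
    show False
    proof (cases "\<gamma> z = \<psi> z")
      case True
      have "\<psi> w \<le> \<gamma> w" for w by (simp add: \<gamma>_def)
      then show False
        using q_pshD_real[OF psi z V A \<delta>] touch unfolding True by (meson order_trans)
    next
      case False
      then have zW: "z \<in> W" and eq: "\<gamma> z = s z" by (auto simp: \<gamma>_def max_def split: if_splits)
      obtain e where e: "e > 0" "ball z e \<subseteq> W" using W_open zW open_contains_ball by blast
      show False
      proof (rule q_pshD_real[OF s zW V A, of "min \<delta> e"])
        fix v assume v: "v \<in> V" "norm v < min \<delta> e"
        then have "z + v \<in> W" by (intro subsetD[OF e(2)]) (simp add: dist_norm)
        then have "s (z + v) \<le> \<gamma> (z + v)" by (simp add: \<gamma>_def)
        then show "s (z + v) \<le> s z + p \<bullet> v + v \<bullet> A v" using touch[OF v(1)] v(2) eq by simp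
      qed (use \<delta> e in auto)
    qed
  qed
  then show ?thesis by (simp add: \<gamma>_def)
qed

text \<open>A test function touching \<open>u\<close> at \<open>z\<close> can be made strict by a
  margin \<open>\<kappa>\<close> on a small sphere. Some member of \<open>F\<close> comes within
  \<open>\<kappa> / 2\<close> of \<open>u z\<close> at a point close to \<open>z\<close>, stays
  below \<open>u\<close> on the sphere and thus has a strict bump.\<close>

lemma q_psh_upper_envelope:
  fixes D :: "(complex^'n) set"
  assumes D: "open D" and q: "q < CARD('n)" and psh: "\<And>\<psi>. \<psi> \<in> F \<Longrightarrow> q_psh q D (\<lambda>z. ereal (\<psi> z))"
    and usc: "usc_on D (\<lambda>z. ereal (u z))" and le: "\<And>\<psi> z. \<psi> \<in> F \<Longrightarrow> z \<in> D \<Longrightarrow> \<psi> z \<le> u z"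
    and freq: "\<And>z e. z \<in> D \<Longrightarrow> e > 0 \<Longrightarrow> \<exists>\<^sub>F w in nhds z. \<exists>\<psi>\<in>F. u z - e < \<psi> w"
  shows "q_psh q D (\<lambda>z. ereal (u z))"
proof (rule q_pshI_real[OF D q usc])
  fix z p A \<delta> and V :: "(complex^'n) set"
  assume z: "z \<in> D" and V: "vec.subspace V" "vec.dim V = q + 1" and A: "levi_neg A V" and \<delta>: "0 < (\<delta> :: real)"
    and touch: "\<And>v. v \<in> V \<Longrightarrow> norm v < \<delta> \<Longrightarrow> u (z + v) \<le> u z + p \<bullet> v + v \<bullet> A v"
  obtain \<rho>0 where \<rho>0: "\<rho>0 > 0" "cball z \<rho>0 \<subseteq> D"
    using D z open_contains_cball by metis
  obtain A' \<rho> \<kappa> where \<rho>: "0 < \<rho>" "\<rho> \<le> \<rho>0" and \<kappa>: "\<kappa> > 0" and A': "levi_neg A' V"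
    and sph: "\<And>v. norm v = \<rho> \<Longrightarrow> u (z + v) \<le> u z + p \<bullet> v + v \<bullet> A' v - \<kappa>"
    using penalize_normal_directions[OF usc_on_subset[OF usc \<rho>0(2)] \<rho>0(1) V(1) A \<delta> touch] by metis
  have cD: "cball z \<rho> \<subseteq> D" using \<rho> \<rho>0 by auto
  define Q where "Q x = p \<bullet> (x - z) + (x - z) \<bullet> A' (x - z)" for x
  have contA: "continuous_on UNIV A'"
    by (rule linear_imp_continuous_on[OF levi_negD(1)[OF A']])
  have "continuous_on UNIV Q"
    unfolding Q_def by (intro continuous_intros continuous_on_compose2[OF contA]) auto
  then have "(Q \<longlongrightarrow> Q z) (nhds z)"
    by (simp add: continuous_on_eq_continuous_at isCont_def tendsto_at_iff_tendsto_nhds)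
  moreover have "Q z = 0" by (simp add: Q_def linear_0[OF levi_negD(1)[OF A']])
  ultimately have "\<forall>\<^sub>F w in nhds z. Q w < \<kappa> / 2" using \<kappa> by (auto dest!: order_tendstoD(2)[of _ _ _ "\<kappa> / 2"])
  moreover have "\<forall>\<^sub>F w in nhds z. w \<in> ball z \<rho>" using \<rho> by (intro eventually_nhds_in_open) auto
  ultimately have "\<forall>\<^sub>F w in nhds z. Q w < \<kappa> / 2 \<and> w \<in> ball z \<rho>" by eventually_elim simp
  from frequently_eventually_conj[OF freq[OF z, of "\<kappa> / 2"] this]
  obtain w \<psi> where w: "Q w < \<kappa> / 2" "w \<in> ball z \<rho>" "\<psi> \<in> F" "u z - \<kappa> / 2 < \<psi> w"
    using \<kappa> by (auto dest: frequently_ex)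
  show False
  proof (rule q_psh_no_strict_bump[OF psh[OF w(3)] \<rho>(1) cD V A', of "w - z"])
    show "norm (w - z) \<le> \<rho>" using w(2) by (simp add: dist_norm norm_minus_commute)
    fix v :: "complex^'n" assume v: "norm v = \<rho>"
    then have "z + v \<in> D" using cD by (auto simp: dist_norm)
    then have "\<psi> (z + v) - p \<bullet> v - v \<bullet> A' v \<le> u z - \<kappa>" using le[OF w(3), of "z + v"] sph[OF v] by simp
    also have "\<dots> < \<psi> w - Q w" using w by simp
    finally show "\<psi> (z + v) - p \<bullet> v - v \<bullet> A' v < \<psi> (z + (w - z)) - p \<bullet> (w - z) - (w - z) \<bullet> A' (w - z)"
      by (simp add: Q_def)
  qed
qed

text \<open>At an interior maximum of \<open>\<psi> + \<epsilon> |w|^2\<close> the function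
  \<open>\<psi>\<close> is touched by a quadratic function with Levi form
  \<open>- 2 \<epsilon> |v|^2\<close>, negative on every subspace. Hence the principle holds for
  every index below \<open>n\<close>.\<close>

lemma q_psh_maximum_principle:
  fixes W :: "(complex^'n) set"
  assumes psh: "q_psh q W (\<lambda>z. ereal (\<psi> z))" and bounded: "bounded W"
    and bd: "\<And>p e. p \<in> frontier W \<Longrightarrow> e > 0 \<Longrightarrow> \<forall>\<^sub>F w in inf (nhds p) (principal W). \<psi> w < c + e"
    and z: "z \<in> W"
  shows "\<psi> z \<le> c"
proof (rule ccontr)
  assume "\<not> \<psi> z \<le> c"
  then have gt: "c < \<psi> z" by simp
  have W: "open W" by (rule q_pshD_open[OF psh])
  obtain R where R: "R > 0" "\<And>w. w \<in> W \<Longrightarrow> norm w \<le> R"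
    using bounded by (auto simp: bounded_pos)
  define \<epsilon> where "\<epsilon> = (\<psi> z - c) / (2 * (R\<^sup>2 + 1))"
  define d where "d = R\<^sup>2 + 1"
  have "d > 0" by (simp add: d_def add_nonneg_pos)
  then have \<epsilon>: "\<epsilon> > 0" "2 * \<epsilon> * d = \<psi> z - c"
    using gt unfolding \<epsilon>_def d_def[symmetric] by simp_all
  have nW: "\<epsilon> * (norm w)\<^sup>2 \<le> \<epsilon> * R\<^sup>2" if "w \<in> W" for w
    using R(2)[OF that] \<epsilon>(1) by (intro mult_left_mono power_mono) auto
  \<comment> \<open>On the frontier the constant \<open>c + \<epsilon> * R\<^sup>2\<close> bounds
    all limits permitted by \<open>bd\<close>, so this extension to the compact closure is upper
    semicontinuous. \<open>\<epsilon>\<close> is so small that the constant stays below the value at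
    \<open>z\<close>.\<close>
  define \<theta> where "\<theta> w = (if w \<in> W then \<psi> w + \<epsilon> * (norm w)\<^sup>2 else c + \<epsilon> * R\<^sup>2)" for w
  have "usc_on (closure W) (\<lambda>w. ereal (\<theta> w))"
    unfolding usc_on_real_iff
  proof (intro ballI allI impI)
    fix x c' assume x: "x \<in> closure W" "\<theta> x < c'"
    have "\<forall>\<^sub>F w in nhds x. \<theta> w < c' \<or> w \<notin> closure W"
    proof (cases "x \<in> W")
      case True
      have "usc_on W (\<lambda>w. ereal (\<psi> w + \<epsilon> * (norm w)\<^sup>2))"
        by (intro usc_on_add_continuous q_pshD_usc[OF psh] continuous_intros)
      then have "\<forall>\<^sub>F w in inf (nhds x) (principal W). \<psi> w + \<epsilon> * (norm w)\<^sup>2 < c'"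
        using True x(2) unfolding usc_on_real_iff by (auto simp: \<theta>_def)
      then have "\<forall>\<^sub>F w in nhds x. w \<in> W \<longrightarrow> \<psi> w + \<epsilon> * (norm w)\<^sup>2 < c'" by (simp add: eventually_inf_principal)
      moreover have "\<forall>\<^sub>F w in nhds x. w \<in> W" by (rule eventually_nhds_in_open[OF W True])
      ultimately show ?thesis by eventually_elim (auto simp: \<theta>_def)
    next
      case False
      then have xf: "x \<in> frontier W" using x(1) W by (simp add: frontier_def interior_open)
      have c': "c + \<epsilon> * R\<^sup>2 < c'" using x(2) False by (simp add: \<theta>_def)
      then have "\<forall>\<^sub>F w in inf (nhds x) (principal W). \<psi> w < c + (c' - (c + \<epsilon> * R\<^sup>2))"
        by (intro bd[OF xf]) simp
      then have "\<forall>\<^sub>F w in nhds x. w \<in> W \<longrightarrow> \<psi> w < c + (c' - (c + \<epsilon> * R\<^sup>2))" by (simp add: eventually_inf_principal)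
      then show ?thesis
      proof eventually_elim
        case (elim w)
        then show ?case using nW[of w] c' by (auto simp: \<theta>_def)
      qed
    qed
    then show "\<forall>\<^sub>F w in inf (nhds x) (principal (closure W)). \<theta> w < c'"
      by (auto simp: eventually_inf_principal elim: eventually_mono)
  qed
  moreover have "compact (closure W)" using bounded by (simp add: compact_closure)
  moreover have "closure W \<noteq> {}" using z by auto
  ultimately obtain x where x: "x \<in> closure W" "\<And>y. y \<in> closure W \<Longrightarrow> \<theta> y \<le> \<theta> x"
    using usc_on_compact_attains_sup_real by metis
  have "\<theta> z > c + \<epsilon> * R\<^sup>2"
  proof -
    have "0 \<le> \<epsilon> * (norm z)\<^sup>2" "0 \<le> \<epsilon> * R\<^sup>2" using \<epsilon>(1) by auto
    moreover have "\<psi> z - c = 2 * (\<epsilon> * R\<^sup>2) + 2 * \<epsilon>" using \<epsilon>(2) by (simp add: d_def algebra_simps)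
    moreover have "\<theta> z = \<psi> z + \<epsilon> * (norm z)\<^sup>2" using z by (simp add: \<theta>_def)
    ultimately show ?thesis using \<epsilon>(1) by linarith
  qed
  moreover have "\<theta> z \<le> \<theta> x" using z closure_subset by (intro x(2)) blast
  ultimately have xW: "x \<in> W" by (auto simp: \<theta>_def split: if_splits)
  obtain e where e: "e > 0" "ball x e \<subseteq> W" using W xW open_contains_ball by blast
  obtain V :: "(complex^'n) set" where V: "vec.subspace V" "vec.dim V = q + 1"
  proof (rule complex_subspace_of_dim[of "UNIV :: (complex^'n) set" "q + 1"])
    show "q + 1 \<le> vec.dim (UNIV :: (complex^'n) set)"
      using q_pshD_less[OF psh] by (simp add: vec_dim_card del: vec.dim_UNIV)
  qed auto
  have lev: "levi (\<lambda>v. (- \<epsilon>) *\<^sub>R v) v = - 2 * \<epsilon> * (norm v)\<^sup>2" for v :: "complex^'n"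
    by (simp add: levi_def inner_i_mult power2_norm_eq_inner)
  have "levi_neg (\<lambda>v. (- \<epsilon>) *\<^sub>R v) V"
    unfolding levi_neg_def lev using \<epsilon>(1) by (auto intro: linear_scaleR)
  then show False
  proof (rule q_pshD_real[OF psh xW V _ e(1)])
    fix v :: "complex^'n" assume "norm v < e"
    then have "x + v \<in> W" by (intro subsetD[OF e(2)]) (simp add: dist_norm)
    then have "\<theta> (x + v) \<le> \<theta> x" using closure_subset by (intro x(2)) blast
    then have "\<psi> (x + v) + \<epsilon> * (norm (x + v))\<^sup>2 \<le> \<psi> x + \<epsilon> * (norm x)\<^sup>2"
      using \<open>x + v \<in> W\<close> xW by (simp add: \<theta>_def)
    then show "\<psi> (x + v) \<le> \<psi> x + (- (2 * \<epsilon>) *\<^sub>R x) \<bullet> v + v \<bullet> ((- \<epsilon>) *\<^sub>R v)"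
      unfolding power2_norm_add by (simp add: distrib_left power2_norm_eq_inner)
  qed
qed

section \<open>The maximal subsolution\<close>

lemma eventually_nhds_within_self:
  assumes "z \<in> A" "\<forall>\<^sub>F w in inf (nhds z) (principal A). P w"
  shows "P z"
  using assms eventually_nhds_x_imp_x by (fastforce simp: eventually_inf_principal)

lemma eventually_eventually_nhds_within:
  assumes "\<forall>\<^sub>F w in inf (nhds z) (principal A). P w"
  shows "\<forall>\<^sub>F w in inf (nhds z) (principal A). \<forall>\<^sub>F x in inf (nhds w) (principal A). P x"
proof -
  have "\<forall>\<^sub>F w in nhds z. \<forall>\<^sub>F x in nhds w. x \<in> A \<longrightarrow> P x"
    using assms by (simp add: eventually_eventually eventually_inf_principal)
  then show ?thesis
    by (auto simp: eventually_inf_principal elim: eventually_mono)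
qed

lemma eventually_nhds_within_subset:
  assumes "\<forall>\<^sub>F w in inf (nhds z) (principal A). P w" "B \<subseteq> A"
  shows "\<forall>\<^sub>F w in inf (nhds z) (principal B). P w"
  using assms by (auto simp: eventually_inf_principal elim!: eventually_mono)

lemma eventually_nhds_within_openI:
  assumes "open S" "z \<in> S"
  shows "\<forall>\<^sub>F w in inf (nhds z) (principal A). w \<in> S"
  using eventually_nhds_in_open[OF assms] by (auto simp: eventually_inf_principal elim: eventually_mono)

text \<open>Boundedness keeps the regularization real-valued, so the rules for real functions apply.
  The last conclusion, that \<open>U z\<close> lies below every local upper bound of
  \<open>u\<close>, is the source of semicontinuity and of the boundary estimates.\<close>

lemma usc_reg_bounded:
  fixes u :: "complex^'n \<Rightarrow> real"
  assumes bd: "\<And>z. z \<in> A \<Longrightarrow> a \<le> u z" "\<And>z. z \<in> A \<Longrightarrow> u z \<le> b"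
  obtains U where "\<And>z. z \<in> A \<Longrightarrow> usc_reg A u z = ereal (U z)" "\<And>z. z \<in> A \<Longrightarrow> u z \<le> U z"
    "\<And>z. z \<in> A \<Longrightarrow> U z \<le> b" "usc_on A (\<lambda>z. ereal (U z))"
    "\<And>z c. z \<in> A \<Longrightarrow> \<forall>\<^sub>F w in inf (nhds z) (principal A). u w \<le> c \<Longrightarrow> U z \<le> c"
proof -
  define U where "U z = real_of_ereal (usc_reg A u z)" for z
  have ge: "ereal (u z) \<le> usc_reg A u z" if z: "z \<in> A" for z
  proof (rule ccontr)
    assume "\<not> ?thesis"
    then have "\<forall>\<^sub>F w in inf (nhds z) (principal A). ereal (u w) < ereal (u z)"
      unfolding usc_reg_def by (intro Limsup_lessD) (simp add: not_le)
    from eventually_nhds_within_self[OF z this] show False by simp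
  qed
  have le: "usc_reg A u z \<le> ereal c" if "\<forall>\<^sub>F w in inf (nhds z) (principal A). u w \<le> c" for z c
    unfolding usc_reg_def by (rule Limsup_bounded) (use that in simp)
  have inA: "\<forall>\<^sub>F w in inf (nhds z) (principal A). w \<in> A" for z
    by (simp add: eventually_inf_principal)
  have le_b: "usc_reg A u z \<le> ereal b" for z
    by (rule le, rule eventually_mono[OF inA]) (rule bd(2))
  have eq: "usc_reg A u z = ereal (U z)" if z: "z \<in> A" for z
    using ge[OF z] le_b[of z] unfolding U_def by (cases "usc_reg A u z") auto
  have least: "U z \<le> c" if "z \<in> A" "\<forall>\<^sub>F w in inf (nhds z) (principal A). u w \<le> c" for z c
    using le[OF that(2)] eq[OF that(1)] by simp
  have "usc_on A (\<lambda>z. ereal (U z))"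
    unfolding usc_on_real_iff
  proof (intro ballI allI impI)
    fix z c assume z: "z \<in> A" "U z < c"
    obtain c' where c': "U z < c'" "c' < c" using dense[OF z(2)] by blast
    have "usc_reg A u z < ereal c'" using eq[OF z(1)] c'(1) by simp
    then have "\<forall>\<^sub>F w in inf (nhds z) (principal A). ereal (u w) < ereal c'"
      unfolding usc_reg_def by (rule Limsup_lessD)
    then have "\<forall>\<^sub>F w in inf (nhds z) (principal A). u w \<le> c'"
      by (rule eventually_mono) simp
    then have "\<forall>\<^sub>F w in inf (nhds z) (principal A). \<forall>\<^sub>F x in inf (nhds w) (principal A). u x \<le> c'"
      by (rule eventually_eventually_nhds_within)
    with inA show "\<forall>\<^sub>F w in inf (nhds z) (principal A). U w < c"
      by eventually_elim (use least c' in \<open>auto intro: le_less_trans\<close>)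
  qed
  then show thesis
    using that[of U] eq ge le_b least by (metis ereal_less_eq(3))
qed

lemma lsc_reg_eq_uminus_usc_reg: "lsc_reg A u z = - usc_reg A (\<lambda>z. - u z) z"
  using ereal_Limsup_uminus[of "inf (nhds z) (principal A)" "\<lambda>z. ereal (u z)"]
  by (simp add: lsc_reg_def usc_reg_def)

lemma usc_reg_continuous:
  fixes u :: "complex^'n \<Rightarrow> real"
  assumes "continuous_on A u" "z \<in> A"
  shows "usc_reg A u z = ereal (u z)"
  unfolding usc_reg_def
proof (rule lim_imp_Limsup)
  show "inf (nhds z) (principal A) \<noteq> bot"
    unfolding trivial_limit_def using eventually_nhds_within_self[OF assms(2), of "\<lambda>_. False"] by blast
  show "((\<lambda>w. ereal (u w)) \<longlongrightarrow> ereal (u z)) (inf (nhds z) (principal A))"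
    by (intro tendsto_intros continuous_on_imp_tendsto_nhds assms)
qed

lemma usc_on_max_0:
  assumes "usc_on A \<psi>"
  shows "usc_on A (\<lambda>z. max (\<psi> z) 0)"
  unfolding usc_on_def
proof (intro ballI conjI allI impI)
  fix z assume z: "z \<in> A"
  then have "\<psi> z < \<infinity>" using assms by (simp add: usc_on_def)
  then show "max (\<psi> z) 0 < \<infinity>" by (cases "\<psi> z \<le> 0") (auto simp: max_def)
  fix c assume "max (\<psi> z) 0 < c"
  then show "\<forall>\<^sub>F w in at z within A. max (\<psi> w) 0 < c"
    using assms z by (auto simp: usc_on_def eventually_conj_iff)
qed

text \<open>Truncation removes the value \<open>-\<infinity>\<close>, so that arbitrary competitors
  can be compared with real-valued subsolutions.\<close>

lemma q_psh_max_0: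
  fixes U :: "(complex^'n) set"
  assumes psh: "q_psh q U \<psi>"
  shows "q_psh q U (\<lambda>z. ereal (real_of_ereal (max (\<psi> z) 0)))"
proof -
  define \<phi> where "\<phi> z = real_of_ereal (max (\<psi> z) 0)" for z
  have eq: "ereal (\<phi> z) = max (\<psi> z) 0" if "z \<in> U" for z
  proof -
    have "\<psi> z < \<infinity>" using q_pshD_usc[OF psh] that by (simp add: usc_on_def)
    then show ?thesis by (cases "\<psi> z") (auto simp: \<phi>_def max_def zero_ereal_def)
  qed
  have "q_psh q U (\<lambda>z. max (\<psi> z) 0)"
    unfolding q_psh_def
  proof (intro conjI allI impI)
    show "open U" "q < CARD('n)" using psh by (auto simp: q_psh_def)
    show "usc_on U (\<lambda>z. max (\<psi> z) 0)"
      by (rule usc_on_max_0[OF q_pshD_usc[OF psh]])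
    fix P c \<rho> W h
    assume H: "complex_affine_subspace (q + 1) P \<and> 0 < \<rho> \<and> cball c \<rho> \<subseteq> U \<and>
        open W \<and> cball c \<rho> \<subseteq> W \<and> pluriharmonic_on W h \<and>
        (\<forall>z\<in>sphere c \<rho> \<inter> P. max (\<psi> z) 0 \<le> ereal (h z))"
    then have "\<forall>z\<in>cball c \<rho> \<inter> P. \<psi> z \<le> ereal (h z)"
      using psh unfolding q_psh_def by (metis max.bounded_iff)
    moreover have "\<forall>z\<in>cball c \<rho> \<inter> P. ereal 0 \<le> ereal (h z)"
      using q_psh_const[of U q 0] psh H unfolding q_psh_def by (metis max.bounded_iff zero_ereal_def)
    ultimately show "\<forall>z\<in>cball c \<rho> \<inter> P. max (\<psi> z) 0 \<le> ereal (h z)"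
      by (auto simp: zero_ereal_def)
  qed
  then show ?thesis
    using q_psh_cong[of U "\<lambda>z. ereal (\<phi> z)" "\<lambda>z. max (\<psi> z) 0" q] eq by (simp add: \<phi>_def)
qed

text \<open>\<open>\<Psi>\<close> has index \<open>0\<close>, so adding a multiple of it keeps the
  index \<open>q\<close>. It pushes the function, which is bounded by \<open>B\<close>, below
  \<open>c\<close> outside a large ball and does not increase it elsewhere. This reduces the claim
  to a bounded open set.\<close>

lemma bounded_type_maximum_principle:
  fixes D :: "(complex^'n) set"
  assumes bt: "bounded_type D" and psh: "q_psh q D (\<lambda>z. ereal (\<theta> z))" and B: "\<And>z. z \<in> D \<Longrightarrow> \<theta> z \<le> B"
    and bd: "\<And>p e. p \<in> frontier D \<Longrightarrow> e > 0 \<Longrightarrow> \<forall>\<^sub>F w in inf (nhds p) (principal D). \<theta> w < c + e"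
    and z: "z \<in> D"
  shows "\<theta> z \<le> c"
proof (rule ccontr)
  assume "\<not> \<theta> z \<le> c"
  then have gt: "c < \<theta> z" by simp
  obtain \<Psi> :: "complex^'n \<Rightarrow> real" where \<Psi>: "q_psh 0 D (\<lambda>z. ereal (\<Psi> z))" "continuous_on D \<Psi>"
      "\<And>z. z \<in> D \<Longrightarrow> \<Psi> z < 0" "\<And>C. C \<ge> 0 \<Longrightarrow> \<exists>R>0. \<forall>z\<in>D - ball 0 R. \<Psi> z < - C"
    using bt unfolding bounded_type_def by blast
  have D: "open D" by (rule q_pshD_open[OF psh])
  \<comment> \<open>Only half of the excess of \<open>\<theta> z\<close> over \<open>c\<close> is
    spent, so the perturbed function still exceeds \<open>c\<close> at \<open>z\<close>.\<close>
  define \<delta> where "\<delta> = (\<theta> z - c) / (2 * (- \<Psi> z))"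
  have \<Psi>z: "\<Psi> z < 0" by (rule \<Psi>(3)[OF z])
  have \<delta>: "\<delta> > 0" "\<delta> * \<Psi> z = - (\<theta> z - c) / 2" using gt \<Psi>z by (auto simp: \<delta>_def field_simps)
  define C where "C = max 0 ((B - c) / \<delta>)"
  have C: "C \<ge> 0" "B - \<delta> * C \<le> c"
  proof -
    have "(B - c) / \<delta> \<le> C" by (simp add: C_def)
    then show "B - \<delta> * C \<le> c" using \<delta>(1) by (simp add: field_simps)
  qed (simp add: C_def)
  obtain R where R: "R > 0" "\<And>w. w \<in> D \<Longrightarrow> R \<le> norm w \<Longrightarrow> \<Psi> w < - C"
    using \<Psi>(4)[OF C(1)] by (auto simp: not_less)
  define R' where "R' = max R (norm z + 1)"
  define W where "W = D \<inter> ball 0 R'"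
  have W: "open W" "bounded W" "W \<subseteq> D" "z \<in> W"
    using D z by (auto simp: W_def R'_def intro: bounded_subset[OF bounded_ball])
  have "q_psh (q + 0) D (\<lambda>w. ereal (\<theta> w + \<delta> * \<Psi> w))"
    by (rule q_psh_add[OF psh q_psh_cmult[OF \<Psi>(1) \<delta>(1)]]) (use q_pshD_less[OF psh] in simp)
  then have "q_psh q W (\<lambda>w. ereal (\<theta> w + \<delta> * \<Psi> w))"
    using q_psh_subset[OF _ W(1,3)] by simp
  then have "\<theta> z + \<delta> * \<Psi> z \<le> c"
  proof (rule q_psh_maximum_principle[OF _ W(2) _ W(4)])
    fix p :: "complex^'n" and e :: real assume p: "p \<in> frontier W" and e: "e > 0"
    have pW: "p \<in> closure W" "p \<notin> W" using p W(1) by (auto simp: frontier_def interior_open)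
    have inW: "\<forall>\<^sub>F w in inf (nhds p) (principal W). w \<in> W" by (simp add: eventually_inf_principal)
    show "\<forall>\<^sub>F w in inf (nhds p) (principal W). \<theta> w + \<delta> * \<Psi> w < c + e"
    proof (cases "p \<in> D")
      case True
      then have "R \<le> norm p" using pW(2) by (auto simp: W_def R'_def)
      then have "\<Psi> p < - C" using R(2) True by blast
      then have "\<forall>\<^sub>F w in inf (nhds p) (principal D). \<Psi> w < - C"
        by (rule order_tendstoD(2)[OF continuous_on_imp_tendsto_nhds[OF \<Psi>(2) True]])
      from eventually_nhds_within_subset[OF this W(3)] inW show ?thesis
      proof eventually_elim
        case (elim w)
        have "\<delta> * \<Psi> w < \<delta> * (- C)" using elim(1) \<delta>(1) by (rule mult_strict_left_mono)
        then show ?case using B[of w] elim(2) W(3) C(2) e by fastforce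
      qed
    next
      case False
      then have "p \<in> frontier D"
        using pW(1) closure_mono[OF W(3)] D by (auto simp: frontier_def interior_open)
      from eventually_nhds_within_subset[OF bd[OF this e] W(3)] inW show ?thesis
      proof eventually_elim
        case (elim w)
        have "\<delta> * \<Psi> w < 0" using \<Psi>(3)[of w] elim(2) W(3) \<delta>(1) by (intro mult_pos_neg) auto
        then show ?case using elim(1) by simp
      qed
    qed
  qed
  then show False using \<delta>(2) gt by (simp add: field_simps)
qed

text \<open>\<open>rq\<close> makes peak functions \<open>q\<close>-plurisubharmonic, for the lower
  barriers; \<open>qr\<close> keeps the index of \<open>\<psi> + K * \<phi>\<close> below
  \<open>n\<close>, for the upper ones. \<open>M0\<close> covers an empty frontier, where
  \<open>f\<close> gives no lower bound for \<open>M\<close>.\<close>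

locale perron_problem =
  fixes D :: "(complex^'n) set" and f :: "complex^'n \<Rightarrow> real" and M :: real and q r :: nat
  assumes rq: "r \<le> q" and qr: "q + r < CARD('n)" and D: "open D" and Dne: "D \<noteq> {}"
    and peak: "\<And>p. p \<in> frontier D \<Longrightarrow> peak_point r D p"
    and contf: "continuous_on (frontier D) f"
    and f0: "\<And>z. z \<in> frontier D \<Longrightarrow> 0 \<le> f z" and fM: "\<And>z. z \<in> frontier D \<Longrightarrow> f z \<le> M" and M0: "0 \<le> M"
begin

text \<open>Competitors are only upper semicontinuous, unlike those of
  \<open>perron_bremermann\<close>, so that the regularized supremum and its local modifications are
  competitors again. The lower bound \<open>0\<close> keeps the supremum real and loses nothing
  because \<open>f \<ge> 0\<close>.\<close>

definition subsolutions :: "(complex^'n \<Rightarrow> real) set" where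
  "subsolutions = {\<psi>. q_psh q D (\<lambda>z. ereal (\<psi> z)) \<and> usc_on (closure D) (\<lambda>z. ereal (\<psi> z)) \<and>
     (\<forall>z\<in>frontier D. \<psi> z \<le> f z) \<and> (\<forall>z\<in>closure D. 0 \<le> \<psi> z \<and> \<psi> z \<le> M)}"

definition envelope :: "complex^'n \<Rightarrow> real" where
  "envelope z = (SUP \<psi>\<in>subsolutions. \<psi> z)"

lemma q_less: "q < CARD('n)"
  using qr by simp

lemma frontier_sub: "p \<in> frontier D \<Longrightarrow> p \<in> closure D"
  by (simp add: frontier_def)

lemma D_sub: "z \<in> D \<Longrightarrow> z \<in> closure D"
  using closure_subset by blast

lemma closure_cases: "z \<in> closure D \<Longrightarrow> z \<in> D \<or> z \<in> frontier D"
  using D by (auto simp: frontier_def interior_open)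

lemma frontier_notin: "p \<in> frontier D \<Longrightarrow> p \<notin> D"
  using D by (auto simp: frontier_def interior_open)

lemma subsolutionsD:
  assumes "\<psi> \<in> subsolutions"
  shows "q_psh q D (\<lambda>z. ereal (\<psi> z))" "usc_on (closure D) (\<lambda>z. ereal (\<psi> z))"
    "\<And>z. z \<in> frontier D \<Longrightarrow> \<psi> z \<le> f z" "\<And>z. z \<in> closure D \<Longrightarrow> 0 \<le> \<psi> z" "\<And>z. z \<in> closure D \<Longrightarrow> \<psi> z \<le> M"
  using assms by (auto simp: subsolutions_def)

lemma zero_subsolution: "(\<lambda>_. 0) \<in> subsolutions"
  using q_psh_const[OF D q_less, of 0] f0 M0 by (auto simp: subsolutions_def usc_on_real_iff)

lemma envelope_upper: "\<psi> \<in> subsolutions \<Longrightarrow> z \<in> closure D \<Longrightarrow> \<psi> z \<le> envelope z"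
  unfolding envelope_def
  by (rule cSUP_upper) (auto intro!: bdd_aboveI[of _ M] dest: subsolutionsD(5))

lemma envelope_least: "(\<And>\<psi>. \<psi> \<in> subsolutions \<Longrightarrow> \<psi> z \<le> c) \<Longrightarrow> envelope z \<le> c"
  unfolding envelope_def using zero_subsolution by (intro cSUP_least) auto

lemma envelope_bounds:
  assumes "z \<in> closure D"
  shows "0 \<le> envelope z" "envelope z \<le> M"
  using envelope_upper[OF zero_subsolution assms] envelope_least[of z M] subsolutionsD(5) assms by auto

text \<open>On an unbounded domain a peak function may tend to \<open>0\<close> at infinity. Uniform
  negativity is guaranteed on compact sets only, so the barriers are built inside a ball around
  \<open>p\<close> and use the bound \<open>- m\<close> on its sphere.\<close>

lemma peak_function:
  assumes p: "p \<in> frontier D" and \<delta>: "\<delta> > 0"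
  obtains \<phi> m where "q_psh r D (\<lambda>z. ereal (\<phi> z))" "continuous_on (closure D) \<phi>" "\<phi> p = 0"
    "\<And>z. z \<in> closure D \<Longrightarrow> \<phi> z \<le> 0" "m > 0" "\<And>z. z \<in> closure D \<Longrightarrow> dist p z = \<delta> \<Longrightarrow> \<phi> z \<le> - m"
proof -
  obtain \<phi> where \<phi>: "q_psh r D (\<lambda>z. ereal (\<phi> z))" "continuous_on (closure D) \<phi>" "\<phi> p = 0"
      "\<And>z. z \<in> closure D \<Longrightarrow> z \<noteq> p \<Longrightarrow> \<phi> z < 0"
    using peak[OF p] unfolding peak_point_def by blast
  define S where "S = closure D \<inter> sphere p \<delta>"
  have S: "compact S" unfolding S_def by (simp add: closed_Int_compact)
  have "\<exists>m>0. \<forall>z\<in>S. \<phi> z \<le> - m"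
  proof (cases "S = {}")
    case False
    then obtain x where x: "x \<in> S" "\<And>z. z \<in> S \<Longrightarrow> \<phi> z \<le> \<phi> x"
    proof -
      have "continuous_on S \<phi>" by (rule continuous_on_subset[OF \<phi>(2)]) (auto simp: S_def)
      then show ?thesis using continuous_attains_sup[OF S False] that by blast
    qed
    then have "\<phi> x < 0" using \<phi>(4)[of x] \<delta> by (auto simp: S_def)
    then show ?thesis using x(2) by (intro exI[of _ "- \<phi> x"]) auto
  qed (auto intro: exI[of _ 1])
  then obtain m where m: "m > 0" "\<And>z. z \<in> S \<Longrightarrow> \<phi> z \<le> - m" by blast
  show thesis
  proof (rule that[OF \<phi>(1-3) _ m(1)])
    show "\<phi> z \<le> 0" if "z \<in> closure D" for z using \<phi>(3) \<phi>(4)[OF that] by (cases "z = p") auto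
    show "\<phi> z \<le> - m" if "z \<in> closure D" "dist p z = \<delta>" for z using m(2)[of z] that by (simp add: S_def)
  qed
qed

lemma f_near:
  assumes p: "p \<in> frontier D" and e: "e > 0"
  obtains \<delta> where "\<delta> > 0" "\<And>w. w \<in> frontier D \<Longrightarrow> dist p w \<le> \<delta> \<Longrightarrow> \<bar>f w - f p\<bar> < e"
proof -
  obtain d where d: "d > 0" "\<And>w. w \<in> frontier D \<Longrightarrow> dist w p < d \<Longrightarrow> dist (f w) (f p) < e"
    using contf p e unfolding continuous_on_iff by metis
  show thesis
    by (rule that[of "d / 2"]) (use d in \<open>auto simp: dist_commute dist_real_def\<close>)
qed

text \<open>
  The condition \<open>q + r < n\<close> enters here: \<open>\<psi> + K \<phi>\<close> obeys the maximum principle for a subsolution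
  \<open>\<psi>\<close> and a peak function \<open>\<phi>\<close>.
\<close>

lemma upper_barrier:
  assumes p: "p \<in> frontier D" and e: "e > 0"
  shows "\<forall>\<^sub>F z in inf (nhds p) (principal (closure D)). \<forall>\<psi>\<in>subsolutions. \<psi> z \<le> f p + e"
proof -
  obtain \<delta> where \<delta>: "\<delta> > 0" "\<And>w. w \<in> frontier D \<Longrightarrow> dist p w \<le> \<delta> \<Longrightarrow> \<bar>f w - f p\<bar> < e / 2"
    using f_near[OF p, of "e / 2"] e by auto
  obtain \<phi> m where \<phi>: "q_psh r D (\<lambda>z. ereal (\<phi> z))" "continuous_on (closure D) \<phi>" "\<phi> p = 0"
    "\<And>z. z \<in> closure D \<Longrightarrow> \<phi> z \<le> 0" "m > 0" "\<And>z. z \<in> closure D \<Longrightarrow> dist p z = \<delta> \<Longrightarrow> \<phi> z \<le> - m"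
    by (rule peak_function[OF p \<delta>(1)]) blast
  \<comment> \<open>On the sphere \<open>K * \<phi> \<le> - (M + 1)\<close>, so
    \<open>\<psi> + K * \<phi>\<close> is negative there for every subsolution
    \<open>\<psi>\<close>.\<close>
  define K where "K = (M + 1) / m"
  have K: "K > 0" "K * m = M + 1" using M0 \<phi>(5) by (auto simp: K_def)
  define c where "c = f p + e / 2"
  have c: "c > 0" using f0[OF p] e by (simp add: c_def)
  define W where "W = D \<inter> ball p \<delta>"
  have W: "open W" "bounded W" "W \<subseteq> D"
    using D by (auto simp: W_def intro: bounded_subset[OF bounded_ball])
  have Wc: "W \<subseteq> closure D" using W(3) closure_subset by blast
  have main: "\<psi> z \<le> c - K * \<phi> z" if \<psi>: "\<psi> \<in> subsolutions" and z: "z \<in> W" for \<psi> z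
  proof -
    have "q_psh (q + r) D (\<lambda>w. ereal (\<psi> w + K * \<phi> w))"
      by (rule q_psh_add[OF subsolutionsD(1)[OF \<psi>] q_psh_cmult[OF \<phi>(1) K(1)] qr])
    then have "q_psh (q + r) W (\<lambda>w. ereal (\<psi> w + K * \<phi> w))"
      by (rule q_psh_subset[OF _ W(1,3)])
    then have "\<psi> z + K * \<phi> z \<le> c"
    proof (rule q_psh_maximum_principle[OF _ W(2) _ z])
      fix x :: "complex^'n" and e' :: real assume x: "x \<in> frontier W" and e': "e' > 0"
      have xW: "x \<in> closure W" "x \<notin> W" using x W(1) by (auto simp: frontier_def interior_open)
      have xD: "x \<in> closure D" using xW(1) closure_mono[OF W(3)] by blast
      have "closure W \<subseteq> cball p \<delta>" by (rule closure_minimal) (auto simp: W_def)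
      then have xb: "dist p x \<le> \<delta>" using xW(1) by auto
      have "\<psi> x + K * \<phi> x \<le> c"
      proof (cases "x \<in> D")
        case True
        then have "dist p x = \<delta>" using xW(2) xb by (simp add: W_def)
        then have "K * \<phi> x \<le> K * (- m)" using \<phi>(6)[OF xD] K(1) by (intro mult_left_mono) auto
        then show ?thesis using subsolutionsD(5)[OF \<psi> xD] K(2) c by simp
      next
        case False
        then have xf: "x \<in> frontier D" using closure_cases[OF xD] by blast
        have "\<psi> x \<le> f x" by (rule subsolutionsD(3)[OF \<psi> xf])
        also have "\<dots> \<le> c" using \<delta>(2)[OF xf xb] unfolding c_def by linarith
        finally show ?thesis using \<phi>(4)[OF xD] K(1) by (simp add: add_decreasing2 mult_nonneg_nonpos)
      qed
      moreover have "usc_on (closure D) (\<lambda>w. ereal (\<psi> w + K * \<phi> w))"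
        by (intro usc_on_add_continuous subsolutionsD(2)[OF \<psi>] continuous_intros \<phi>(2))
      ultimately have "\<forall>\<^sub>F w in inf (nhds x) (principal (closure D)). \<psi> w + K * \<phi> w < c + e'"
      proof -
        assume le: "\<psi> x + K * \<phi> x \<le> c" and usc: "usc_on (closure D) (\<lambda>w. ereal (\<psi> w + K * \<phi> w))"
        have "\<psi> x + K * \<phi> x < c + e'" using le e' by linarith
        then show ?thesis using usc xD unfolding usc_on_real_iff by blast
      qed
      then show "\<forall>\<^sub>F w in inf (nhds x) (principal W). \<psi> w + K * \<phi> w < c + e'"
        by (rule eventually_nhds_within_subset[OF _ Wc])
    qed
    then show ?thesis by simp
  qed
  have "((\<lambda>z. c - K * \<phi> z) \<longlongrightarrow> c - K * \<phi> p) (inf (nhds p) (principal (closure D)))"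
    by (intro tendsto_intros continuous_on_imp_tendsto_nhds \<phi>(2) frontier_sub p)
  then have "\<forall>\<^sub>F z in inf (nhds p) (principal (closure D)). c - K * \<phi> z < f p + e"
    by (rule order_tendstoD(2)) (use e in \<open>simp add: \<phi>(3) c_def\<close>)
  moreover have "\<forall>\<^sub>F z in inf (nhds p) (principal (closure D)). z \<in> ball p \<delta>"
    by (rule eventually_nhds_within_openI) (use \<delta> in auto)
  moreover have "\<forall>\<^sub>F z in inf (nhds p) (principal (closure D)). z \<in> closure D"
    by (simp add: eventually_inf_principal)
  ultimately show ?thesis
  proof eventually_elim
    case (elim z)
    show ?case
    proof
      fix \<psi> assume \<psi>: "\<psi> \<in> subsolutions"
      show "\<psi> z \<le> f p + e"
      proof (cases "z \<in> D")
        case True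
        then show ?thesis using main[OF \<psi>, of z] elim(1,2) by (simp add: W_def)
      next
        case False
        then have zf: "z \<in> frontier D" using closure_cases[OF elim(3)] by blast
        then have "\<bar>f z - f p\<bar> < e / 2" using \<delta>(2)[OF zf] elim(2) by simp
        then show ?thesis using subsolutionsD(3)[OF \<psi> zf] e by linarith
      qed
    qed
  qed
qed

lemma lower_barrier:
  assumes p: "p \<in> frontier D" and e: "e > 0"
  shows "\<forall>\<^sub>F z in inf (nhds p) (principal (closure D)). f p - e < envelope z"
proof -
  obtain \<delta> where \<delta>: "\<delta> > 0" "\<And>w. w \<in> frontier D \<Longrightarrow> dist p w \<le> \<delta> \<Longrightarrow> \<bar>f w - f p\<bar> < e / 2"
    using f_near[OF p, of "e / 2"] e by auto
  obtain \<phi> m where \<phi>: "q_psh r D (\<lambda>z. ereal (\<phi> z))" "continuous_on (closure D) \<phi>" "\<phi> p = 0"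
    "\<And>z. z \<in> closure D \<Longrightarrow> \<phi> z \<le> 0" "m > 0" "\<And>z. z \<in> closure D \<Longrightarrow> dist p z = \<delta> \<Longrightarrow> \<phi> z \<le> - m"
    by (rule peak_function[OF p \<delta>(1)]) blast
  define K where "K = (M + 1) / m"
  have K: "K > 0" "K * m = M + 1" using M0 \<phi>(5) by (auto simp: K_def)
  \<comment> \<open>The peak is placed at height \<open>f p - e / 2\<close>: low enough to stay
    below \<open>f\<close> within distance \<open>\<delta>\<close>, and, since
    \<open>K * m = M + 1\<close>, negative on the sphere, where the constant \<open>0\<close> takes
    over.\<close>
  define s where "s z = (f p - e / 2) + K * \<phi> z" for z
  have s_le: "s z \<le> f p - e / 2" if "z \<in> closure D" for z
    using \<phi>(4)[OF that] K(1) by (simp add: s_def mult_nonneg_nonpos)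
  have s_sph: "s z < 0" if z: "z \<in> closure D" "dist p z = \<delta>" for z
  proof -
    have "K * \<phi> z \<le> K * (- m)" using \<phi>(6)[OF z] K(1) by (intro mult_left_mono) auto
    then show ?thesis using K(2) fM[OF p] e by (simp add: s_def)
  qed
  have conts: "continuous_on (closure D) s"
    unfolding s_def by (intro continuous_intros \<phi>(2))
  define W where "W = D \<inter> ball p \<delta>"
  have W: "open W" "W \<subseteq> D" using D by (auto simp: W_def)
  have Wc: "W \<subseteq> closure D" using W(2) closure_subset by blast
  have "q_psh (0 + q) D (\<lambda>z. ereal (s z))"
    unfolding s_def
    by (rule q_psh_add[OF q_psh_const[OF D] q_psh_cmult[OF q_psh_mono[OF \<phi>(1) rq q_less] K(1)]])
      (use q_less in auto)
  then have s_psh: "q_psh q W (\<lambda>z. ereal (s z))"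
    using q_psh_subset[OF _ W] by simp
  \<comment> \<open>Cutting with the ball instead of \<open>W\<close> defines \<open>b\<close>
    suitably on the frontier of \<open>D\<close> too, where semicontinuity and
    \<open>b \<le> f\<close> have to hold.\<close>
  define b where "b z = (if z \<in> ball p \<delta> then max 0 (s z) else 0)" for z
  have "b \<in> subsolutions"
    unfolding subsolutions_def
  proof (intro CollectI conjI ballI)
    have "q_psh q D (\<lambda>z. ereal (if z \<in> W then max 0 (s z) else 0))"
    proof (rule q_psh_glue[OF q_psh_const[OF D q_less] s_psh W(2)])
      fix x assume x: "x \<in> D - W"
      show "\<forall>\<^sub>F w in inf (nhds x) (principal W). s w \<le> 0"
      proof (cases "dist p x = \<delta>")
        case True
        have "\<forall>\<^sub>F w in inf (nhds x) (principal (closure D)). s w < 0"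
          by (rule order_tendstoD(2)[OF continuous_on_imp_tendsto_nhds[OF conts] s_sph]) (use x D_sub True in auto)
        from eventually_nhds_within_subset[OF this Wc] show ?thesis
          by (rule eventually_mono) simp
      next
        case False
        then have "x \<in> - cball p \<delta>" using x by (auto simp: W_def)
        then have "\<forall>\<^sub>F w in inf (nhds x) (principal W). w \<in> - cball p \<delta>"
          by (intro eventually_nhds_within_openI) auto
        moreover have "\<forall>\<^sub>F w in inf (nhds x) (principal W). w \<in> W" by (simp add: eventually_inf_principal)
        ultimately show ?thesis by eventually_elim (auto simp: W_def)
      qed
    qed
    then show "q_psh q D (\<lambda>z. ereal (b z))"
      by (rule q_psh_cong[THEN iffD1, rotated]) (auto simp: b_def W_def)
    have "continuous_on ((closure D \<inter> cball p \<delta>) \<union> (closure D - ball p \<delta>)) b"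
      unfolding b_def
    proof (rule continuous_on_If)
      show "closed (closure D - ball p \<delta>)" by (simp add: closed_Diff)
      show "continuous_on (closure D \<inter> cball p \<delta>) (\<lambda>z. max 0 (s z))"
        by (intro continuous_intros continuous_on_subset[OF conts]) auto
      show "max 0 (s x) = 0" if "x \<in> closure D \<inter> cball p \<delta>" "x \<notin> ball p \<delta>" for x
        using s_sph[of x] that by auto
    qed auto
    moreover have "(closure D \<inter> cball p \<delta>) \<union> (closure D - ball p \<delta>) = closure D" by auto
    ultimately show "usc_on (closure D) (\<lambda>z. ereal (b z))"
      by (intro continuous_on_imp_usc_on) simp
    show "b z \<le> f z" if z: "z \<in> frontier D" for z
    proof (cases "z \<in> ball p \<delta>")
      case True
      then have "\<bar>f z - f p\<bar> < e / 2" using \<delta>(2)[OF z] by simp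
      then have "s z \<le> f z" using s_le[OF frontier_sub[OF z]] by linarith
      then show ?thesis using f0[OF z] by (simp add: b_def)
    qed (use f0[OF z] in \<open>simp add: b_def\<close>)
    show "0 \<le> b z" for z by (simp add: b_def)
    show "b z \<le> M" if "z \<in> closure D" for z
      using s_le[OF that] fM[OF p] M0 e by (auto simp: b_def)
  qed
  note b_le = envelope_upper[OF this]
  have "\<forall>\<^sub>F z in inf (nhds p) (principal (closure D)). f p - e < s z"
    by (rule order_tendstoD(1)[OF continuous_on_imp_tendsto_nhds[OF conts frontier_sub[OF p]]])
      (use e \<phi>(3) in \<open>simp add: s_def\<close>)
  moreover have "\<forall>\<^sub>F z in inf (nhds p) (principal (closure D)). z \<in> ball p \<delta>"
    by (rule eventually_nhds_within_openI) (use \<delta> in auto)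
  moreover have "\<forall>\<^sub>F z in inf (nhds p) (principal (closure D)). z \<in> closure D"
    by (simp add: eventually_inf_principal)
  ultimately show ?thesis
    by eventually_elim (use b_le in \<open>fastforce simp: b_def\<close>)
qed

section \<open>Boundary values and maximality of the envelope\<close>

lemma envelope_upper_near:
  assumes "p \<in> frontier D" "e > 0"
  shows "\<forall>\<^sub>F z in inf (nhds p) (principal (closure D)). envelope z \<le> f p + e"
  using upper_barrier[OF assms] by (rule eventually_mono) (auto intro: envelope_least)

lemma envelope_frontier:
  assumes p: "p \<in> frontier D"
  shows "envelope p = f p"
proof (rule antisym)
  show "envelope p \<le> f p"
    by (rule envelope_least) (rule subsolutionsD(3)[OF _ p])
  show "f p \<le> envelope p"
  proof (rule field_le_epsilon)
    fix e :: real assume "e > 0"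
    from eventually_nhds_within_self[OF frontier_sub[OF p] lower_barrier[OF p this]]
    show "f p \<le> envelope p + e" by simp
  qed
qed

lemma envelope_tendsto_frontier:
  assumes p: "p \<in> frontier D"
  shows "(envelope \<longlongrightarrow> envelope p) (inf (nhds p) (principal (closure D)))"
proof (rule order_tendstoI)
  fix a assume "a < envelope p"
  then show "\<forall>\<^sub>F z in inf (nhds p) (principal (closure D)). a < envelope z"
    using lower_barrier[OF p, of "f p - a"] envelope_frontier[OF p] by simp
next
  fix a assume a: "envelope p < a"
  then obtain a' where a': "envelope p < a'" "a' < a" using dense by blast
  then show "\<forall>\<^sub>F z in inf (nhds p) (principal (closure D)). envelope z < a"
    using envelope_upper_near[OF p, of "a' - f p"] envelope_frontier[OF p]
    by (auto elim!: eventually_mono)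
qed

text \<open>
  Perron's argument: the upper regularization of the envelope is again a subsolution, hence equal to it.
\<close>

lemma envelope_subsolution: "envelope \<in> subsolutions"
  and usc_reg_envelope: "z \<in> closure D \<Longrightarrow> usc_reg (closure D) envelope z = ereal (envelope z)"
proof -
  obtain U where U: "\<And>z. z \<in> closure D \<Longrightarrow> usc_reg (closure D) envelope z = ereal (U z)"
    "\<And>z. z \<in> closure D \<Longrightarrow> envelope z \<le> U z" "\<And>z. z \<in> closure D \<Longrightarrow> U z \<le> M"
    "usc_on (closure D) (\<lambda>z. ereal (U z))"
    "\<And>z c. z \<in> closure D \<Longrightarrow> \<forall>\<^sub>F w in inf (nhds z) (principal (closure D)). envelope w \<le> c \<Longrightarrow> U z \<le> c"
    by (rule usc_reg_bounded[of "closure D" 0 envelope M]) (use envelope_bounds in \<open>blast+\<close>)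
  have "U \<in> subsolutions"
    unfolding subsolutions_def
  proof (intro CollectI conjI ballI)
    show "q_psh q D (\<lambda>z. ereal (U z))"
    proof (rule q_psh_upper_envelope[OF D q_less, where F = subsolutions])
      show "q_psh q D (\<lambda>z. ereal (\<psi> z))" if "\<psi> \<in> subsolutions" for \<psi> by (rule subsolutionsD(1)[OF that])
      show "usc_on D (\<lambda>z. ereal (U z))" by (rule usc_on_subset[OF U(4) closure_subset])
      show "\<psi> z \<le> U z" if "\<psi> \<in> subsolutions" "z \<in> D" for \<psi> z
        using envelope_upper[OF that(1) D_sub[OF that(2)]] U(2)[OF D_sub[OF that(2)]] by simp
      fix z and e :: real assume z: "z \<in> D" and e: "e > 0"
      \<comment> \<open>If near \<open>z\<close> all subsolutions stayed below
        \<open>U z - e\<close>, so would the envelope, and its regularization could not reach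
        \<open>U z\<close>.\<close>
      show "\<exists>\<^sub>F w in nhds z. \<exists>\<psi>\<in>subsolutions. U z - e < \<psi> w"
        unfolding frequently_def
      proof
        assume "\<forall>\<^sub>F w in nhds z. \<not> (\<exists>\<psi>\<in>subsolutions. U z - e < \<psi> w)"
        then have "\<forall>\<^sub>F w in nhds z. envelope w \<le> U z - e"
          by (rule eventually_mono) (auto intro!: envelope_least simp: not_less)
        then have "U z \<le> U z - e"
          by (intro U(5)[OF D_sub[OF z]]) (auto simp: eventually_inf_principal elim: eventually_mono)
        then show False using e by simp
      qed
    qed
    show "usc_on (closure D) (\<lambda>z. ereal (U z))" by (rule U(4))
    show "U z \<le> f z" if z: "z \<in> frontier D" for z
    proof (rule field_le_epsilon)
      fix e :: real assume "e > 0"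
      show "U z \<le> f z + e" by (rule U(5)[OF frontier_sub[OF z] envelope_upper_near[OF z \<open>e > 0\<close>]])
    qed
    fix z assume z: "z \<in> closure D"
    show "0 \<le> U z" using U(2)[OF z] envelope_bounds(1)[OF z] by simp
    show "U z \<le> M" by (rule U(3)[OF z])
  qed
  then have eq: "U z = envelope z" if "z \<in> closure D" for z
    using envelope_upper[of U z] U(2)[OF that] that by simp
  then show "usc_reg (closure D) envelope z = ereal (envelope z)" if "z \<in> closure D"
    using U(1)[OF that] that by simp
  have "q_psh q D (\<lambda>z. ereal (envelope z))"
    using subsolutionsD(1)[OF \<open>U \<in> subsolutions\<close>] by (rule q_psh_cong[THEN iffD1, rotated]) (simp add: eq D_sub)
  moreover have "usc_on (closure D) (\<lambda>z. ereal (envelope z))"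
    using U(4) by (rule usc_on_cong[THEN iffD1, rotated]) (simp add: eq)
  ultimately show "envelope \<in> subsolutions"
    using envelope_bounds envelope_frontier by (auto simp: subsolutions_def)
qed

text \<open>The positive part of \<open>\<psi>\<close> is a subsolution, because both
  \<open>f\<close> and \<open>M\<close> are nonnegative.\<close>

lemma envelope_maximal:
  assumes psh: "q_psh q D \<psi>" and usc: "usc_on (closure D) \<psi>" and le: "\<And>z. z \<in> frontier D \<Longrightarrow> \<psi> z \<le> ereal (f z)"
    and leM: "\<And>z. z \<in> closure D \<Longrightarrow> \<psi> z \<le> ereal M" and z: "z \<in> closure D"
  shows "\<psi> z \<le> ereal (envelope z)"
proof -
  define \<phi> where "\<phi> z = real_of_ereal (max (\<psi> z) 0)" for z
  have eq: "ereal (\<phi> z) = max (\<psi> z) 0" if "z \<in> closure D" for z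
    using leM[OF that] unfolding \<phi>_def by (cases "\<psi> z") (auto simp: max_def zero_ereal_def)
  have "\<phi> \<in> subsolutions"
    unfolding subsolutions_def
  proof (intro CollectI conjI ballI)
    show "q_psh q D (\<lambda>z. ereal (\<phi> z))" unfolding \<phi>_def by (rule q_psh_max_0[OF psh])
    have "usc_on (closure D) (\<lambda>z. max (\<psi> z) 0)"
      by (rule usc_on_max_0[OF usc])
    then show "usc_on (closure D) (\<lambda>z. ereal (\<phi> z))"
      by (rule usc_on_cong[THEN iffD1, rotated]) (simp add: eq)
    show "\<phi> z \<le> f z" if "z \<in> frontier D" for z
      using eq[OF frontier_sub[OF that]] le[OF that] f0[OF that]
      by (metis ereal_less_eq(3) ereal_less_eq(5) max.bounded_iff)
    show "0 \<le> \<phi> z" if "z \<in> closure D" for z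
      using eq[OF that] by (metis ereal_less_eq(5) max.cobounded2)
    show "\<phi> z \<le> M" if "z \<in> closure D" for z
      using eq[OF that] leM[OF that] M0 by (metis ereal_less_eq(3) ereal_less_eq(5) max.bounded_iff)
  qed
  from envelope_upper[OF this z] have "max (\<psi> z) 0 \<le> ereal (envelope z)"
    using eq[OF z] by (metis ereal_less_eq(3))
  then show ?thesis by simp
qed

text \<open>
  Bumping: if \<open>N\<close> failed to be \<open>(n - q - 1)\<close>-plurisubharmonic, a quadratic function could be used
  to lift the envelope near a point.
\<close>

lemma uminus_lsc_reg_envelope:
  obtains N where "\<And>z. z \<in> closure D \<Longrightarrow> - lsc_reg (closure D) envelope z = ereal (N z)"
    "\<And>z. z \<in> closure D \<Longrightarrow> - envelope z \<le> N z" "\<And>z. z \<in> closure D \<Longrightarrow> N z \<le> 0"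
    "\<And>z c. z \<in> closure D \<Longrightarrow> \<forall>\<^sub>F w in inf (nhds z) (principal (closure D)). - envelope w \<le> c \<Longrightarrow> N z \<le> c"
    "q_psh (CARD('n) - q - 1) D (\<lambda>z. ereal (N z))"
proof -
  obtain N where N: "\<And>z. z \<in> closure D \<Longrightarrow> usc_reg (closure D) (\<lambda>z. - envelope z) z = ereal (N z)"
    "\<And>z. z \<in> closure D \<Longrightarrow> - envelope z \<le> N z" "\<And>z. z \<in> closure D \<Longrightarrow> N z \<le> 0"
    "usc_on (closure D) (\<lambda>z. ereal (N z))"
    "\<And>z c. z \<in> closure D \<Longrightarrow> \<forall>\<^sub>F w in inf (nhds z) (principal (closure D)). - envelope w \<le> c \<Longrightarrow> N z \<le> c"
  proof (rule usc_reg_bounded[of "closure D" "- M" "\<lambda>z. - envelope z" 0])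
    show "- M \<le> - envelope z" "- envelope z \<le> 0" if "z \<in> closure D" for z
      using envelope_bounds[OF that] by auto
  qed blast
  have uscN: "usc_on D (\<lambda>z. ereal (N z))" by (rule usc_on_subset[OF N(4) closure_subset])
  have "q_psh (CARD('n) - q - 1) D (\<lambda>z. ereal (N z))"
  proof (rule q_pshI_real[OF D _ uscN])
    show "CARD('n) - q - 1 < CARD('n)" using q_less by simp
    fix z p A \<delta> and V :: "(complex^'n) set"
    assume z: "z \<in> D" and V: "vec.subspace V" "vec.dim V = CARD('n) - q - 1 + 1" and A: "levi_neg A V"
      and \<delta>: "0 < (\<delta> :: real)" and touch: "\<And>v. v \<in> V \<Longrightarrow> norm v < \<delta> \<Longrightarrow> N (z + v) \<le> N z + p \<bullet> v + v \<bullet> A v"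
    obtain \<rho>0 where \<rho>0: "\<rho>0 > 0" "cball z \<rho>0 \<subseteq> D" using D z open_contains_cball by metis
    obtain A' \<rho> \<kappa> where \<rho>: "0 < \<rho>" "\<rho> \<le> \<rho>0" and \<kappa>: "\<kappa> > 0" and A': "levi_neg A' V"
      and sph: "\<And>v. norm v = \<rho> \<Longrightarrow> N (z + v) \<le> N z + p \<bullet> v + v \<bullet> A' v - \<kappa>"
      using penalize_normal_directions[OF usc_on_subset[OF uscN \<rho>0(2)] \<rho>0(1) V(1) A \<delta> touch] by metis
    note linA' = levi_negD(1)[OF A']
    define W where "W = ball z \<rho>"
    have cW: "cball z \<rho> \<subseteq> D" using \<rho> \<rho>0 by auto
    then have W: "open W" "bounded W" "W \<subseteq> D" "z \<in> W" using \<rho>(1) by (auto simp: W_def)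
    \<comment> \<open>The negated test function, raised by \<open>\<kappa> / 2\<close>. Its Levi
      form is nonnegative on \<open>V\<close>, whose dimension \<open>n - q\<close> is what
      \<open>q_psh_quadratic\<close> asks for index \<open>q\<close>. On the sphere it still lies
      below \<open>- N\<close> by at least \<open>\<kappa> / 2\<close>.\<close>
    define s where "s x = (- N z + \<kappa> / 2) + (- p) \<bullet> (x - z) + (x - z) \<bullet> (- A' (x - z))" for x
    have s_psh: "q_psh q W (\<lambda>x. ereal (s x))"
      unfolding s_def
    proof (rule q_psh_quadratic[OF W(1) q_less _ V(1)])
      show "linear (\<lambda>v. - A' v)" using linA' by (rule linear_compose_neg)
      show "CARD('n) \<le> q + vec.dim V" using V(2) q_less by simp
      show "0 \<le> levi (\<lambda>v. - A' v) v" if "v \<in> V" for v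
        using levi_negD(2)[OF A' that] by (cases "v = 0") (auto simp: levi_def linear_0[OF linA'])
    qed
    have conts: "continuous_on UNIV s"
    proof -
      have cA: "continuous_on UNIV A'"
        by (rule linear_imp_continuous_on[OF linA'])
      then show ?thesis
        unfolding s_def by (intro continuous_intros continuous_on_compose2[OF cA]) auto
    qed
    have s_lim: "(s \<longlongrightarrow> s x) (nhds x)" for x
      using continuous_on_imp_tendsto_nhds[OF conts, of x] by simp
    have s_sph: "s x < - N x" if x: "dist z x = \<rho>" for x
      using sph[of "x - z"] x \<kappa> by (simp add: s_def dist_norm norm_minus_commute)
    \<comment> \<open>\<open>- N\<close> is the lower regularization of the envelope, so a strict
      inequality with \<open>- N\<close> at one point gives an inequality with the envelope in a
      whole neighbourhood, as gluing requires.\<close>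
    have s_env: "\<forall>\<^sub>F w in nhds x. s w \<le> envelope w" if x: "dist z x = \<rho>" for x
    proof -
      have xD: "x \<in> D" using cW x by auto
      obtain c where c: "s x < c" "c < - N x" using dense[OF s_sph[OF x]] by blast
      have "\<forall>\<^sub>F w in inf (nhds x) (principal D). N w < - c"
        using uscN xD c(2) unfolding usc_on_real_iff by simp
      moreover have "\<forall>\<^sub>F w in nhds x. w \<in> D" by (rule eventually_nhds_in_open[OF D xD])
      ultimately have "\<forall>\<^sub>F w in nhds x. c < envelope w"
        unfolding eventually_inf_principal by eventually_elim (use N(2) D_sub in force)
      with order_tendstoD(2)[OF s_lim c(1)] show ?thesis
        by eventually_elim simp
    qed
    \<comment> \<open>So far \<open>s\<close> is controlled only on the sphere. The maximum
      principle keeps it below \<open>M\<close> inside, so that the lifted function is a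
      subsolution.\<close>
    have sM: "s x \<le> M" if x: "x \<in> W" for x
    proof (rule q_psh_maximum_principle[OF s_psh W(2) _ x])
      fix y :: "complex^'n" and e :: real assume y: "y \<in> frontier W" and e: "e > 0"
      then have dy: "dist z y = \<rho>" using \<rho>(1) by (simp add: W_def frontier_ball)
      have yD: "y \<in> closure D" using cW dy D_sub by auto
      have "s y < M + e" using s_sph[OF dy] N(2)[OF yD] envelope_bounds(2)[OF yD] e
        using eventually_nhds_x_imp_x[OF s_env[OF dy]] by simp
      from order_tendstoD(2)[OF s_lim this]
      show "\<forall>\<^sub>F w in inf (nhds y) (principal W). s w < M + e"
        by (auto simp: eventually_inf_principal elim: eventually_mono)
    qed
    define g where "g x = (if x \<in> W then max (envelope x) (s x) else envelope x)" for x
    have g_psh: "q_psh q D (\<lambda>x. ereal (g x))"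
      unfolding g_def
    proof (rule q_psh_glue[OF subsolutionsD(1)[OF envelope_subsolution] s_psh W(3)])
      fix x assume x: "x \<in> D - W"
      show "\<forall>\<^sub>F w in inf (nhds x) (principal W). s w \<le> envelope w"
      proof (cases "dist z x = \<rho>")
        case True
        then show ?thesis using s_env[OF True] by (auto simp: eventually_inf_principal elim: eventually_mono)
      next
        case False
        then have "x \<in> - cball z \<rho>" using x by (auto simp: W_def)
        then have "\<forall>\<^sub>F w in nhds x. w \<in> - cball z \<rho>" by (intro eventually_nhds_in_open) auto
        then show ?thesis
          unfolding eventually_inf_principal by (rule eventually_mono) (auto simp: W_def)
      qed
    qed
    have "g \<in> subsolutions"
      unfolding subsolutions_def
    proof (intro CollectI conjI ballI g_psh)
      show "usc_on (closure D) (\<lambda>x. ereal (g x))"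
        unfolding usc_on_real_iff
      proof (intro ballI allI impI)
        fix x c assume x: "x \<in> closure D" "g x < c"
        show "\<forall>\<^sub>F w in inf (nhds x) (principal (closure D)). g w < c"
        proof (cases "x \<in> D")
          case True
          then have "\<forall>\<^sub>F w in inf (nhds x) (principal D). g w < c"
            using q_pshD_usc[OF g_psh] x(2) unfolding usc_on_real_iff by blast
          moreover have "\<forall>\<^sub>F w in nhds x. w \<in> D" by (rule eventually_nhds_in_open[OF D True])
          ultimately have "\<forall>\<^sub>F w in nhds x. g w < c"
            unfolding eventually_inf_principal by eventually_elim simp
          then show ?thesis by (auto simp: eventually_inf_principal elim: eventually_mono)
        next
          case False
          then have "x \<in> - cball z \<rho>" using cW by blast
          then have "\<forall>\<^sub>F w in inf (nhds x) (principal (closure D)). w \<in> - cball z \<rho>"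
            by (intro eventually_nhds_within_openI) auto
          moreover have "envelope x < c" using x(2) False W(3) by (auto simp: g_def split: if_splits)
          then have "\<forall>\<^sub>F w in inf (nhds x) (principal (closure D)). envelope w < c"
            using subsolutionsD(2)[OF envelope_subsolution] x(1) unfolding usc_on_real_iff by blast
          ultimately show ?thesis by eventually_elim (auto simp: g_def W_def)
        qed
      qed
      show "g x \<le> f x" if "x \<in> frontier D" for x
        using frontier_notin[OF that] W(3) envelope_frontier[OF that] by (auto simp: g_def)
      fix x assume x: "x \<in> closure D"
      show "0 \<le> g x" using envelope_bounds(1)[OF x] by (auto simp: g_def)
      show "g x \<le> M" using envelope_bounds(2)[OF x] sM[of x] by (auto simp: g_def)
    qed
    then have s_le: "s x \<le> envelope x" if "x \<in> W" for x
      using envelope_upper[of g x] that W(3) D_sub by (fastforce simp: g_def)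
    \<comment> \<open>By maximality the envelope dominates \<open>s\<close> near \<open>z\<close>,
      but \<open>s z\<close> exceeds the lower regularization \<open>- N z\<close> by
      \<open>\<kappa> / 2\<close>.\<close>
    have "s z = - N z + \<kappa> / 2" by (simp add: s_def linear_0[OF linA'])
    then have "\<forall>\<^sub>F w in nhds z. - N z + \<kappa> / 4 < s w" using \<kappa> by (intro order_tendstoD(1)[OF s_lim]) simp
    moreover have "\<forall>\<^sub>F w in nhds z. w \<in> W" by (rule eventually_nhds_in_open[OF W(1,4)])
    ultimately have "\<forall>\<^sub>F w in nhds z. - envelope w \<le> N z - \<kappa> / 4"
      by eventually_elim (use s_le in force)
    then have "N z \<le> N z - \<kappa> / 4"
      by (intro N(5)[OF D_sub[OF z]]) (auto simp: eventually_inf_principal elim: eventually_mono)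
    then show False using \<kappa> by simp
  qed
  then show thesis
    using that[of N] N by (simp add: lsc_reg_eq_uminus_usc_reg)
qed

section \<open>Bremermann properties, continuity and uniqueness of the envelope\<close>

lemma almost_bremermann_envelope: "almost_bremermann_closure q D envelope"
proof -
  obtain N where N: "\<And>z. z \<in> closure D \<Longrightarrow> - lsc_reg (closure D) envelope z = ereal (N z)"
    "q_psh (CARD('n) - q - 1) D (\<lambda>z. ereal (N z))"
    by (rule uminus_lsc_reg_envelope) blast
  have "q_psh q D (usc_reg (closure D) envelope)"
    using subsolutionsD(1)[OF envelope_subsolution]
    by (rule q_psh_cong[THEN iffD1, rotated]) (simp add: usc_reg_envelope D_sub)
  moreover have "q_psh (CARD('n) - q - 1) D (\<lambda>z. - lsc_reg (closure D) envelope z)"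
    using N(2) by (rule q_psh_cong[THEN iffD1, rotated]) (simp add: N(1) D_sub)
  ultimately show ?thesis
    using q_less by (simp add: almost_bremermann_closure_def)
qed

lemma perron_le_envelope:
  assumes z: "z \<in> closure D" and M': "M' \<le> ereal M"
  shows "perron_bremermann f q D M' z \<le> ereal (envelope z)"
  unfolding perron_bremermann_def
proof (rule SUP_least)
  fix \<psi> :: "complex^'n \<Rightarrow> real"
  assume "\<psi> \<in> {\<psi>. q_psh q D (\<lambda>w. ereal (\<psi> w)) \<and> continuous_on (closure D) \<psi> \<and>
     (\<forall>w\<in>frontier D. \<psi> w \<le> f w) \<and> (\<forall>w\<in>closure D. ereal (\<psi> w) \<le> M')}"
  moreover from this have "ereal (\<psi> w) \<le> ereal M" if "w \<in> closure D" for w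
    using M' that by (auto intro: order_trans simp del: ereal_less_eq)
  ultimately show "ereal (\<psi> z) \<le> ereal (envelope z)"
    by (intro envelope_maximal[OF _ continuous_on_imp_usc_on _ _ z]) auto
qed

text \<open>The upper and the lower regularization agree: \<open>envelope + N\<close> has index
  \<open>n - 1\<close> and upper limits at most \<open>0\<close> at the frontier, so it is at most
  \<open>0\<close>, while \<open>N \<ge> - envelope\<close> always.\<close>

lemma envelope_continuous:
  assumes bt: "bounded_type D"
  shows "continuous_on (closure D) envelope" "q_psh (CARD('n) - q - 1) D (\<lambda>z. ereal (- envelope z))"
proof -
  obtain N where N: "\<And>z. z \<in> closure D \<Longrightarrow> - envelope z \<le> N z" "\<And>z. z \<in> closure D \<Longrightarrow> N z \<le> 0"
    "\<And>z c. z \<in> closure D \<Longrightarrow> \<forall>\<^sub>F w in inf (nhds z) (principal (closure D)). - envelope w \<le> c \<Longrightarrow> N z \<le> c"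
    "q_psh (CARD('n) - q - 1) D (\<lambda>z. ereal (N z))"
    by (rule uminus_lsc_reg_envelope) blast
  have sum: "q_psh (q + (CARD('n) - q - 1)) D (\<lambda>z. ereal (envelope z + N z))"
    by (rule q_psh_add[OF subsolutionsD(1)[OF envelope_subsolution] N(4)]) (use q_less in simp)
  have "envelope z + N z \<le> 0" if z: "z \<in> D" for z
  proof (rule bounded_type_maximum_principle[OF bt sum _ _ z])
    show "envelope z + N z \<le> M" if "z \<in> D" for z
      using envelope_bounds(2)[OF D_sub[OF that]] N(2)[OF D_sub[OF that]] by simp
    fix p :: "complex^'n" and e :: real assume p: "p \<in> frontier D" and e: "e > 0"
    have "\<forall>\<^sub>F w in inf (nhds p) (principal (closure D)). - envelope w \<le> - f p + e / 4"
      using lower_barrier[OF p, of "e / 4"] e by (auto elim: eventually_mono)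
    \<comment> \<open>\<open>N w\<close> is controlled by values of the envelope near
      \<open>w\<close>, not only at \<open>w\<close>; hence the nested neighbourhoods.\<close>
    then have "\<forall>\<^sub>F w in inf (nhds p) (principal (closure D)).
        \<forall>\<^sub>F x in inf (nhds w) (principal (closure D)). - envelope x \<le> - f p + e / 4"
      by (rule eventually_eventually_nhds_within)
    moreover have "\<forall>\<^sub>F w in inf (nhds p) (principal (closure D)). envelope w \<le> f p + e / 4"
      by (rule envelope_upper_near[OF p]) (use e in simp)
    moreover have "\<forall>\<^sub>F w in inf (nhds p) (principal (closure D)). w \<in> closure D"
      by (simp add: eventually_inf_principal)
    ultimately have "\<forall>\<^sub>F w in inf (nhds p) (principal (closure D)). envelope w + N w < 0 + e"
    proof eventually_elim
      case (elim w)
      then show ?case using N(3)[OF elim(3,1)] e by simp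
    qed
    then show "\<forall>\<^sub>F w in inf (nhds p) (principal D). envelope w + N w < 0 + e"
      by (rule eventually_nhds_within_subset[OF _ closure_subset])
  qed
  then have eq: "N z = - envelope z" if "z \<in> D" for z
    using N(1)[OF D_sub[OF that]] that by fastforce
  show neg_psh: "q_psh (CARD('n) - q - 1) D (\<lambda>z. ereal (- envelope z))"
    using N(4) by (rule q_psh_cong[THEN iffD1, rotated]) (simp add: eq)
  show "continuous_on (closure D) envelope"
    unfolding continuous_on_def
  proof
    fix z assume z: "z \<in> closure D"
    have "(envelope \<longlongrightarrow> envelope z) (inf (nhds z) (principal (closure D)))"
    proof (cases "z \<in> D")
      case True
      show ?thesis
      proof (rule order_tendstoI)
        fix a assume "envelope z < a"
        then show "\<forall>\<^sub>F w in inf (nhds z) (principal (closure D)). envelope w < a"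
          using subsolutionsD(2)[OF envelope_subsolution] z unfolding usc_on_real_iff by blast
      next
        fix a assume "a < envelope z"
        then have "- envelope z < - a" by simp
        then have "\<forall>\<^sub>F w in inf (nhds z) (principal D). - envelope w < - a"
          using q_pshD_usc[OF neg_psh] True unfolding usc_on_real_iff by blast
        moreover have "\<forall>\<^sub>F w in nhds z. w \<in> D" by (rule eventually_nhds_in_open[OF D True])
        ultimately have "\<forall>\<^sub>F w in nhds z. a < envelope w"
          unfolding eventually_inf_principal by eventually_elim simp
        then show "\<forall>\<^sub>F w in inf (nhds z) (principal (closure D)). a < envelope w"
          by (auto simp: eventually_inf_principal elim: eventually_mono)
      qed
    next
      case False
      then show ?thesis using closure_cases[OF z] envelope_tendsto_frontier by blast
    qed
    then show "(envelope \<longlongrightarrow> envelope z) (at z within closure D)"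
      by (simp add: tendsto_at_within_iff_nhds[OF z])
  qed
qed

text \<open>On a domain of bounded type the envelope is continuous and does not exceed the supremum
  of \<open>f\<close>, so it is itself a competitor in the Perron-Bremermann supremum, however large
  \<open>M\<close> is.\<close>

lemma envelope_eq_perron:
  assumes bt: "bounded_type D" and z: "z \<in> closure D"
  shows "ereal (envelope z) = perron_bremermann f q D (SUP w\<in>frontier D. ereal (f w)) z"
proof (rule antisym)
  let ?M0 = "SUP w\<in>frontier D. ereal (f w)"
  have "?M0 \<le> ereal M" by (rule SUP_least) (simp add: fM)
  from perron_le_envelope[OF z this] show "perron_bremermann f q D ?M0 z \<le> ereal (envelope z)" .
  \<comment> \<open>With an empty frontier the boundary condition would be vacuous and the maximum
    principle would bound the constant \<open>0\<close> by \<open>- 1\<close>. Nonemptiness makes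
    the supremum of \<open>f\<close> a real number.\<close>
  have "frontier D \<noteq> {}"
  proof
    assume "frontier D = {}"
    moreover obtain w where "w \<in> D" using Dne by blast
    ultimately have "(0::real) \<le> - 1"
      using bounded_type_maximum_principle[OF bt q_psh_const[OF D q_less, of 0], of 0 "- 1" w] by simp
    then show False by simp
  qed
  then obtain p where p: "p \<in> frontier D" by blast
  have "ereal (f p) \<le> ?M0" by (rule SUP_upper[OF p])
  with \<open>?M0 \<le> ereal M\<close> obtain m where m: "?M0 = ereal m" by (cases ?M0) auto
  have fm: "f w \<le> m" if "w \<in> frontier D" for w
    using SUP_upper[OF that, of "\<lambda>w. ereal (f w)"] m by simp
  have "envelope w \<le> m" if w: "w \<in> D" for w
  proof (rule bounded_type_maximum_principle[OF bt subsolutionsD(1)[OF envelope_subsolution] _ _ w])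
    show "envelope z \<le> M" if "z \<in> D" for z using envelope_bounds(2)[OF D_sub[OF that]] .
    fix x :: "complex^'n" and e :: real assume x: "x \<in> frontier D" and e: "e > 0"
    have "\<forall>\<^sub>F w in inf (nhds x) (principal (closure D)). envelope w \<le> f x + e / 2"
      by (rule envelope_upper_near[OF x]) (use e in simp)
    then have "\<forall>\<^sub>F w in inf (nhds x) (principal (closure D)). envelope w < m + e"
      by (rule eventually_mono) (use fm[OF x] e in simp)
    then show "\<forall>\<^sub>F w in inf (nhds x) (principal D). envelope w < m + e"
      by (rule eventually_nhds_within_subset[OF _ closure_subset])
  qed
  then have "envelope w \<le> m" if "w \<in> closure D" for w
    using closure_cases[OF that] envelope_frontier fm by fastforce
  then show "ereal (envelope z) \<le> perron_bremermann f q D ?M0 z"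
    unfolding perron_bremermann_def m
    using subsolutionsD(1,3)[OF envelope_subsolution] envelope_continuous(1)[OF bt]
    by (intro SUP_upper) auto
qed

text \<open>Both differences of \<open>G\<close> and the envelope are sums of functions of the
  complementary indices \<open>q\<close> and \<open>n - q - 1\<close>, hence of index
  \<open>n - 1\<close>, and vanish on the frontier. \<open>bdG\<close> supplies the upper bounds
  that \<open>bounded_type_maximum_principle\<close> asks for.\<close>

lemma bremermann_unique:
  assumes bt: "bounded_type D" and G: "bremermann_closure q D G" and bdG: "bounded (G ` closure D)"
    and Gf: "\<And>z. z \<in> frontier D \<Longrightarrow> G z = f z" and z: "z \<in> closure D"
  shows "G z = envelope z"
proof -
  have contG: "continuous_on (closure D) G" using G by (simp add: bremermann_closure_def)
  have "q_psh q D (usc_reg (closure D) G)"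
    and "q_psh (CARD('n) - q - 1) D (\<lambda>z. - lsc_reg (closure D) G z)"
    using G by (auto simp: bremermann_closure_def almost_bremermann_closure_def)
  moreover have "continuous_on (closure D) (\<lambda>z. - G z)" by (intro continuous_intros contG)
  ultimately have psh: "q_psh q D (\<lambda>z. ereal (G z))" "q_psh (CARD('n) - q - 1) D (\<lambda>z. ereal (- G z))"
    using q_psh_cong[of D "usc_reg (closure D) G" "\<lambda>z. ereal (G z)"]
      q_psh_cong[of D "\<lambda>z. - lsc_reg (closure D) G z" "\<lambda>z. ereal (- G z)"]
    by (simp_all add: usc_reg_continuous contG D_sub lsc_reg_eq_uminus_usc_reg)
  obtain B where B: "\<And>z. z \<in> closure D \<Longrightarrow> \<bar>G z\<bar> \<le> B"
    using bdG by (auto simp: bounded_iff)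
  note contE = envelope_continuous(1)[OF bt]
  have boundary: "\<forall>\<^sub>F w in inf (nhds p) (principal D). h w < 0 + e"
    if h: "continuous_on (closure D) h" and p: "p \<in> frontier D" "h p = 0" and e: "e > 0" for h :: "complex^'n \<Rightarrow> real" and p e
  proof -
    have "\<forall>\<^sub>F w in inf (nhds p) (principal (closure D)). h w < 0 + e"
      by (rule order_tendstoD(2)[OF continuous_on_imp_tendsto_nhds[OF h frontier_sub[OF p(1)]]]) (use p e in simp)
    then show ?thesis by (rule eventually_nhds_within_subset[OF _ closure_subset])
  qed
  have lt: "q + (CARD('n) - q - 1) < CARD('n)" using q_less by simp
  have "G w + - envelope w \<le> 0" if w: "w \<in> D" for w
  proof (rule bounded_type_maximum_principle[OF bt q_psh_add[OF psh(1) envelope_continuous(2)[OF bt] lt] _ _ w])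
    show "G z + - envelope z \<le> B" if "z \<in> D" for z
      using B[OF D_sub[OF that]] envelope_bounds(1)[OF D_sub[OF that]] by simp
    show "\<forall>\<^sub>F w in inf (nhds p) (principal D). G w + - envelope w < 0 + e" if "p \<in> frontier D" "e > 0" for p e
      by (rule boundary[OF _ that(1) _ that(2)]) (auto intro!: continuous_intros contG contE simp: Gf envelope_frontier that)
  qed
  moreover have "envelope w + - G w \<le> 0" if w: "w \<in> D" for w
  proof (rule bounded_type_maximum_principle[OF bt q_psh_add[OF subsolutionsD(1)[OF envelope_subsolution] psh(2) lt] _ _ w])
    show "envelope z + - G z \<le> M + B" if "z \<in> D" for z
      using B[OF D_sub[OF that]] envelope_bounds(2)[OF D_sub[OF that]] by simp
    show "\<forall>\<^sub>F w in inf (nhds p) (principal D). envelope w + - G w < 0 + e" if "p \<in> frontier D" "e > 0" for p e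
      by (rule boundary[OF _ that(1) _ that(2)]) (auto intro!: continuous_intros contG contE simp: Gf envelope_frontier that)
  qed
  ultimately have "G w = envelope w" if "w \<in> D" for w
    using that by (metis add.right_inverse add_le_cancel_right antisym add_uminus_conv_diff diff_le_0_iff_le)
  then show ?thesis
    using closure_cases[OF z] Gf envelope_frontier by auto
qed

end

text \<open>The supremum of \<open>f\<close> is taken in \<open>ereal\<close>, where an empty
  frontier gives \<open>-\<infinity>\<close>; then \<open>0 \<le> M\<close> is what makes
  \<open>0 \<le> \<Phi> z \<le> M\<close> possible. Uniqueness is stated among bounded functions
  because of functions such as \<open>Re z\<close> on a half-plane.\<close>

theorem theorem4p19:
  fixes D :: "(complex^'n) set" and f :: "complex^'n \<Rightarrow> real" and M :: real and q r :: nat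
  assumes "r \<le> CARD('n) - 1" and "r \<le> q" and "q \<le> CARD('n) - r - 1"
    and "open D" and "connected D" and "D \<noteq> {}" and "\<not> bounded D"
    and "\<forall>p\<in>frontier D. peak_point r D p"
    and "continuous_on (frontier D) f"
    and "\<forall>z\<in>frontier D. 0 \<le> f z"
    and "(SUP z\<in>frontier D. ereal (f z)) \<le> ereal M" and "0 \<le> M"
  shows "\<exists>\<Phi> :: complex^'n \<Rightarrow> real.
     almost_bremermann_closure q D \<Phi> \<and>
     (\<forall>z\<in>frontier D. \<Phi> z = f z) \<and> (\<forall>z\<in>closure D. 0 \<le> \<Phi> z \<and> \<Phi> z \<le> M) \<and>
     (\<forall>\<psi> :: complex^'n \<Rightarrow> ereal.
        q_psh q D \<psi> \<and> usc_on (closure D) \<psi> \<and>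
        (\<forall>z\<in>frontier D. \<psi> z \<le> ereal (f z)) \<and> (\<forall>z\<in>closure D. \<psi> z \<le> ereal M)
        \<longrightarrow> (\<forall>z\<in>closure D. \<psi> z \<le> ereal (\<Phi> z))) \<and>
     (\<forall>z\<in>closure D. perron_bremermann f q D (ereal M) z \<le> ereal (\<Phi> z)) \<and>
     (\<forall>p\<in>frontier D. continuous (at p within closure D) \<Phi>) \<and>
     (bounded_type D \<longrightarrow>
        bremermann_closure q D \<Phi> \<and>
        (\<forall>z\<in>closure D.
           ereal (\<Phi> z) = perron_bremermann f q D (SUP w\<in>frontier D. ereal (f w)) z)) \<and>
     (bounded_type D \<longrightarrow>
        (\<forall>G :: complex^'n \<Rightarrow> real.
           bremermann_closure q D G \<and> bounded (G ` closure D) \<and> (\<forall>z\<in>frontier D. G z = f z)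
           \<longrightarrow> (\<forall>z\<in>closure D. G z = \<Phi> z)))"
proof -
  have "f z \<le> M" if "z \<in> frontier D" for z
    using SUP_upper[OF that, of "\<lambda>z. ereal (f z)"] assms(11) by (metis ereal_less_eq(3) order_trans)
  \<comment> \<open>Subtraction is truncated, so the bound on \<open>q\<close> is read together with
    \<open>r \<le> CARD('n) - 1\<close>, which keeps \<open>CARD('n) - r - 1\<close> a true
    difference.\<close>
  moreover have "q + r < CARD('n)"
    using assms(1,3) zero_less_card_finite[where 'a = 'n] by linarith
  ultimately interpret perron_problem D f M q r
    using assms by unfold_locales auto
  have "continuous (at p within closure D) envelope" if p: "p \<in> frontier D" for p
    using envelope_tendsto_frontier[OF p] tendsto_at_within_iff_nhds[OF frontier_sub[OF p], of envelope]
    by (simp add: continuous_within)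
  then show ?thesis
    using almost_bremermann_envelope envelope_frontier envelope_bounds envelope_maximal
      perron_le_envelope[OF _ order_refl] envelope_continuous(1) envelope_eq_perron bremermann_unique
    by (intro exI[of _ envelope]) (auto simp: bremermann_closure_def)
qed

end
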